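(* Let $n\ge 1$ be an integer, $0<s<1$, $0<\alpha<1$, $Q=Q_2(0,0)$ and $\tilde Q=Q_1(0,0)$. There exists a positive constant $C$, independent of $f$, such that the following holds. Let $f\in C^{\alpha,\alpha/2}_{x,t}(Q)$, let $f_Q=f$ on $Q$ and $f_Q=0$ on $Q^c$, and let $$w(x,t)=\int_{-\infty}^t\int_{\mathbb{R}^n} f_Q(y,\tau)\,G(x-y,t-\tau)\,dy\,d\tau .$$ Then $$\|w\|_{C^{2s+\alpha,s+\alpha/2}_{x,t}(\tilde Q)}\le C\|f\|_{C^{\alpha,\alpha/2}_{x,t}(Q)}\quad\text{if } 2s+\alpha<1\text{ or }1<2s+\alpha<2;$$ $$\|w\|_{C^{\log L,s+\alpha/2}_{x,t}(\tilde Q)}\le C\|f\|_{C^{\alpha,\alpha/2}_{x,t}(Q)}\quad\text{if } 2s+\alpha=1;$$ $$\|w\|_{C^{1+\log L,\log L}_{x,t}(\tilde Q)}\le C\|f\|_{C^{\alpha,\alpha/2}_{x,t}(Q)}\quad\text{if } 2s+\alpha=2.$$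
   Context: $Q_r(x^o,t_o)=\{(x,t)\in\mathbb{R}^n\times\mathbb{R}: |x-x^o|<r,\ |t-t_o|<r^2\}$. $G(x,t)=\dfrac{C_{n,s}}{t^{n/2+1-s}}e^{-\frac{|x|^2}{4t}}$ for $t>0$, with $C_{n,s}=\frac{1}{(4\pi)^{n/2}|\Gamma(-s)|}$. Parabolic Hölder spaces on a cylinder $\Omega$: (i) if $0<\beta\le\frac12$, $u\in C^{2\beta,\beta}_{x,t}(\Omega)$ means $u$ is bounded and $|u(x,t)-u(y,\tau)|\le K(|x-y|+|t-\tau|^{1/2})^{2\beta}$ on $\Omega$ for some $K$; the norm is $\sup|u|$ plus the least $K$. (ii) If $\frac12<\beta\le 1$, $u\in C^{2\beta,\beta}_{x,t}(\Omega)$ means $u$ and $\nabla_x u$ are bounded, $u$ is $\beta$-Hölder in $t$ uniformly in $x$, and $\nabla_x u$ is $(2\beta-1)$-Hölder in $x$ uniformly in $t$ and $(\beta-\frac12)$-Hölder in $t$ uniformly in $x$; the norm is the sum of the corresponding sup norms and Hölder seminorms. Log-Lipschitz spaces: $\|g\|_{C^{\log L}(D)}=\|g\|_{L^\infty(D)}+\sup_{x\ne y\in D}\dfrac{|g(x)-g(y)|}{|x-y|\,|\log\min\{|x-y|,1/2\}|}$; $C^{1+\log L}$ consists of bounded functions whose first derivatives are in $C^{\log L}$. $C^{\log L,\gamma}_{x,t}(\Omega)$: $u$ is $C^{\log L}$ in $x$ uniformly in $t$ and $C^\gamma$ in $t$ uniformly in $x$. $C^{1+\log L,\log L}_{x,t}(\Omega)$: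 $u$ is $C^{1+\log L}$ in $x$ uniformly in $t$ and $C^{\log L}$ in $t$ uniformly in $x$. Each has the corresponding norm. *)

theory Defs
  imports "HOL-Analysis.Analysis"
begin

definition par_cylinder :: "real \<Rightarrow> 'a::real_normed_vector \<Rightarrow> real \<Rightarrow> ('a \<times> real) set" where
  "par_cylinder r x0 t0 = {(x, t). norm (x - x0) < r \<and> \<bar>t - t0\<bar> < r\<^sup>2}"

definition kernel_G :: "real \<Rightarrow> real ^ 'n::finite \<Rightarrow> real \<Rightarrow> real" where
  "kernel_G s x t =
     (if t > 0
      then (1 / ((4 * pi) powr (real CARD('n) / 2) * \<bar>Gamma (- s)\<bar>))
             / t powr (real CARD('n) / 2 + 1 - s) * exp (- (norm x)\<^sup>2 / (4 * t))
      else 0)"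

definition heat_potential ::
    "real \<Rightarrow> ((real ^ 'n::finite) \<times> real \<Rightarrow> real) \<Rightarrow> (real ^ 'n) \<times> real \<Rightarrow> real" where
  "heat_potential s g = (\<lambda>(x, t).
     (LINT \<tau>:{..<t}|lborel. (LINT y|lborel. g (y, \<tau>) * kernel_G s (x - y) (t - \<tau>))))"

definition zero_ext :: "'b set \<Rightarrow> ('b \<Rightarrow> 'c::zero) \<Rightarrow> 'b \<Rightarrow> 'c" where
  "zero_ext \<Omega> f = (\<lambda>p. if p \<in> \<Omega> then f p else 0)"

text \<open>
  Regularity in the space variable uniformly in time, and in time uniformly in space, is
  expressed by letting the two compared points range over pairs that share the other
  coordinate. On such pairs the product distance \<^const>\<open>dist\<close> is \<open>\<bar>x - y\<bar>\<close>, respectively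
  \<open>\<bar>t - \<tau>\<bar>\<close>.
\<close>

definition space_pairs :: "('a \<times> real) set \<Rightarrow> (('a \<times> real) \<times> ('a \<times> real)) set" where
  "space_pairs \<Omega> = {(p, q). p \<in> \<Omega> \<and> q \<in> \<Omega> \<and> snd p = snd q}"

definition time_pairs :: "('a \<times> real) set \<Rightarrow> (('a \<times> real) \<times> ('a \<times> real)) set" where
  "time_pairs \<Omega> = {(p, q). p \<in> \<Omega> \<and> q \<in> \<Omega> \<and> fst p = fst q}"

definition par_dist :: "'a::real_normed_vector \<times> real \<Rightarrow> 'a \<times> real \<Rightarrow> real" where
  "par_dist p q = norm (fst p - fst q) + sqrt \<bar>snd p - snd q\<bar>"

definition sup_norm :: "'b set \<Rightarrow> ('b \<Rightarrow> 'c::real_normed_vector) \<Rightarrow> real" where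
  "sup_norm \<Omega> u = (SUP p\<in>\<Omega>. norm (u p))"

definition hoelder_consts ::
    "('b \<times> 'b) set \<Rightarrow> ('b \<Rightarrow> 'b \<Rightarrow> real) \<Rightarrow> real \<Rightarrow> ('b \<Rightarrow> 'c::real_normed_vector) \<Rightarrow> real set" where
  "hoelder_consts S d a u =
     {K. 0 \<le> K \<and> (\<forall>(p, q)\<in>S. norm (u p - u q) \<le> K * d p q powr a)}"

definition hoelder_seminorm ::
    "('b \<times> 'b) set \<Rightarrow> ('b \<Rightarrow> 'b \<Rightarrow> real) \<Rightarrow> real \<Rightarrow> ('b \<Rightarrow> 'c::real_normed_vector) \<Rightarrow> real" where
  "hoelder_seminorm S d a u = Inf (hoelder_consts S d a u)"

definition loglip_quotients ::
    "('b \<times> 'b) set \<Rightarrow> ('b::metric_space \<Rightarrow> 'c::real_normed_vector) \<Rightarrow> real set" where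
  "loglip_quotients S u =
     {norm (u p - u q) / (dist p q * \<bar>ln (min (dist p q) (1/2))\<bar>) | p q. (p, q) \<in> S \<and> p \<noteq> q}"

definition loglip_seminorm ::
    "('b \<times> 'b) set \<Rightarrow> ('b::metric_space \<Rightarrow> 'c::real_normed_vector) \<Rightarrow> real" where
  "loglip_seminorm S u = Sup (loglip_quotients S u)"

definition has_grad_on :: "('a::real_inner \<times> real) set \<Rightarrow> ('a \<times> real \<Rightarrow> real) \<Rightarrow> bool" where
  "has_grad_on \<Omega> u \<longleftrightarrow> (\<forall>(x, t)\<in>\<Omega>. \<exists>D. GDERIV (\<lambda>y. u (y, t)) x :> D)"

definition grad_x :: "('a::real_inner \<times> real \<Rightarrow> real) \<Rightarrow> 'a \<times> real \<Rightarrow> 'a" where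
  "grad_x u = (\<lambda>(x, t). THE D. GDERIV (\<lambda>y. u (y, t)) x :> D)"

text \<open>
  \<open>par_hoelder \<beta> \<Omega>\<close> is the space with exponents \<open>2\<beta>\<close> in \<open>x\<close> and \<open>\<beta>\<close> in \<open>t\<close>, for
  \<open>0 < \<beta> \<le> 1\<close> and open \<open>\<Omega>\<close>. The norms below are the intended ones only for members of the
  corresponding spaces, since real-valued suprema and infima are used.
\<close>

definition par_hoelder :: "real \<Rightarrow> ('a::real_inner \<times> real) set \<Rightarrow> ('a \<times> real \<Rightarrow> real) set" where
  "par_hoelder \<beta> \<Omega> =
     (if \<beta> \<le> 1/2
      then {u. bounded (u ` \<Omega>) \<and> hoelder_consts (\<Omega> \<times> \<Omega>) par_dist (2 * \<beta>) u \<noteq> {}}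
      else {u. bounded (u ` \<Omega>) \<and> has_grad_on \<Omega> u \<and> bounded (grad_x u ` \<Omega>)
             \<and> hoelder_consts (time_pairs \<Omega>) dist \<beta> u \<noteq> {}
             \<and> hoelder_consts (space_pairs \<Omega>) dist (2 * \<beta> - 1) (grad_x u) \<noteq> {}
             \<and> hoelder_consts (time_pairs \<Omega>) dist (\<beta> - 1/2) (grad_x u) \<noteq> {}})"

definition par_hoelder_norm ::
    "real \<Rightarrow> ('a::real_inner \<times> real) set \<Rightarrow> ('a \<times> real \<Rightarrow> real) \<Rightarrow> real" where
  "par_hoelder_norm \<beta> \<Omega> u =
     (if \<beta> \<le> 1/2
      then sup_norm \<Omega> u + hoelder_seminorm (\<Omega> \<times> \<Omega>) par_dist (2 * \<beta>) u
      else sup_norm \<Omega> u + sup_norm \<Omega> (grad_x u)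
             + hoelder_seminorm (time_pairs \<Omega>) dist \<beta> u
             + hoelder_seminorm (space_pairs \<Omega>) dist (2 * \<beta> - 1) (grad_x u)
             + hoelder_seminorm (time_pairs \<Omega>) dist (\<beta> - 1/2) (grad_x u))"

definition par_loglip :: "real \<Rightarrow> ('a::real_inner \<times> real) set \<Rightarrow> ('a \<times> real \<Rightarrow> real) set" where
  "par_loglip \<gamma> \<Omega> =
     {u. bounded (u ` \<Omega>)
       \<and> bdd_above (loglip_quotients (space_pairs \<Omega>) u)
       \<and> hoelder_consts (time_pairs \<Omega>) dist \<gamma> u \<noteq> {}}"

definition par_loglip_norm ::
    "real \<Rightarrow> ('a::real_inner \<times> real) set \<Rightarrow> ('a \<times> real \<Rightarrow> real) \<Rightarrow> real" where
  "par_loglip_norm \<gamma> \<Omega> u =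
     sup_norm \<Omega> u + loglip_seminorm (space_pairs \<Omega>) u
       + hoelder_seminorm (time_pairs \<Omega>) dist \<gamma> u"

definition par_C1_loglip :: "('a::real_inner \<times> real) set \<Rightarrow> ('a \<times> real \<Rightarrow> real) set" where
  "par_C1_loglip \<Omega> =
     {u. bounded (u ` \<Omega>) \<and> has_grad_on \<Omega> u \<and> bounded (grad_x u ` \<Omega>)
       \<and> bdd_above (loglip_quotients (space_pairs \<Omega>) (grad_x u))
       \<and> bdd_above (loglip_quotients (time_pairs \<Omega>) u)}"

definition par_C1_loglip_norm ::
    "('a::real_inner \<times> real) set \<Rightarrow> ('a \<times> real \<Rightarrow> real) \<Rightarrow> real" where
  "par_C1_loglip_norm \<Omega> u =
     sup_norm \<Omega> u + sup_norm \<Omega> (grad_x u)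
       + loglip_seminorm (space_pairs \<Omega>) (grad_x u)
       + loglip_seminorm (time_pairs \<Omega>) u"

end

(*
Write G(z,r) = c r^(s-1) p_r(z) with p_r a Gaussian of variance proportional to r, and let g be the
zero extension of f. For x in the unit ball, |g(y,tau) - g(x,tau)| <= N |x-y|^alpha holds for every y,
inside or outside the support, because a point outside is at distance at least 1 from x; N is the norm
of f. So no cutoff is needed. Finite differences of G (in space, in time, or second order Taylor
remainders) are dominated by Gaussians, and they annihilate constants in the space variable, or
reduce on constants to the one-dimensional kernel r^(s-1). Hence g(y,tau) may be replaced by
g(y,tau) - g(x,tau), and each space integral gains a factor r^(alpha/2). What remains are integrals in
r = t - tau of powers of r, split at r = |x-x'|^2 or r = |t-t'|; they are finite powers of the
splitting point, except that a logarithm appears when 2s + alpha is 1 or 2.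
*)
theory Submission
  imports Defs "HOL-Probability.Distributions"
begin

section \<open>Gaussian integrals\<close>

text \<open>Three obstacles shape the estimates. A kernel increment is dominated by one Gaussian at
  the base point only while the spatial step is at most \<open>sqrt r\<close>, or the time step at
  most \<open>r\<close>. For smaller \<open>r\<close> the terms must be estimated separately, so the
  splitting is forced by the kernel bounds.

  In time, the mass of the kernel, a multiple of r^(s-1), changes, so constants survive the
  difference. The result, a multiple of (t+4)^s - (t'+4)^s, is Lipschitz because t and t' stay in
  (-1,1), far from the jump of the zero extension at \<tau> = -4.

  The candidate gradient integrates in y first, where cancellation gives order r^(s-3/2+\<alpha>/2),
  integrable in time once 2s + \<alpha> > 1. It is identified afterwards by a Taylor remainder of
  order greater than 1.\<close>

lemma integrable_gaussian_real:
  fixes a :: real assumes "a > 0"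
  shows "integrable lborel (\<lambda>x::real. exp (- (a * x\<^sup>2)))"
proof -
  define \<sigma> where "\<sigma> = sqrt (1 / (2 * a))"
  have \<sigma>: "\<sigma> > 0" "\<sigma>\<^sup>2 = 1 / (2 * a)" using assms by (auto simp: \<sigma>_def)
  have "integrable lborel (\<lambda>x. sqrt (2 * pi * \<sigma>\<^sup>2) * normal_density 0 \<sigma> x)"
    using \<sigma> by (intro integrable_mult_right integrable_normal_density) auto
  moreover have "sqrt (2 * pi * \<sigma>\<^sup>2) * normal_density 0 \<sigma> x = exp (- (a * x\<^sup>2))" for x
    using \<sigma> assms by (simp add: normal_density_def field_simps)
  ultimately show ?thesis by simp
qed

text \<open>Tonelli over the coordinates: the squared norm splits over \<open>Basis\<close>, and
  each factor is a multiple of a normal density.\<close>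

lemma integrable_gaussian:
  fixes a :: real assumes "a > 0"
  shows "integrable lborel (\<lambda>x::'a::euclidean_space. exp (- (a * (norm x)\<^sup>2)))"
proof (rule integrableI_nonneg)
  have eq: "exp (- (a * (norm x)\<^sup>2)) = (\<Prod>b\<in>Basis. exp (- (a * (x \<bullet> b)\<^sup>2)))" for x :: 'a
  proof -
    have "(norm x)\<^sup>2 = (\<Sum>b\<in>Basis. (x \<bullet> b)\<^sup>2)"
      by (metis (no_types, lifting) dot_square_norm euclidean_inner power2_eq_square sum.cong)
    then show ?thesis by (simp add: exp_sum[symmetric] sum_distrib_left sum_negf)
  qed
  have "(\<integral>\<^sup>+x. ennreal (exp (- (a * (norm (x::'a))\<^sup>2))) \<partial>lborel)
      = (\<integral>\<^sup>+x. (\<Prod>b\<in>Basis. ennreal (exp (- (a * ((x::'a) \<bullet> b)\<^sup>2)))) \<partial>lborel)"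
    by (simp only: eq prod_ennreal[symmetric] exp_ge_zero)
  also have "\<dots> = (\<Prod>b\<in>(Basis::'a set). \<integral>\<^sup>+x. ennreal (exp (- (a * x\<^sup>2))) \<partial>lborel)"
    by (subst nn_integral_lborel_prod[where f="\<lambda>b x. ennreal (exp (- (a * x\<^sup>2)))"]) auto
  also have "\<dots> < \<infinity>"
    using integrable_gaussian_real[OF assms] 
    by (simp add: nn_integral_eq_integral ennreal_power[symmetric] power_less_top_ennreal)
  finally show "(\<integral>\<^sup>+x. ennreal (exp (- (a * (norm (x::'a))\<^sup>2))) \<partial>lborel) < \<infinity>" .
qed auto

lemma lborel_integrable_affine_iff:
  fixes f :: "'a::euclidean_space \<Rightarrow> 'b::{banach,second_countable_topology}"
  assumes "c \<noteq> 0" "f \<in> borel_measurable borel"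
  shows "integrable lborel (\<lambda>x. f (t + c *\<^sub>R x)) \<longleftrightarrow> integrable lborel f"
proof -
  have "integrable lborel f \<longleftrightarrow> integrable (density (distr lborel borel (\<lambda>x. t + c *\<^sub>R x)) (\<lambda>_. ennreal (\<bar>c\<bar>^DIM('a)))) f"
    using lborel_affine[OF assms(1), of t] by (simp add: ennreal_power)
  also have "\<dots> \<longleftrightarrow> integrable lborel (\<lambda>x. \<bar>c\<bar>^DIM('a) *\<^sub>R f (t + c *\<^sub>R x))"
    using assms by (subst integrable_density) (auto simp: integrable_distr_eq)
  also have "\<dots> \<longleftrightarrow> integrable lborel (\<lambda>x. f (t + c *\<^sub>R x))"
    using Bochner_Integration.integrable_scaleR_right
        [where c="inverse (\<bar>c\<bar>^DIM('a))" and f="\<lambda>x. \<bar>c\<bar>^DIM('a) *\<^sub>R f (t + c *\<^sub>R x)" and M=lborel] assms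
    by auto
  finally show ?thesis ..
qed

lemma lborel_integral_affine:
  fixes f :: "'a::euclidean_space \<Rightarrow> 'b::{banach,second_countable_topology}"
  assumes "c \<noteq> 0" "f \<in> borel_measurable borel"
  shows "(\<integral>x. f x \<partial>lborel) = \<bar>c\<bar>^DIM('a) *\<^sub>R (\<integral>x. f (t + c *\<^sub>R x) \<partial>lborel)"
proof -
  have "integral\<^sup>L lborel f = integral\<^sup>L (density (distr lborel borel (\<lambda>x. t + c *\<^sub>R x)) (\<lambda>_. ennreal (\<bar>c\<bar>^DIM('a)))) f"
    using lborel_affine[OF assms(1), of t] by (simp add: ennreal_power)
  also have "\<dots> = \<bar>c\<bar>^DIM('a) *\<^sub>R (\<integral>x. f (t + c *\<^sub>R x) \<partial>lborel)"
    using assms by (subst integral_density) (auto simp: integral_distr)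
  finally show ?thesis .
qed

text \<open>
  The width \<open>b\<close> grows along the argument: the kernel has width 4, absorbing polynomial factors
  costs 8, moving the base point or the time costs 16, and the Hoelder weight costs 32.
\<close>

definition gauss :: "real \<Rightarrow> 'a::euclidean_space \<Rightarrow> real \<Rightarrow> real" where
  "gauss b z r = r powr (- (real DIM('a) / 2)) * exp (- (norm z)\<^sup>2 / (b * r))"

lemma gauss_nonneg [simp]: "0 \<le> gauss b z r" by (simp add: gauss_def)

lemma gauss_measurable [measurable]:
  assumes "f \<in> borel_measurable M" "g \<in> borel_measurable M"
  shows "(\<lambda>x. gauss b (f x) (g x)) \<in> borel_measurable M"
  unfolding gauss_def using assms by measurable

definition gauss_mass :: "'a::euclidean_space itself \<Rightarrow> real \<Rightarrow> real" where
  "gauss_mass _ b = (\<integral>z. exp (- (norm (z::'a))\<^sup>2 / b) \<partial>lborel)"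

lemma gauss_mass_nonneg [simp]: "0 \<le> gauss_mass T b"
  by (simp add: gauss_mass_def)

lemma integrable_gauss_mass:
  "b > 0 \<Longrightarrow> integrable lborel (\<lambda>z::'a::euclidean_space. exp (- (norm z)\<^sup>2 / b))"
  using integrable_gaussian[of "1/b", where 'a='a] by simp

lemma gauss_mass_mono:
  assumes "0 < b" "b \<le> c"
  shows "gauss_mass TYPE('a::euclidean_space) b \<le> gauss_mass TYPE('a) c"
  unfolding gauss_mass_def using assms 
  by (intro integral_mono integrable_gauss_mass) (auto intro: divide_left_mono)

text \<open>The substitution y = x + sqrt r z removes \<open>r\<close>: the Jacobian
  \<open>sqrt r ^ DIM('a)\<close> cancels the prefactor of \<open>gauss\<close>, so the mass depends
  on the width alone.\<close>

lemma gauss_integral: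
  fixes x :: "'a::euclidean_space"
  assumes "r > 0" "b > 0"
  shows "integrable lborel (\<lambda>y. gauss b (x - y) r)"
    and "(\<integral>y. gauss b (x - y) r \<partial>lborel) = gauss_mass TYPE('a) b"
proof -
  have eq: "gauss b (- (sqrt r *\<^sub>R z)) r = r powr (- (real DIM('a) / 2)) * exp (- (norm z)\<^sup>2 / b)" for z :: 'a
    using assms by (simp add: gauss_def power_mult_distrib)
  have i: "integrable lborel (\<lambda>z::'a. exp (- (norm z)\<^sup>2 / b))"
    by (rule integrable_gauss_mass[OF assms(2)])
  show "integrable lborel (\<lambda>y. gauss b (x - y) r)"
    by (subst lborel_integrable_affine_iff[of "sqrt r" _ x, symmetric])
       (use assms i in \<open>auto simp: eq simp del: diff_add_cancel\<close>)
  have "sqrt r ^ DIM('a) * r powr (- (real DIM('a) / 2)) = 1"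
    using assms by (simp add: powr_half_sqrt[symmetric] powr_realpow[symmetric] powr_powr powr_add[symmetric])
  then show "(\<integral>y. gauss b (x - y) r \<partial>lborel) = gauss_mass TYPE('a) b"
    unfolding gauss_mass_def
    by (subst lborel_integral_affine[of "sqrt r" _ x])
       (use assms in \<open>auto simp: eq simp del: diff_add_cancel simp flip: mult.assoc\<close>)
qed

text \<open>One crude constant for all powers: v^k \<le> 1 + v^4, and with x = v^2/b one has v^4 =
  b^2 x^2 \<le> 2 b^2 e^x. The widths 8 and 32 give the values 129 and 2049.\<close>

lemma power_exp_bound:
  fixes v :: real
  assumes "v \<ge> 0" "b > 0" "k \<le> 4"
  shows "v ^ k * exp (- v\<^sup>2 / b) \<le> 1 + 2 * b\<^sup>2"
proof -
  define x where "x = v\<^sup>2 / b"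
  have x: "x \<ge> 0" using assms by (simp add: x_def)
  have "v ^ k \<le> 1 + v ^ 4"
  proof (cases "v \<le> 1")
    case True then show ?thesis using assms power_le_one[of v k] by (smt (verit) zero_le_power)
  next
    case False then show ?thesis using power_increasing[of k 4 v] assms by (simp add: add_increasing)
  qed
  also have "v ^ 4 = b\<^sup>2 * x\<^sup>2" using assms by (simp add: x_def power_divide flip: power_mult)
  finally have "v ^ k \<le> 1 + b\<^sup>2 * x\<^sup>2" .
  moreover have "x\<^sup>2 \<le> 2 * exp x" using exp_lower_Taylor_quadratic[OF x] x by simp
  moreover have "1 \<le> exp x" using x by simp
  ultimately have "v ^ k \<le> exp x + b\<^sup>2 * (2 * exp x)"
    by (smt (verit) mult_left_mono zero_le_power2)
  then have "v ^ k * exp (- x) \<le> (exp x + b\<^sup>2 * (2 * exp x)) * exp (- x)"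
    by (intro mult_right_mono) auto
  also have "\<dots> = 1 + 2 * b\<^sup>2" by (simp add: algebra_simps flip: exp_add)
  finally show ?thesis by (simp add: x_def)
qed

text \<open>In the scaled variable v = |z| / sqrt r, half of the exponential absorbs the weight and
  the other half is the wider Gaussian. Since v^\<alpha> \<le> 1 + v, \<open>power_exp_bound\<close>
  is used twice with width 32, whence 4098 = 2 * 2049.\<close>

lemma powr_gauss_bound:
  fixes z :: "'a::euclidean_space"
  assumes "r > 0" "0 \<le> \<alpha>" "\<alpha> \<le> 1"
  shows "norm z powr \<alpha> * gauss 16 z r \<le> 4098 * r powr (\<alpha>/2) * gauss 32 z r"
proof -
  define v where "v = norm z / sqrt r"
  have v: "v \<ge> 0" "norm z = sqrt r * v" using assms by (auto simp: v_def)
  have z2: "(norm z)\<^sup>2 = r * v\<^sup>2" using assms v by (simp add: power_mult_distrib)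
  have va: "v powr \<alpha> \<le> 1 + v"
  proof (cases "v \<le> 1")
    case True then show ?thesis using v assms by (smt (verit) powr_le1)
  next
    case False then show ?thesis using powr_mono[of \<alpha> 1 v] assms by simp
  qed
  have "v powr \<alpha> * exp (- v\<^sup>2 / 16) = (v powr \<alpha> * exp (- v\<^sup>2 / 32)) * exp (- v\<^sup>2 / 32)"
    by (simp flip: exp_add)
  also have "v powr \<alpha> * exp (- v\<^sup>2 / 32) \<le> v ^ 0 * exp (- v\<^sup>2 / 32) + v ^ 1 * exp (- v\<^sup>2 / 32)"
    using mult_right_mono[OF va, of "exp (- v\<^sup>2 / 32)"] by (simp add: distrib_right)
  also have "\<dots> \<le> 4098" using power_exp_bound[of v 32 0] power_exp_bound[of v 32 1] v by simp
  finally have "v powr \<alpha> * exp (- v\<^sup>2 / 16) \<le> 4098 * exp (- v\<^sup>2 / 32)" by simp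
  from mult_left_mono[OF this, of "r powr (\<alpha>/2) * r powr (- (real DIM('a) / 2))"]
  show ?thesis using assms v z2
    by (simp add: gauss_def powr_mult powr_half_sqrt[symmetric] powr_powr mult_ac)
qed

lemma gauss_bounded_integral:
  fixes K :: "'a::euclidean_space \<Rightarrow> 'b::{banach,second_countable_topology}"
  assumes "r > 0" "\<phi> \<in> borel_measurable borel" "K \<in> borel_measurable borel"
    and K: "\<And>y. norm (K y) \<le> A * gauss 16 (x - y) r" and \<phi>: "\<And>y. \<bar>\<phi> y\<bar> \<le> M"
  shows "integrable lborel (\<lambda>y. \<phi> y *\<^sub>R K y)"
    and "norm (\<integral>y. \<phi> y *\<^sub>R K y \<partial>lborel) \<le> gauss_mass TYPE('a) 16 * (M * A)"
proof -
  have bd: "norm (\<phi> y *\<^sub>R K y) \<le> M * A * gauss 16 (x - y) r" for y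
  proof -
    have "\<bar>\<phi> y\<bar> * norm (K y) \<le> M * (A * gauss 16 (x - y) r)"
      using K \<phi> by (intro mult_mono) (auto intro: order_trans[OF norm_ge_zero] order_trans[OF abs_ge_zero])
    then show ?thesis by simp
  qed
  have i: "integrable lborel (\<lambda>y. M * A * gauss 16 (x - y) r)"
    using gauss_integral(1)[OF assms(1), of 16 x] by simp
  show *: "integrable lborel (\<lambda>y. \<phi> y *\<^sub>R K y)"
    using assms bd by (intro Bochner_Integration.integrable_bound[OF i]) (auto intro!: AE_I2 order_trans[OF bd] simp del: norm_scaleR)
  have "norm (\<integral>y. \<phi> y *\<^sub>R K y \<partial>lborel) \<le> (\<integral>y. M * A * gauss 16 (x - y) r \<partial>lborel)"
    by (rule Bochner_Integration.integral_norm_bound_integral[OF * i bd])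
  then show "norm (\<integral>y. \<phi> y *\<^sub>R K y \<partial>lborel) \<le> gauss_mass TYPE('a) 16 * (M * A)"
    using gauss_integral(2)[OF assms(1), of 16 x] by (simp add: mult_ac)
qed

lemma gauss_hoelder_integral:
  fixes K :: "'a::euclidean_space \<Rightarrow> 'b::{banach,second_countable_topology}"
  assumes "r > 0" "0 \<le> \<alpha>" "\<alpha> \<le> 1" "A \<ge> 0" "L \<ge> 0"
    and K: "\<And>y. norm (K y) \<le> A * gauss 16 (x - y) r" 
    and \<phi>: "\<And>y. \<bar>\<phi> y\<bar> \<le> L * norm (x - y) powr \<alpha>"
  shows "norm (\<integral>y. \<phi> y *\<^sub>R K y \<partial>lborel)
           \<le> 4098 * gauss_mass TYPE('a) 32 * (L * A * r powr (\<alpha>/2))"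
proof (cases "integrable lborel (\<lambda>y. \<phi> y *\<^sub>R K y)")
  \<comment> \<open>The Bochner integral of a non-integrable function is 0, so the bound reduces to
    nonnegativity of its right-hand side.\<close>
  case False
  then show ?thesis using assms by (simp add: not_integrable_integral_eq)
next
  case True
  have bd: "norm (\<phi> y *\<^sub>R K y) \<le> 4098 * (L * A * r powr (\<alpha>/2)) * gauss 32 (x - y) r" for y
  proof -
    have "\<bar>\<phi> y\<bar> * norm (K y) \<le> (L * norm (x - y) powr \<alpha>) * (A * gauss 16 (x - y) r)"
      using K \<phi> assms by (intro mult_mono) auto
    also have "\<dots> = L * A * (norm (x - y) powr \<alpha> * gauss 16 (x - y) r)" by simp
    also have "\<dots> \<le> L * A * (4098 * r powr (\<alpha>/2) * gauss 32 (x - y) r)"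
      using assms by (intro mult_left_mono powr_gauss_bound) auto
    finally show ?thesis by (simp add: mult_ac)
  qed
  have i: "integrable lborel (\<lambda>y. 4098 * (L * A * r powr (\<alpha>/2)) * gauss 32 (x - y) r)"
    using gauss_integral(1)[OF assms(1), of 32 x] by simp
  have "norm (\<integral>y. \<phi> y *\<^sub>R K y \<partial>lborel) \<le> (\<integral>y. 4098 * (L * A * r powr (\<alpha>/2)) * gauss 32 (x - y) r \<partial>lborel)"
    by (rule Bochner_Integration.integral_norm_bound_integral[OF True i bd])
  then show ?thesis
    using gauss_integral(2)[OF assms(1), of 32 x] by (simp add: mult_ac)
qed

section \<open>Pointwise bounds for the kernel\<close>

text \<open>The kernel G without its normalizing constant. The value 0 at nonpositive elapsed times
  lets the integrals over source times run over the whole line.\<close>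

definition hk :: "real \<Rightarrow> 'a::euclidean_space \<Rightarrow> real \<Rightarrow> real" where
  "hk s z r = (if r > 0 then r powr (s - 1) * gauss 4 z r else 0)"

definition grad_hk :: "real \<Rightarrow> 'a::euclidean_space \<Rightarrow> real \<Rightarrow> 'a" where
  "grad_hk s z r = - (hk s z r / (2 * r)) *\<^sub>R z"

lemma hk_measurable [measurable]:
  assumes [measurable]: "f \<in> borel_measurable M" "g \<in> borel_measurable M"
  shows "(\<lambda>x. hk s (f x) (g x)) \<in> borel_measurable M"
  unfolding hk_def by measurable

lemma grad_hk_measurable [measurable]:
  assumes [measurable]: "f \<in> borel_measurable M" "g \<in> borel_measurable M"
  shows "(\<lambda>x. grad_hk s (f x) (g x)) \<in> borel_measurable M"
  unfolding grad_hk_def by measurable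

lemma hk_nonneg [simp]: "0 \<le> hk s z r" by (simp add: hk_def)

lemma hk_nonpos_time: "r \<le> 0 \<Longrightarrow> hk s z r = 0" by (simp add: hk_def)

lemma grad_hk_nonpos_time: "r \<le> 0 \<Longrightarrow> grad_hk s z r = 0" by (simp add: grad_hk_def hk_def)

lemma grad_hk_uminus: "grad_hk s (- z) r = - grad_hk s z r"
  by (simp add: grad_hk_def hk_def gauss_def)

lemma hk_has_derivative:
  assumes "r > 0"
  shows "((\<lambda>z. hk s z r) has_derivative (\<lambda>v. grad_hk s z r \<bullet> v)) (at z within S)"
  unfolding hk_def grad_hk_def gauss_def power2_norm_eq_inner using assms
  by (auto intro!: derivative_eq_intros simp: field_simps inner_commute)

lemma grad_hk_has_derivative:
  assumes "r > 0"
  shows "((\<lambda>z. grad_hk s z r) has_derivative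
     (\<lambda>v. - (hk s z r / (2 * r)) *\<^sub>R v - ((grad_hk s z r \<bullet> v) / (2 * r)) *\<^sub>R z)) (at z within S)"
proof -
  have "((\<lambda>z. - (hk s z r / (2 * r))) has_derivative (\<lambda>v. - ((grad_hk s z r \<bullet> v) / (2 * r)))) (at z within S)"
    using assms by (auto intro!: derivative_eq_intros hk_has_derivative[OF assms])
  from has_derivative_scaleR[OF this has_derivative_ident]
  show ?thesis unfolding grad_hk_def[of s _ r] by simp
qed

lemma hk_has_time_derivative:
  fixes z :: "'a::euclidean_space"
  assumes "r > 0"
  shows "((\<lambda>r. hk s z r) has_real_derivative
     (((s - 1 - real DIM('a) / 2) / r + (norm z)\<^sup>2 / (4 * r\<^sup>2)) * hk s z r)) (at r within S)"
proof -
  define a where "a = s - 1 - real DIM('a) / 2"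
  have eq: "hk s z \<rho> = \<rho> powr a * exp (- (norm z)\<^sup>2 / (4 * \<rho>))" if "\<rho> > 0" for \<rho>
    using that by (simp add: hk_def gauss_def a_def flip: powr_add)
  have "((\<lambda>r. r powr a * exp (- (norm z)\<^sup>2 / (4 * r))) has_real_derivative
     ((a / r + (norm z)\<^sup>2 / (4 * r\<^sup>2)) * hk s z r)) (at r)"
    using assms
    by (auto intro!: derivative_eq_intros simp: eq powr_diff field_simps power2_eq_square)
  then have "((\<lambda>r. hk s z r) has_real_derivative
     ((a / r + (norm z)\<^sup>2 / (4 * r\<^sup>2)) * hk s z r)) (at r)"
    by (rule has_field_derivative_transform_within_open[of _ _ _ "{0<..}"]) (use assms eq in auto)
  then show ?thesis unfolding a_def by (rule has_field_derivative_at_within)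
qed

lemma grad_hk_has_time_derivative:
  fixes z :: "'a::euclidean_space"
  assumes "r > 0"
  shows "((\<lambda>r. grad_hk s z r) has_vector_derivative
     (- ((s - 2 - real DIM('a) / 2) / (2 * r\<^sup>2) + (norm z)\<^sup>2 / (8 * r ^ 3)) * hk s z r) *\<^sub>R z) (at r within S)"
proof -
  have "((\<lambda>r. - (hk s z r / (2 * r))) has_real_derivative
     (- ((s - 2 - real DIM('a) / 2) / (2 * r\<^sup>2) + (norm z)\<^sup>2 / (8 * r ^ 3)) * hk s z r)) (at r within S)"
    using assms
    by (auto intro!: derivative_eq_intros hk_has_time_derivative[OF assms] 
        simp: field_simps power2_eq_square power3_eq_cube)
  from has_vector_derivative_scaleR[OF this has_vector_derivative_const[of z]]
  show ?thesis by (simp add: grad_hk_def[abs_def])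
qed

section \<open>Absorbing powers into wider Gaussians\<close>

lemma power_gauss_bound:
  fixes z :: "'a::euclidean_space"
  assumes "r > 0" "k \<le> 4"
  shows "norm z ^ k * gauss 4 z r \<le> 129 * r powr (k/2) * gauss 8 z r"
proof -
  define v where "v = norm z / sqrt r"
  have v: "v \<ge> 0" "norm z = sqrt r * v" using assms by (auto simp: v_def)
  have z2: "(norm z)\<^sup>2 = r * v\<^sup>2" using assms v by (simp add: power_mult_distrib)
  have "v ^ k * exp (- v\<^sup>2 / 4) = (v ^ k * exp (- v\<^sup>2 / 8)) * exp (- v\<^sup>2 / 8)"
    by (simp flip: exp_add)
  also have "\<dots> \<le> 129 * exp (- v\<^sup>2 / 8)" 
    using power_exp_bound[of v 8 k] v assms by (intro mult_right_mono) auto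
  finally have "v ^ k * exp (- v\<^sup>2 / 4) \<le> 129 * exp (- v\<^sup>2 / 8)" .
  from mult_left_mono[OF this, of "r powr (k/2) * r powr (- (real DIM('a) / 2))"]
  show ?thesis using assms v z2
    by (simp add: gauss_def power_mult_distrib powr_half_sqrt[symmetric] powr_power mult_ac)
qed

lemma power_hk_bound:
  fixes z :: "'a::euclidean_space"
  assumes "r > 0" "k \<le> 4"
  shows "norm z ^ k * hk s z r \<le> 129 * r powr (s - 1 + k/2) * gauss 8 z r"
  using mult_left_mono[OF power_gauss_bound[OF assms, of z], of "r powr (s - 1)"] assms
  by (simp add: hk_def powr_add mult_ac)

text \<open>Derivatives of \<open>hk\<close> are sums of terms of this shape. Parabolic scaling
  counts each factor \<open>norm z\<close> as \<open>sqrt r\<close>, so the order in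
  \<open>r\<close> can be read off from \<open>k\<close> and \<open>j\<close>.\<close>

lemma power_hk_div_bound:
  fixes z :: "'a::euclidean_space"
  assumes "r > 0" "k \<le> 4"
  shows "norm z ^ k * hk s z r / r ^ j \<le> 129 * r powr (s - 1 + k/2 - j) * gauss 8 z r"
proof -
  have "norm z ^ k * hk s z r / r ^ j \<le> (129 * r powr (s - 1 + k/2) * gauss 8 z r) / r ^ j"
    using power_hk_bound[OF assms] assms by (intro divide_right_mono) auto
  also have "\<dots> = 129 * r powr (s - 1 + k/2 - j) * gauss 8 z r"
    using assms by (simp add: powr_diff powr_realpow)
  finally show ?thesis .
qed

section \<open>Size and increments of the kernel and of its gradient\<close>

lemma gauss_8_le_16: "r > 0 \<Longrightarrow> gauss 8 z r \<le> gauss 16 z r"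
  unfolding gauss_def by (intro mult_left_mono) (auto simp: field_simps)

lemma hk_bound:
  assumes "r > 0" 
  shows "hk s z r \<le> 129 * r powr (s - 1) * gauss 16 z r"
proof -
  have "hk s z r \<le> 129 * r powr (s - 1) * gauss 8 z r"
    using power_hk_bound[OF assms, of 0 z s] by simp
  also have "\<dots> \<le> 129 * r powr (s - 1) * gauss 16 z r"
    using gauss_8_le_16[OF assms, of z] by (intro mult_left_mono) auto
  finally show ?thesis .
qed

lemma norm_grad_hk: "r > 0 \<Longrightarrow> norm (grad_hk s z r) = norm z * hk s z r / r / 2"
  by (simp add: grad_hk_def abs_mult field_simps)

lemma grad_hk_bound_8:
  assumes "r > 0" 
  shows "norm (grad_hk s z r) \<le> 129 * r powr (s - 3/2) * gauss 8 z r"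
proof -
  have "norm (grad_hk s z r) \<le> norm z * hk s z r / r" 
    using assms by (simp add: norm_grad_hk field_simps)
  also have "\<dots> \<le> 129 * r powr (s - 3/2) * gauss 8 z r"
    using power_hk_div_bound[OF assms, of 1 z s 1] by (simp add: algebra_simps)
  finally show ?thesis .
qed

lemma grad_hk_bound:
  assumes "r > 0" 
  shows "norm (grad_hk s z r) \<le> 129 * r powr (s - 3/2) * gauss 16 z r"
  using grad_hk_bound_8[OF assms, of s z] gauss_8_le_16[OF assms, of z]
  by (elim order_trans) (intro mult_left_mono, auto)

text \<open>Moving the centre by at most \<open>sqrt r\<close> gives |z|^2 \<le> 2 |\<zeta>|^2 + 2
  r. The first factor 2 doubles the width, the term 2 r costs exp (1/8) \<le> 2.\<close>

lemma gauss_8_near: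
  assumes "r > 0" "(norm (z - \<zeta>))\<^sup>2 \<le> r"
  shows "gauss 8 \<zeta> r \<le> 2 * gauss 16 z r"
proof -
  have "norm z \<le> norm \<zeta> + norm (z - \<zeta>)" by (metis add.commute norm_triangle_sub)
  then have "(norm z)\<^sup>2 \<le> (norm \<zeta> + norm (z - \<zeta>))\<^sup>2" by (intro power_mono) auto
  also have "\<dots> \<le> 2 * (norm \<zeta>)\<^sup>2 + 2 * (norm (z - \<zeta>))\<^sup>2" 
    using sum_squares_bound[of "norm \<zeta>" "norm (z - \<zeta>)"] by (simp add: power2_sum)
  finally have "(norm z)\<^sup>2 \<le> 2 * (norm \<zeta>)\<^sup>2 + 2 * r" using assms by simp
  then have "- (norm \<zeta>)\<^sup>2 / (8 * r) \<le> 1/8 + - (norm z)\<^sup>2 / (16 * r)"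
    using assms by (simp add: field_simps)
  then have "exp (- (norm \<zeta>)\<^sup>2 / (8 * r)) \<le> exp (1/8) * exp (- (norm z)\<^sup>2 / (16 * r))"
    by (simp flip: exp_add)
  also have "exp (1/8::real) \<le> 2" using exp_bound[of "1/8"] by (simp add: power2_eq_square)
  finally have "exp (- (norm \<zeta>)\<^sup>2 / (8 * r)) \<le> 2 * exp (- (norm z)\<^sup>2 / (16 * r))" by simp
  from mult_left_mono[OF this, of "r powr (- (real DIM('a) / 2))"] show ?thesis
    by (simp add: gauss_def mult_ac)
qed

text \<open>Mean value inequality on the ball about \<open>z\<close> through \<open>z'\<close>, on
  all of which \<open>gauss_8_near\<close> replaces the moving Gaussian by the one at
  \<open>z\<close>. Hence 258 = 2 * 129.\<close>

lemma hk_space_diff: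
  fixes z :: "'a::euclidean_space"
  assumes "r > 0" "(norm (z - z'))\<^sup>2 \<le> r"
  shows "norm (hk s z' r - hk s z r) \<le> 258 * norm (z' - z) * r powr (s - 3/2) * gauss 16 z r"
proof -
  have "norm (hk s z' r - hk s z r) \<le> 258 * r powr (s - 3/2) * gauss 16 z r * norm (z' - z)"
  proof (rule differentiable_bound[where S="cball z (norm (z' - z))"])
    fix \<zeta> assume \<zeta>: "\<zeta> \<in> cball z (norm (z' - z))"
    show "((\<lambda>z. hk s z r) has_derivative (\<lambda>v. grad_hk s \<zeta> r \<bullet> v)) (at \<zeta> within cball z (norm (z' - z)))"
      by (rule hk_has_derivative[OF assms(1)])
    have "(norm (z - \<zeta>))\<^sup>2 \<le> (norm (z - z'))\<^sup>2" using \<zeta> by (intro power_mono) (auto simp: dist_norm norm_minus_commute)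
    then have "gauss 8 \<zeta> r \<le> 2 * gauss 16 z r" by (intro gauss_8_near[OF assms(1)] order_trans[OF _ assms(2)])
    then have "129 * r powr (s - 3/2) * gauss 8 \<zeta> r \<le> 129 * r powr (s - 3/2) * (2 * gauss 16 z r)"
      by (intro mult_left_mono) auto
    then have "norm (grad_hk s \<zeta> r) \<le> 258 * r powr (s - 3/2) * gauss 16 z r"
      using order_trans[OF grad_hk_bound_8[OF assms(1), of s \<zeta>]] by simp
    then show "onorm (\<lambda>v. grad_hk s \<zeta> r \<bullet> v) \<le> 258 * r powr (s - 3/2) * gauss 16 z r"
      by (intro onorm_bound) (auto intro: order_trans[OF Cauchy_Schwarz_ineq2 mult_right_mono])
  qed (auto simp: dist_norm norm_minus_commute)
  then show ?thesis by (simp add: mult_ac)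
qed

text \<open>The Hessian of \<open>hk\<close> consists of a multiple of the identity of size hk/(2r)
  and a rank-one part of size |z|^2 hk/(4r^2). Both scale like
  \<open>r powr (s - 2)\<close>.\<close>

lemma grad_hk_space_diff:
  fixes z :: "'a::euclidean_space"
  assumes "r > 0" "(norm (z - z'))\<^sup>2 \<le> r"
  shows "norm (grad_hk s z' r - grad_hk s z r) \<le> 258 * norm (z' - z) * r powr (s - 2) * gauss 16 z r"
proof -
  have "norm (grad_hk s z' r - grad_hk s z r) \<le> 258 * r powr (s - 2) * gauss 16 z r * norm (z' - z)"
  proof (rule differentiable_bound[where S="cball z (norm (z' - z))"])
    fix \<zeta> assume \<zeta>: "\<zeta> \<in> cball z (norm (z' - z))"
    let ?D = "\<lambda>v. - (hk s \<zeta> r / (2 * r)) *\<^sub>R v - ((grad_hk s \<zeta> r \<bullet> v) / (2 * r)) *\<^sub>R \<zeta>"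
    show "((\<lambda>z. grad_hk s z r) has_derivative ?D) (at \<zeta> within cball z (norm (z' - z)))"
      by (rule grad_hk_has_derivative[OF assms(1)])
    have "(norm (z - \<zeta>))\<^sup>2 \<le> (norm (z - z'))\<^sup>2" using \<zeta> by (intro power_mono) (auto simp: dist_norm norm_minus_commute)
    then have "gauss 8 \<zeta> r \<le> 2 * gauss 16 z r" by (intro gauss_8_near[OF assms(1)] order_trans[OF _ assms(2)])
    then have g: "129 * r powr (s - 2) * gauss 8 \<zeta> r \<le> 129 * r powr (s - 2) * (2 * gauss 16 z r)"
      by (intro mult_left_mono) auto
    have aux: "a / 2 + b / 4 \<le> X" if "a \<le> X" "b \<le> X" "0 \<le> X" for a b X :: real
      using that by linarith
    have "norm (?D v) \<le> 258 * r powr (s - 2) * gauss 16 z r * norm v" for v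
    proof -
      have "norm (?D v) \<le> hk s \<zeta> r / (2 * r) * norm v + \<bar>grad_hk s \<zeta> r \<bullet> v\<bar> / (2 * r) * norm \<zeta>"
        using assms by (intro order_trans[OF norm_triangle_ineq4]) simp
      also have "\<bar>grad_hk s \<zeta> r \<bullet> v\<bar> / (2 * r) * norm \<zeta> \<le> (norm (grad_hk s \<zeta> r) * norm v) / (2 * r) * norm \<zeta>"
        using assms by (intro mult_right_mono divide_right_mono Cauchy_Schwarz_ineq2) auto
      also have "hk s \<zeta> r / (2 * r) * norm v + (norm (grad_hk s \<zeta> r) * norm v) / (2 * r) * norm \<zeta>
         = (norm \<zeta> ^ 0 * hk s \<zeta> r / r ^ 1 / 2 + norm \<zeta> ^ 2 * hk s \<zeta> r / r ^ 2 / 4) * norm v"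
        using assms by (simp add: norm_grad_hk field_simps power2_eq_square)
      also have "\<dots> \<le> (129 * r powr (s - 2) * gauss 8 \<zeta> r) * norm v"
      proof (intro mult_right_mono)
        have "norm \<zeta> ^ 0 * hk s \<zeta> r / r ^ 1 \<le> 129 * r powr (s - 2) * gauss 8 \<zeta> r"
          using power_hk_div_bound[OF assms(1), of 0 \<zeta> s 1] by simp
        moreover have "norm \<zeta> ^ 2 * hk s \<zeta> r / r ^ 2 \<le> 129 * r powr (s - 2) * gauss 8 \<zeta> r"
          using power_hk_div_bound[OF assms(1), of 2 \<zeta> s 2] by simp
        moreover have "0 \<le> 129 * r powr (s - 2) * gauss 8 \<zeta> r" by simp
        ultimately show "norm \<zeta> ^ 0 * hk s \<zeta> r / r ^ 1 / 2 + norm \<zeta> ^ 2 * hk s \<zeta> r / r ^ 2 / 4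
            \<le> 129 * r powr (s - 2) * gauss 8 \<zeta> r"
          by (rule aux)
      qed simp
      also have "\<dots> \<le> 258 * r powr (s - 2) * gauss 16 z r * norm v"
        using g by (intro mult_right_mono) auto
      finally show ?thesis by simp
    qed
    then show "onorm ?D \<le> 258 * r powr (s - 2) * gauss 16 z r"
      by (intro onorm_bound) auto
  qed (auto simp: dist_norm norm_minus_commute)
  then show ?thesis by (simp add: mult_ac)
qed

text \<open>Mean value inequality for \<open>?f\<close>, whose gradient is exactly the increment
  bounded in \<open>grad_hk_space_diff\<close>; this yields the second factor
  \<open>norm (z' - z)\<close>.\<close>

lemma hk_taylor:
  fixes z :: "'a::euclidean_space"
  assumes "r > 0" "(norm (z - z'))\<^sup>2 \<le> r"
  shows "norm (hk s z' r - hk s z r - grad_hk s z r \<bullet> (z' - z)) 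
    \<le> 258 * (norm (z' - z))\<^sup>2 * r powr (s - 2) * gauss 16 z r"
proof -
  let ?f = "\<lambda>\<zeta>. hk s \<zeta> r - grad_hk s z r \<bullet> \<zeta>"
  let ?B = "258 * norm (z' - z) * r powr (s - 2) * gauss 16 z r"
  have "norm (?f z' - ?f z) \<le> ?B * norm (z' - z)"
  proof (rule differentiable_bound[where S="cball z (norm (z' - z))"])
    fix \<zeta> assume \<zeta>: "\<zeta> \<in> cball z (norm (z' - z))"
    show "(?f has_derivative (\<lambda>v. (grad_hk s \<zeta> r - grad_hk s z r) \<bullet> v)) (at \<zeta> within cball z (norm (z' - z)))"
      by (auto intro!: derivative_eq_intros hk_has_derivative[OF assms(1)] simp: inner_diff_left)
    have le: "norm (z - \<zeta>) \<le> norm (z' - z)" using \<zeta> by (auto simp: dist_norm)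
    then have "(norm (z - \<zeta>))\<^sup>2 \<le> (norm (z - z'))\<^sup>2" by (intro power_mono) (auto simp: norm_minus_commute)
    then have "norm (grad_hk s \<zeta> r - grad_hk s z r) \<le> 258 * norm (\<zeta> - z) * r powr (s - 2) * gauss 16 z r"
      by (intro grad_hk_space_diff[OF assms(1)] order_trans[OF _ assms(2)])
    also have "\<dots> \<le> ?B" using le by (intro mult_right_mono mult_left_mono) (auto simp: norm_minus_commute)
    finally show "onorm (\<lambda>v. (grad_hk s \<zeta> r - grad_hk s z r) \<bullet> v) \<le> ?B"
      by (intro onorm_bound) (auto intro: order_trans[OF Cauchy_Schwarz_ineq2 mult_right_mono])
  qed (auto simp: dist_norm norm_minus_commute)
  then show ?thesis by (simp add: power2_eq_square inner_diff_right diff_diff_eq2 mult_ac)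
qed

text \<open>For \<theta> between \<open>r\<close> and \<open>2 * r\<close> the exponent at width 8
  is at most the one at width 16 and time \<open>r\<close>, and nonpositive powers of \<theta> are
  largest at \<open>r\<close>. So one Gaussian at the earlier time serves the whole segment in the
  mean value inequality.\<close>

lemma gauss_8_later:
  assumes "0 < r" "r \<le> \<theta>" "\<theta> \<le> 2 * r" "a \<le> 0"
  shows "\<theta> powr a * gauss 8 z \<theta> \<le> r powr a * gauss 16 z r"
proof -
  have "exp (- (norm z)\<^sup>2 / (8 * \<theta>)) \<le> exp (- (norm z)\<^sup>2 / (16 * r))"
    using assms mult_right_mono[of "8*\<theta>" "16*r" "(norm z)\<^sup>2"] by (simp add: field_simps)
  then show ?thesis using assms unfolding gauss_def
    by (intro mult_mono) (auto intro: powr_mono2')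
qed

text \<open>The time derivative contributes factors 1/\<theta> and |z|^2/\<theta>^2, which both cost
  one power of time. Their coefficients are at most \<open>1 + DIM('a)\<close> and 1, whence
  \<open>2 + DIM('a)\<close>.\<close>

lemma hk_time_diff:
  fixes z :: "'a::euclidean_space"
  assumes "0 < r" "r \<le> r1" "r1 \<le> 2 * r" "0 < s" "s < 1"
  shows "norm (hk s z r1 - hk s z r) \<le> 129 * (2 + real DIM('a)) * (r1 - r) * r powr (s - 2) * gauss 16 z r"
proof -
  let ?B = "129 * (2 + real DIM('a)) * (r powr (s - 2) * gauss 16 z r)"
  have "norm (hk s z r1 - hk s z r) \<le> ?B * norm (r1 - r)"
  proof (rule differentiable_bound[where S="{r..r1}"])
    fix \<theta> assume \<theta>: "\<theta> \<in> {r..r1}"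
    then have \<theta>0: "\<theta> > 0" using assms by auto
    let ?D = "((s - 1 - real DIM('a) / 2) / \<theta> + (norm z)\<^sup>2 / (4 * \<theta>\<^sup>2)) * hk s z \<theta>"
    show "((\<lambda>r. hk s z r) has_derivative (\<lambda>v. ?D * v)) (at \<theta> within {r..r1})"
      using hk_has_time_derivative[OF \<theta>0] by (simp add: has_field_derivative_def)
    have "\<bar>?D\<bar> = \<bar>(s - 1 - real DIM('a) / 2) / \<theta> + (norm z)\<^sup>2 / (4 * \<theta>\<^sup>2)\<bar> * hk s z \<theta>"
      by (simp add: abs_mult)
    also have "\<dots> \<le> ((1 + real DIM('a)) / \<theta> + (norm z)\<^sup>2 / (4 * \<theta>\<^sup>2)) * hk s z \<theta>"
    proof (intro mult_right_mono order_trans[OF abs_triangle_ineq] add_mono)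
      show "\<bar>(s - 1 - real DIM('a) / 2) / \<theta>\<bar> \<le> (1 + real DIM('a)) / \<theta>"
        using assms \<theta>0 by (simp add: abs_divide divide_right_mono)
    qed auto
    also have "\<dots> = (1 + real DIM('a)) * (norm z ^ 0 * hk s z \<theta> / \<theta> ^ 1) + norm z ^ 2 * hk s z \<theta> / \<theta> ^ 2 / 4"
      using \<theta>0 by (simp add: field_simps)
    also have "\<dots> \<le> (1 + real DIM('a)) * (129 * \<theta> powr (s - 2) * gauss 8 z \<theta>) + 129 * \<theta> powr (s - 2) * gauss 8 z \<theta>"
    proof (intro add_mono mult_left_mono)
      show "norm z ^ 0 * hk s z \<theta> / \<theta> ^ 1 \<le> 129 * \<theta> powr (s - 2) * gauss 8 z \<theta>"
        using power_hk_div_bound[OF \<theta>0, of 0 z s 1] by simp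
      have "norm z ^ 2 * hk s z \<theta> / \<theta> ^ 2 / 4 \<le> norm z ^ 2 * hk s z \<theta> / \<theta> ^ 2"
        using divide_left_mono[of 1 4 "norm z ^ 2 * hk s z \<theta> / \<theta> ^ 2"] by simp
      also have "\<dots> \<le> 129 * \<theta> powr (s - 2) * gauss 8 z \<theta>"
        using power_hk_div_bound[OF \<theta>0, of 2 z s 2] by simp
      finally show "norm z ^ 2 * hk s z \<theta> / \<theta> ^ 2 / 4 \<le> 129 * \<theta> powr (s - 2) * gauss 8 z \<theta>" .
    qed auto
    also have "\<dots> = 129 * (2 + real DIM('a)) * (\<theta> powr (s - 2) * gauss 8 z \<theta>)" by (simp add: algebra_simps)
    also have "\<dots> \<le> ?B" using assms \<theta> by (intro mult_left_mono gauss_8_later) auto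
    finally have "\<bar>?D\<bar> \<le> ?B" .
    then show "onorm (\<lambda>v. ?D * v) \<le> ?B"
      by (intro onorm_bound) (auto simp: abs_mult intro!: mult_right_mono)
  qed (use assms in auto)
  then show ?thesis using assms by (simp add: mult_ac)
qed

lemma grad_hk_time_diff:
  fixes z :: "'a::euclidean_space"
  assumes "0 < r" "r \<le> r1" "r1 \<le> 2 * r" "0 < s" "s < 1"
  shows "norm (grad_hk s z r1 - grad_hk s z r) \<le> 129 * (3 + real DIM('a)) * (r1 - r) * r powr (s - 5/2) * gauss 16 z r"
proof -
  let ?B = "129 * (3 + real DIM('a)) * (r powr (s - 5/2) * gauss 16 z r)"
  have "norm (grad_hk s z r1 - grad_hk s z r) \<le> ?B * norm (r1 - r)"
  proof (rule differentiable_bound[where S="{r..r1}"])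
    fix \<theta> assume \<theta>: "\<theta> \<in> {r..r1}"
    then have \<theta>0: "\<theta> > 0" using assms by auto
    let ?c = "- ((s - 2 - real DIM('a) / 2) / (2 * \<theta>\<^sup>2) + (norm z)\<^sup>2 / (8 * \<theta> ^ 3))"
    let ?D = "(?c * hk s z \<theta>) *\<^sub>R z"
    show "((\<lambda>r. grad_hk s z r) has_derivative (\<lambda>v. v *\<^sub>R ?D)) (at \<theta> within {r..r1})"
      using grad_hk_has_time_derivative[OF \<theta>0] by (simp only: has_vector_derivative_def)
    have "norm ?D = \<bar>?c\<bar> * (hk s z \<theta> * norm z)"
      by (simp add: abs_mult)
    also have "\<dots> \<le> ((2 + real DIM('a)) / \<theta>\<^sup>2 + (norm z)\<^sup>2 / \<theta> ^ 3) * (hk s z \<theta> * norm z)"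
    proof (intro mult_right_mono)
      have "\<bar>?c\<bar> \<le> \<bar>(s - 2 - real DIM('a) / 2) / (2 * \<theta>\<^sup>2)\<bar> + \<bar>(norm z)\<^sup>2 / (8 * \<theta> ^ 3)\<bar>" by linarith
      also have "\<dots> \<le> (2 + real DIM('a)) / \<theta>\<^sup>2 + (norm z)\<^sup>2 / \<theta> ^ 3"
      proof (intro add_mono)
        have "\<bar>(s - 2 - real DIM('a) / 2) / (2 * \<theta>\<^sup>2)\<bar> = \<bar>s - 2 - real DIM('a) / 2\<bar> / 2 / \<theta>\<^sup>2"
          by (simp add: abs_divide)
        also have "\<dots> \<le> (2 + real DIM('a)) / \<theta>\<^sup>2"
          using assms by (intro divide_right_mono) auto
        finally show "\<bar>(s - 2 - real DIM('a) / 2) / (2 * \<theta>\<^sup>2)\<bar> \<le> (2 + real DIM('a)) / \<theta>\<^sup>2" .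
        show "\<bar>(norm z)\<^sup>2 / (8 * \<theta> ^ 3)\<bar> \<le> (norm z)\<^sup>2 / \<theta> ^ 3"
          using \<theta>0 by (simp add: field_simps)
      qed
      finally show "\<bar>?c\<bar> \<le> (2 + real DIM('a)) / \<theta>\<^sup>2 + (norm z)\<^sup>2 / \<theta> ^ 3" .
    qed auto
    also have "\<dots> = (2 + real DIM('a)) * (norm z ^ 1 * hk s z \<theta> / \<theta> ^ 2) + norm z ^ 3 * hk s z \<theta> / \<theta> ^ 3"
      using \<theta>0 by (simp add: field_simps power2_eq_square power3_eq_cube)
    also have "\<dots> \<le> (2 + real DIM('a)) * (129 * \<theta> powr (s - 5/2) * gauss 8 z \<theta>) + 129 * \<theta> powr (s - 5/2) * gauss 8 z \<theta>"
    proof (intro add_mono mult_left_mono)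
      show "norm z ^ 1 * hk s z \<theta> / \<theta> ^ 2 \<le> 129 * \<theta> powr (s - 5/2) * gauss 8 z \<theta>"
        using power_hk_div_bound[OF \<theta>0, of 1 z s 2] by (simp add: algebra_simps)
      show "norm z ^ 3 * hk s z \<theta> / \<theta> ^ 3 \<le> 129 * \<theta> powr (s - 5/2) * gauss 8 z \<theta>"
        using power_hk_div_bound[OF \<theta>0, of 3 z s 3] by (simp add: algebra_simps)
    qed auto
    also have "\<dots> = 129 * (3 + real DIM('a)) * (\<theta> powr (s - 5/2) * gauss 8 z \<theta>)" by (simp add: algebra_simps)
    also have "\<dots> \<le> ?B" using assms \<theta> by (intro mult_left_mono gauss_8_later) auto
    finally have "norm ?D \<le> ?B" .
    then have "norm (v *\<^sub>R ?D) \<le> ?B * norm v" for v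
      by (simp only: norm_scaleR real_norm_def mult.commute[of "\<bar>v\<bar>"] mult_right_mono abs_ge_zero)
    then show "onorm (\<lambda>v. v *\<^sub>R ?D) \<le> ?B"
      by (intro onorm_bound) auto
  qed (use assms in auto)
  then show ?thesis using assms by (simp add: mult_ac)
qed

section \<open>Integrals in time\<close>

lemma hk_integral:
  fixes x :: "'a::euclidean_space"
  assumes "r > 0"
  shows "integrable lborel (\<lambda>y. hk s (x - y) r)"
    and "(\<integral>y. hk s (x - y) r \<partial>lborel) = gauss_mass TYPE('a) 4 * r powr (s - 1)"
  using gauss_integral[OF assms, of 4 x] assms by (simp_all add: hk_def)

text \<open>The gradient is odd and the reflection y -> 2x - y preserves Lebesgue measure, so the
  integral equals its own negative.\<close>

lemma grad_hk_integral:
  fixes x :: "'a::euclidean_space"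
  shows "(\<integral>y. grad_hk s (x - y) r \<partial>lborel) = 0"
proof -
  have "(\<integral>y. grad_hk s (x - y) r \<partial>lborel) = (\<integral>y. grad_hk s (- (x - y)) r \<partial>lborel)"
    by (subst lborel_integral_affine[of "- 1" _ "2 *\<^sub>R x"]) (auto simp: algebra_simps scaleR_2)
  then have "(\<integral>y. grad_hk s (x - y) r \<partial>lborel) = - (\<integral>y. grad_hk s (x - y) r \<partial>lborel)"
    by (simp only: grad_hk_uminus Bochner_Integration.integral_minus)
  then show ?thesis by (metis add.right_inverse scaleR_2 scaleR_eq_0_iff zero_neq_numeral)
qed

text \<open>
  \<open>\<rho>\<close> is the splitting point (the squared spatial, or the temporal, distance of the compared
  points) and \<open>p\<close> the power of \<open>\<rho>\<close> expected after integration. The bound 8 exceeds every elapsed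
  time that occurs.
\<close>

definition radial :: "real \<Rightarrow> real \<Rightarrow> real \<Rightarrow> real \<Rightarrow> real \<Rightarrow> real" where
  "radial a m p \<rho> r = \<rho> powr a * (r powr (p - 1 - a) * indicator {0..2 * \<rho>} r)
     + \<rho> powr m * (r powr (p - 1 - m) * indicator {\<rho>..8} r)"

lemma radial_nonneg [simp]: "0 \<le> radial a m p \<rho> r" by (simp add: radial_def)

text \<open>The near range ends at \<open>2 * \<rho>\<close> because of time differences: with
  \<open>\<rho> = t - t'\<close> and \<open>t' - \<tau> \<le> \<rho>\<close>, the other elapsed time
  \<open>t - \<tau>\<close> can be as large as \<open>2 * \<rho>\<close>. The exponents of
  \<open>\<rho>\<close> and \<open>r\<close> always add up to \<open>p - 1\<close>.\<close>

lemma radial_near: "0 < r \<Longrightarrow> r \<le> 2 * \<rho> \<Longrightarrow> \<rho> powr a * r powr (p - 1 - a) \<le> radial a m p \<rho> r"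
  by (simp add: radial_def)

lemma radial_far: "\<rho> \<le> r \<Longrightarrow> r \<le> 8 \<Longrightarrow> \<rho> powr m * r powr (p - 1 - m) \<le> radial a m p \<rho> r"
  by (simp add: radial_def)

lemma powr_integral_from_0:
  assumes "q > -1" "c \<ge> (0::real)"
  shows "integrable lborel (\<lambda>r. r powr q * indicator {0..c} r)"
    and "(\<integral>r. r powr q * indicator {0..c} r \<partial>lborel) = c powr (q + 1) / (q + 1)"
proof -
  have h: "((\<lambda>x. x powr q) has_integral (c powr (q+1) / (q+1))) {0..c}"
    by (rule has_integral_powr_from_0[OF assms])
  then have "(\<lambda>x. x powr q) absolutely_integrable_on {0..c}"
    by (intro nonnegative_absolutely_integrable_1) auto
  then have i: "set_integrable lborel {0..c} (\<lambda>x. x powr q)"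
    by (simp add: set_integrable_def integrable_completion)
  then show "integrable lborel (\<lambda>r. r powr q * indicator {0..c} r)"
    by (simp add: set_integrable_def mult.commute)
  show "(\<integral>r. r powr q * indicator {0..c} r \<partial>lborel) = c powr (q + 1) / (q + 1)"
    using set_borel_integral_eq_integral(2)[OF i] integral_unique[OF h]
    by (simp add: set_lebesgue_integral_def mult.commute)
qed

lemma FTC_integral_indicator:
  fixes f F :: "real \<Rightarrow> real"
  assumes "a \<le> b" "\<And>x. a \<le> x \<Longrightarrow> x \<le> b \<Longrightarrow> (F has_real_derivative f x) (at x)"
     "continuous_on {a..b} f"
  shows "integrable lborel (\<lambda>r. f r * indicator {a..b} r)"
    and "(\<integral>r. f r * indicator {a..b} r \<partial>lborel) = F b - F a"
proof -
  have i: "set_integrable lborel {a..b} f" by (rule borel_integrable_atLeastAtMost'[OF assms(3)])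
  have h: "(f has_integral F b - F a) {a..b}"
    by (rule fundamental_theorem_of_calculus)
       (use assms in \<open>auto simp: has_real_derivative_iff_has_vector_derivative[symmetric] intro: has_field_derivative_at_within\<close>)
  show "integrable lborel (\<lambda>r. f r * indicator {a..b} r)"
    using i by (simp add: set_integrable_def mult.commute)
  show "(\<integral>r. f r * indicator {a..b} r \<partial>lborel) = F b - F a"
    using set_borel_integral_eq_integral(2)[OF i] integral_unique[OF h]
    by (simp add: set_lebesgue_integral_def mult.commute)
qed

lemma powr_integral_far:
  assumes "\<rho> > (0::real)"
  shows "integrable lborel (\<lambda>r. r powr q * indicator {\<rho>..8} r)" (is ?i)
    and "q < -1 \<Longrightarrow> (\<integral>r. r powr q * indicator {\<rho>..8} r \<partial>lborel) \<le> \<rho> powr (q + 1) / (- q - 1)"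
    and "q = -1 \<Longrightarrow> \<rho> \<le> 8 \<Longrightarrow> (\<integral>r. r powr q * indicator {\<rho>..8} r \<partial>lborel) = ln 8 - ln \<rho>"
proof -
  have c: "continuous_on {\<rho>..8} (\<lambda>r. r powr q)"
    using assms by (intro continuous_intros) auto
  show ?i using borel_integrable_atLeastAtMost'[OF c] by (simp add: set_integrable_def mult.commute)
  show "(\<integral>r. r powr q * indicator {\<rho>..8} r \<partial>lborel) \<le> \<rho> powr (q + 1) / (- q - 1)" if q: "q < -1"
  proof (cases "\<rho> \<le> 8")
    case True
    have "((\<lambda>r. r powr (q + 1) / (q + 1)) has_real_derivative x powr q) (at x)" if "x > 0" for x
      using DERIV_cdivide[OF has_real_derivative_powr[OF that, of "q + 1"], of "q + 1"] q by simp
    then have "(\<integral>r. r powr q * indicator {\<rho>..8} r \<partial>lborel) = 8 powr (q + 1) / (q + 1) - \<rho> powr (q + 1) / (q + 1)"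
      using assms q True c
      by (intro FTC_integral_indicator(2)[where F="\<lambda>r. r powr (q + 1) / (q + 1)"]) auto
    \<comment> \<open>The term at the upper end 8 is nonpositive, since \<open>q + 1 < 0\<close>,
      and is dropped.\<close>
    also have "\<dots> \<le> \<rho> powr (q + 1) / (- q - 1)"
      using divide_nonneg_neg[of "8 powr (q + 1)" "q + 1"] minus_divide_right[of "\<rho> powr (q + 1)" "q + 1"] q by simp
    finally show ?thesis .
  next
    case False
    then show ?thesis using q by simp
  qed
  show "(\<integral>r. r powr q * indicator {\<rho>..8} r \<partial>lborel) = ln 8 - ln \<rho>" if q: "q = -1" "\<rho> \<le> 8"
    using assms q c
    by (intro FTC_integral_indicator(2)[where F=ln])
       (auto intro!: derivative_eq_intros simp: powr_minus field_simps)
qed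

lemma radial_integrable:
  assumes "a < p" "\<rho> > 0"
  shows "integrable lborel (radial a m p \<rho>)"
  unfolding radial_def[abs_def] using assms
  by (intro Bochner_Integration.integrable_add integrable_mult_right powr_integral_from_0 powr_integral_far) auto

lemma radial_integral:
  assumes "a < p" "\<rho> > 0"
  shows "(\<integral>r. radial a m p \<rho> r \<partial>lborel) = 2 powr (p - a) / (p - a) * \<rho> powr p
     + \<rho> powr m * (\<integral>r. r powr (p - 1 - m) * indicator {\<rho>..8} r \<partial>lborel)"
proof -
  have "\<rho> powr a * ((2 * \<rho>) powr (p - a) / (p - a)) = 2 powr (p - a) / (p - a) * \<rho> powr p"
    using assms by (simp add: powr_mult powr_diff)
  then show ?thesis unfolding radial_def using assms 
    by (subst Bochner_Integration.integral_add)
       (auto intro!: integrable_mult_right powr_integral_from_0 powr_integral_far simp: powr_integral_from_0)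
qed

text \<open>The condition \<open>a < p\<close> makes the near part integrable at 0, and
  \<open>p < m\<close> lets the lower end dominate the far integral; both are then bounded by
  multiples of \<open>\<rho> powr p\<close>.\<close>

lemma radial_integral_less:
  assumes "a < p" "p < m" "\<rho> > 0"
  shows "(\<integral>r. radial a m p \<rho> r \<partial>lborel) \<le> (2 powr (p - a) / (p - a) + 1 / (m - p)) * \<rho> powr p"
proof -
  have "\<rho> powr m * (\<integral>r. r powr (p - 1 - m) * indicator {\<rho>..8} r \<partial>lborel) \<le> \<rho> powr m * (\<rho> powr (p - 1 - m + 1) / (- (p - 1 - m) - 1))"
    using assms by (intro mult_left_mono powr_integral_far) auto
  also have "\<dots> = 1 / (m - p) * \<rho> powr p" using assms by (simp add: powr_diff)
  finally show ?thesis using assms by (simp add: radial_integral distrib_right)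
qed

text \<open>At \<open>p = m\<close> the far integrand is 1/r, and its integral is
  \<open>ln 8 - ln \<rho>\<close> in place of a power. The logarithmic moduli of the borderline
  cases originate here.\<close>

lemma radial_integral_log:
  assumes "a < p" "0 < \<rho>" "\<rho> \<le> 8"
  shows "(\<integral>r. radial a p p \<rho> r \<partial>lborel) \<le> (2 powr (p - a) / (p - a) + 7) * (\<rho> powr p * (1 + \<bar>ln \<rho>\<bar>))"
proof -
  have "ln (8::real) \<le> 7" using ln_le_minus_one[of 8] by simp
  moreover have "- ln \<rho> \<le> \<bar>ln \<rho>\<bar>" "0 \<le> \<bar>ln \<rho>\<bar>" by auto
  ultimately have "ln 8 - ln \<rho> \<le> 7 * (1 + \<bar>ln \<rho>\<bar>)" unfolding distrib_left by linarith
  then have "\<rho> powr p * (ln 8 - ln \<rho>) \<le> \<rho> powr p * (7 * (1 + \<bar>ln \<rho>\<bar>))" by (intro mult_left_mono) auto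
  moreover have "2 powr (p - a) / (p - a) * \<rho> powr p * 1 \<le> 2 powr (p - a) / (p - a) * \<rho> powr p * (1 + \<bar>ln \<rho>\<bar>)"
    using assms by (intro mult_left_mono) auto
  moreover have "(\<integral>r. r powr (p - 1 - p) * indicator {\<rho>..8} r \<partial>lborel) = ln 8 - ln \<rho>"
    using assms by (intro powr_integral_far(3)) auto
  ultimately show ?thesis unfolding radial_integral[OF assms(1,2)] by (simp add: distrib_right distrib_left)
qed

lemma integrable_reflect:
  fixes R :: "real \<Rightarrow> 'b::{banach,second_countable_topology}"
  assumes "integrable lborel R" 
  shows "integrable lborel (\<lambda>\<tau>. R (t - \<tau>))" "(\<integral>\<tau>. R (t - \<tau>) \<partial>lborel) = (\<integral>r. R r \<partial>lborel)"
proof -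
  have [measurable]: "R \<in> borel_measurable borel" using assms by auto
  show "integrable lborel (\<lambda>\<tau>. R (t - \<tau>))"
    using lborel_integrable_affine_iff[of "-1" R t] assms by simp
  show "(\<integral>\<tau>. R (t - \<tau>) \<partial>lborel) = (\<integral>r. R r \<partial>lborel)"
    using lborel_integral_affine[of "-1" R t] by simp
qed

lemma time_integral_bound:
  fixes F :: "real \<Rightarrow> 'b::{banach,second_countable_topology}"
  assumes R: "integrable lborel R" 
    and F: "\<And>\<tau>. norm (F \<tau>) \<le> A * (R (t - \<tau>) + R (t' - \<tau>))"
    and A: "A \<ge> 0" and I: "(\<integral>r. R r \<partial>lborel) \<le> I" "0 \<le> I"
  shows "norm (\<integral>\<tau>. F \<tau> \<partial>lborel) \<le> 2 * A * I"
proof (cases "integrable lborel F")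
  case False
  then show ?thesis using assms by (simp add: not_integrable_integral_eq)
next
  case True
  have "norm (\<integral>\<tau>. F \<tau> \<partial>lborel) \<le> (\<integral>\<tau>. A * (R (t - \<tau>) + R (t' - \<tau>)) \<partial>lborel)"
    using R F by (intro Bochner_Integration.integral_norm_bound_integral[OF True] 
        Bochner_Integration.integrable_add integrable_mult_right integrable_reflect) auto
  also have "\<dots> = 2 * A * (\<integral>r. R r \<partial>lborel)"
    using R by (simp add: integrable_reflect)
  also have "\<dots> \<le> 2 * A * I" using I A by (intro mult_left_mono) auto
  finally show ?thesis .
qed

section \<open>Space integrals against a Hoelder source\<close>

text \<open>One constant for all kernels: the first two factors come from
  \<open>gauss_hoelder_integral\<close>, and \<open>258 * (3 + DIM('a))\<close> majorizes every
  numerical prefactor of the kernel bounds, namely 129, 258 and the two dimension-dependent ones of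
  the time differences.\<close>

definition est_const :: "'a::euclidean_space itself \<Rightarrow> real" where
  "est_const _ = 4098 * gauss_mass TYPE('a) 32 * (258 * (3 + real DIM('a)))"

lemma est_const_nonneg [simp]: "0 \<le> est_const T"
  by (simp add: est_const_def)

definition hk_mass :: "'a::euclidean_space itself \<Rightarrow> real \<Rightarrow> real \<Rightarrow> real" where
  "hk_mass _ s r = (if r > 0 then gauss_mass TYPE('a) 4 * r powr (s - 1) else 0)"

text \<open>The estimates see the source only through \<open>N\<close>, so every bound is linear in
  it and the constants depend on \<open>s\<close>, \<alpha> and the dimension alone. Time regularity
  is required only between times of modulus below 4, since a zero extension may jump at the ends of
  that interval.\<close>

locale source_term =
  fixes s \<alpha> N :: real and g :: "'a::euclidean_space \<times> real \<Rightarrow> real"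
  assumes s: "0 < s" "s < 1" and \<alpha>: "0 < \<alpha>" "\<alpha> < 1"
    and g_measurable [measurable]: "g \<in> borel_measurable borel"
    and g_bound: "\<And>p. \<bar>g p\<bar> \<le> N"
    and g_support: "\<And>y \<tau>. 4 \<le> \<bar>\<tau>\<bar> \<Longrightarrow> g (y, \<tau>) = 0"
    and g_space: "\<And>x y \<tau>. norm x < 1 \<Longrightarrow> \<bar>g (y, \<tau>) - g (x, \<tau>)\<bar> \<le> N * norm (x - y) powr \<alpha>"
    and g_time: "\<And>x \<tau> \<tau>'. norm x < 1 \<Longrightarrow> \<bar>\<tau>\<bar> < 4 \<Longrightarrow> \<bar>\<tau>'\<bar> < 4 \<Longrightarrow>
        \<bar>g (x, \<tau>) - g (x, \<tau>')\<bar> \<le> N * \<bar>\<tau> - \<tau>'\<bar> powr (\<alpha> / 2)"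
begin

lemma N_nonneg [simp]: "0 \<le> N" using g_bound[of undefined] by linarith

text \<open>\<open>DJ\<close> and \<open>Dw\<close> below are the gradients of \<open>J\<close> and \<open>w\<close>; for \<open>w\<close> this is \<open>w_GDERIV\<close>.\<close>

definition J :: "'a \<Rightarrow> real \<Rightarrow> real \<Rightarrow> real" where
  "J x t \<tau> = (\<integral>y. g (y, \<tau>) *\<^sub>R hk s (x - y) (t - \<tau>) \<partial>lborel)"

definition DJ :: "'a \<Rightarrow> real \<Rightarrow> real \<Rightarrow> 'a" where
  "DJ x t \<tau> = (\<integral>y. g (y, \<tau>) *\<^sub>R grad_hk s (x - y) (t - \<tau>) \<partial>lborel)"

lemma J_zero: "t \<le> \<tau> \<or> 4 \<le> \<bar>\<tau>\<bar> \<Longrightarrow> J x t \<tau> = 0"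
  by (auto simp: J_def hk_nonpos_time g_support)

lemma DJ_zero: "t \<le> \<tau> \<or> 4 \<le> \<bar>\<tau>\<bar> \<Longrightarrow> DJ x t \<tau> = 0"
  by (auto simp: DJ_def grad_hk_nonpos_time g_support)

lemma J_measurable [measurable]: "J x t \<in> borel_measurable borel"
proof -
  have "case_prod (\<lambda>\<tau> y. g (y, \<tau>) *\<^sub>R hk s (x - y) (t - \<tau>)) \<in> borel_measurable (lborel \<Otimes>\<^sub>M lborel)"
    by measurable
  from lborel.borel_measurable_lebesgue_integral[OF this]
  show ?thesis by (simp add: J_def[abs_def])
qed

lemma DJ_measurable [measurable]: "DJ x t \<in> borel_measurable borel"
proof -
  have "case_prod (\<lambda>\<tau> y. g (y, \<tau>) *\<^sub>R grad_hk s (x - y) (t - \<tau>)) \<in> borel_measurable (lborel \<Otimes>\<^sub>M lborel)"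
    by measurable
  from lborel.borel_measurable_lebesgue_integral[OF this]
  show ?thesis by (simp add: DJ_def[abs_def])
qed

lemma kernel_integrable:
  fixes K :: "'a \<Rightarrow> 'b::{banach,second_countable_topology}"
  assumes "r > 0" and [measurable]: "K \<in> borel_measurable borel"
    and K: "\<And>y. norm (K y) \<le> B * gauss 16 (x - y) r"
  shows "integrable lborel K" "integrable lborel (\<lambda>y. g (y, \<tau>) *\<^sub>R K y)"
proof -
  show "integrable lborel (\<lambda>y. g (y, \<tau>) *\<^sub>R K y)"
    by (rule gauss_bounded_integral(1)[OF assms(1) _ assms(2) K, of _ N]) (use g_bound in auto)
  show "integrable lborel K"
    using gauss_bounded_integral(1)[OF assms(1) _ assms(2) K, of "\<lambda>_. 1" 1] by simp
qed

text \<open>Subtracting the mass term leaves \<open>g (y, \<tau>) - g (x, \<tau>)\<close> under the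
  integral, to which \<open>gauss_hoelder_integral\<close> applies. The factor \<open>c\<close>
  collects numerical constants and disappears in \<open>est_const\<close>, while \<open>B\<close>
  carries the dependence on distances and elapsed time.\<close>

lemma kernel_estimate:
  fixes K :: "'a \<Rightarrow> 'b::{banach,second_countable_topology}"
  assumes "r > 0" and [measurable]: "K \<in> borel_measurable borel"
    and K: "\<And>y. norm (K y) \<le> c * B * gauss 16 (x - y) r" 
    and c: "0 \<le> c" "c \<le> 258 * (3 + real DIM('a))" and B: "0 \<le> B" and x: "norm x < 1"
  shows "norm ((\<integral>y. g (y, \<tau>) *\<^sub>R K y \<partial>lborel) - g (x, \<tau>) *\<^sub>R (\<integral>y. K y \<partial>lborel)) \<le> est_const TYPE('a) * N * (B * r powr (\<alpha>/2))"
proof -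
  note i = kernel_integrable[OF assms(1,2) K]
  have "(\<integral>y. g (y, \<tau>) *\<^sub>R K y \<partial>lborel) - g (x, \<tau>) *\<^sub>R (\<integral>y. K y \<partial>lborel) 
     = (\<integral>y. (g (y, \<tau>) - g (x, \<tau>)) *\<^sub>R K y \<partial>lborel)"
    using i by (simp add: scaleR_diff_left)
  also have "norm \<dots> \<le> 4098 * gauss_mass TYPE('a) 32 * (N * (c * B) * r powr (\<alpha>/2))"
    using g_space[OF x] \<alpha> c B N_nonneg by (intro gauss_hoelder_integral[OF assms(1) _ _ _ _ K]) auto
  also have "\<dots> = 4098 * gauss_mass TYPE('a) 32 * (c * (N * B * r powr (\<alpha>/2)))" by simp
  also have "\<dots> \<le> 4098 * gauss_mass TYPE('a) 32 * ((258 * (3 + real DIM('a))) * (N * B * r powr (\<alpha>/2)))"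
    using c B N_nonneg by (intro mult_left_mono mult_right_mono) auto
  finally show ?thesis by (simp add: est_const_def)
qed

lemma kernel_estimate_0:
  fixes K :: "'a \<Rightarrow> 'b::{banach,second_countable_topology}"
  assumes "r > 0" "K \<in> borel_measurable borel"
    and "\<And>y. norm (K y) \<le> c * B * gauss 16 (x - y) r" 
    and "0 \<le> c" "c \<le> 258 * (3 + real DIM('a))" "0 \<le> B" "norm x < 1"
    and "(\<integral>y. K y \<partial>lborel) = 0"
  shows "norm (\<integral>y. g (y, \<tau>) *\<^sub>R K y \<partial>lborel) \<le> est_const TYPE('a) * N * (B * r powr (\<alpha>/2))"
  using kernel_estimate[OF assms(1-7), of \<tau>] assms(8) by simp

lemma hk_integrable:
  fixes x :: 'a
  assumes "r > 0"
  shows "integrable lborel (\<lambda>y. hk s (x - y) r)" "integrable lborel (\<lambda>y. g (y, \<tau>) *\<^sub>R hk s (x - y) r)"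
  using kernel_integrable[OF assms, of "\<lambda>y. hk s (x - y) r" "129 * r powr (s - 1)" x] hk_bound[OF assms, of s]
  by auto

lemma grad_hk_integrable:
  fixes x :: 'a
  assumes "r > 0"
  shows "integrable lborel (\<lambda>y. grad_hk s (x - y) r)" "integrable lborel (\<lambda>y. g (y, \<tau>) *\<^sub>R grad_hk s (x - y) r)"
  using kernel_integrable[OF assms, of "\<lambda>y. grad_hk s (x - y) r" "129 * r powr (s - 3/2)" x] grad_hk_bound[OF assms, of s]
  by auto

lemma hk_integral_mass: "r > 0 \<Longrightarrow> (\<integral>y. hk s (x - y :: 'a) r \<partial>lborel) = hk_mass TYPE('a) s r"
  by (simp add: hk_integral(2) hk_mass_def)

text \<open>No cancellation here, since the mass of \<open>hk\<close> is positive; the exponent s -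
  1 > -1 is already integrable in time.\<close>

lemma J_bound:
  assumes "\<tau> < t"
  shows "norm (J x t \<tau>) \<le> est_const TYPE('a) * N * (t - \<tau>) powr (s - 1)"
proof -
  have "norm (J x t \<tau>) \<le> gauss_mass TYPE('a) 16 * (N * (129 * (t - \<tau>) powr (s - 1)))"
    unfolding J_def using assms g_bound
    by (intro gauss_bounded_integral(2)[where x=x]) (auto intro: hk_bound)
  also have "\<dots> = gauss_mass TYPE('a) 16 * 129 * (N * (t - \<tau>) powr (s - 1))" by simp
  also have "\<dots> \<le> (gauss_mass TYPE('a) 32 * (4098 * (258 * (3 + real DIM('a))))) * (N * (t - \<tau>) powr (s - 1))"
    using N_nonneg by (intro mult_mono gauss_mass_mono) (auto intro: gauss_mass_mono mult_nonneg_nonneg)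
  finally show ?thesis by (simp add: est_const_def mult_ac)
qed

lemma J_mass_diff:
  assumes "\<tau> < t" "norm x < 1"
  shows "norm (J x t \<tau> - g (x, \<tau>) * hk_mass TYPE('a) s (t - \<tau>)) \<le> est_const TYPE('a) * N * (t - \<tau>) powr (s - 1 + \<alpha>/2)"
proof -
  have "norm ((\<integral>y. g (y, \<tau>) *\<^sub>R hk s (x - y) (t - \<tau>) \<partial>lborel) - g (x, \<tau>) *\<^sub>R (\<integral>y. hk s (x - y) (t - \<tau>) \<partial>lborel)) 
    \<le> est_const TYPE('a) * N * ((t - \<tau>) powr (s - 1) * (t - \<tau>) powr (\<alpha>/2))"
    using assms by (intro kernel_estimate[where c=129]) (auto intro: hk_bound)
  then show ?thesis using assms by (simp add: J_def hk_integral_mass powr_add)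
qed

text \<open>The kernel gradient has mean zero, which yields the extra \<alpha>/2. The resulting
  exponent exceeds -1 exactly when 2s + \<alpha> > 1.\<close>

lemma DJ_bound:
  assumes "\<tau> < t" "norm x < 1"
  shows "norm (DJ x t \<tau>) \<le> est_const TYPE('a) * N * (t - \<tau>) powr (s - 3/2 + \<alpha>/2)"
proof -
  have "norm (\<integral>y. g (y, \<tau>) *\<^sub>R grad_hk s (x - y) (t - \<tau>) \<partial>lborel) 
    \<le> est_const TYPE('a) * N * ((t - \<tau>) powr (s - 3/2) * (t - \<tau>) powr (\<alpha>/2))"
    using assms by (intro kernel_estimate_0[where c=129]) (auto intro: grad_hk_bound simp: grad_hk_integral)
  then show ?thesis using assms by (simp add: DJ_def powr_add)
qed

text \<open>Both kernels have the same elapsed time, hence the same mass, so their difference has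
  mean zero.\<close>

lemma J_space_diff:
  assumes "\<tau> < t" "norm x < 1" "(norm (x - x'))\<^sup>2 \<le> t - \<tau>"
  shows "norm (J x' t \<tau> - J x t \<tau>) \<le> est_const TYPE('a) * N * (norm (x' - x) * (t - \<tau>) powr (s - 3/2 + \<alpha>/2))"
proof -
  let ?K = "\<lambda>y. hk s (x' - y) (t - \<tau>) - hk s (x - y) (t - \<tau>)"
  have "norm (\<integral>y. g (y, \<tau>) *\<^sub>R ?K y \<partial>lborel)
    \<le> est_const TYPE('a) * N * ((norm (x' - x) * (t - \<tau>) powr (s - 3/2)) * (t - \<tau>) powr (\<alpha>/2))"
  proof (intro kernel_estimate_0[where c=258])
    show "norm (?K y) \<le> 258 * (norm (x' - x) * (t - \<tau>) powr (s - 3/2)) * gauss 16 (x - y) (t - \<tau>)" for y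
      using hk_space_diff[of "t - \<tau>" "x - y" "x' - y" s] assms by simp
    show "(\<integral>y. ?K y \<partial>lborel) = 0"
      using assms by (simp add: hk_integrable hk_integral_mass)
  qed (use assms in auto)
  then show ?thesis using assms hk_integrable(2)[of "t - \<tau>"]
    by (simp add: J_def powr_add right_diff_distrib mult.assoc)
qed

lemma DJ_space_diff:
  assumes "\<tau> < t" "norm x < 1" "(norm (x - x'))\<^sup>2 \<le> t - \<tau>"
  shows "norm (DJ x' t \<tau> - DJ x t \<tau>) \<le> est_const TYPE('a) * N * (norm (x' - x) * (t - \<tau>) powr (s - 2 + \<alpha>/2))"
proof -
  let ?K = "\<lambda>y. grad_hk s (x' - y) (t - \<tau>) - grad_hk s (x - y) (t - \<tau>)"
  have "norm (\<integral>y. g (y, \<tau>) *\<^sub>R ?K y \<partial>lborel)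
    \<le> est_const TYPE('a) * N * ((norm (x' - x) * (t - \<tau>) powr (s - 2)) * (t - \<tau>) powr (\<alpha>/2))"
  proof (intro kernel_estimate_0[where c=258])
    show "norm (?K y) \<le> 258 * (norm (x' - x) * (t - \<tau>) powr (s - 2)) * gauss 16 (x - y) (t - \<tau>)" for y
      using grad_hk_space_diff[of "t - \<tau>" "x - y" "x' - y" s] assms by simp
    show "(\<integral>y. ?K y \<partial>lborel) = 0"
      using assms by (simp add: grad_hk_integrable grad_hk_integral)
  qed (use assms in auto)
  then show ?thesis using assms grad_hk_integrable(2)[of "t - \<tau>"]
    by (simp add: DJ_def powr_add scaleR_diff_right mult.assoc)
qed

lemma J_taylor:
  assumes "\<tau> < t" "norm x < 1" "(norm (x - x'))\<^sup>2 \<le> t - \<tau>"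
  shows "norm (J x' t \<tau> - J x t \<tau> - DJ x t \<tau> \<bullet> (x' - x)) \<le> est_const TYPE('a) * N * ((norm (x' - x))\<^sup>2 * (t - \<tau>) powr (s - 2 + \<alpha>/2))"
proof -
  let ?K = "\<lambda>y. hk s (x' - y) (t - \<tau>) - hk s (x - y) (t - \<tau>) - grad_hk s (x - y) (t - \<tau>) \<bullet> (x' - x)"
  have i: "integrable lborel (\<lambda>y. grad_hk s (x - y) (t - \<tau>) \<bullet> (x' - x))"
     "integrable lborel (\<lambda>y. g (y, \<tau>) * (grad_hk s (x - y) (t - \<tau>) \<bullet> (x' - x)))"
    using integrable_inner_left[OF grad_hk_integrable(1)] integrable_inner_left[OF grad_hk_integrable(2)] assms by auto
  have "norm (\<integral>y. g (y, \<tau>) *\<^sub>R ?K y \<partial>lborel)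
    \<le> est_const TYPE('a) * N * (((norm (x' - x))\<^sup>2 * (t - \<tau>) powr (s - 2)) * (t - \<tau>) powr (\<alpha>/2))"
  proof (intro kernel_estimate_0[where c=258])
    show "norm (?K y) \<le> 258 * ((norm (x' - x))\<^sup>2 * (t - \<tau>) powr (s - 2)) * gauss 16 (x - y) (t - \<tau>)" for y
      using hk_taylor[of "t - \<tau>" "x - y" "x' - y" s] assms by simp
    have "(\<integral>y. grad_hk s (x - y) (t - \<tau>) \<bullet> (x' - x) \<partial>lborel) = 0"
      using assms by (simp add: grad_hk_integrable grad_hk_integral)
    then show "(\<integral>y. ?K y \<partial>lborel) = 0"
      using assms i by (simp add: hk_integrable hk_integral_mass)
  qed (use assms in auto)
  moreover have "(\<integral>y. g (y, \<tau>) * (grad_hk s (x - y) (t - \<tau>) \<bullet> (x' - x)) \<partial>lborel) = DJ x t \<tau> \<bullet> (x' - x)"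
    unfolding DJ_def using assms by (subst integral_inner_left[symmetric]) (auto intro: grad_hk_integrable)
  ultimately show ?thesis using assms hk_integrable(2)[of "t - \<tau>"] i(2)
    by (simp add: J_def powr_add right_diff_distrib mult.assoc)
qed

text \<open>The masses at the two elapsed times differ, so they are subtracted explicitly; what
  remains has the same cancellation as a mean-zero kernel.\<close>

lemma J_time_diff:
  assumes "\<tau> < t'" "t' \<le> t" "t - t' \<le> t' - \<tau>" "norm x < 1"
  shows "norm (J x t \<tau> - g (x, \<tau>) * hk_mass TYPE('a) s (t - \<tau>) - (J x t' \<tau> - g (x, \<tau>) * hk_mass TYPE('a) s (t' - \<tau>))) 
     \<le> est_const TYPE('a) * N * ((t - t') * (t' - \<tau>) powr (s - 2 + \<alpha>/2))"
proof -
  let ?K = "\<lambda>y. hk s (x - y) (t - \<tau>) - hk s (x - y) (t' - \<tau>)"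
  have "norm ((\<integral>y. g (y, \<tau>) *\<^sub>R ?K y \<partial>lborel) - g (x, \<tau>) *\<^sub>R (\<integral>y. ?K y \<partial>lborel))
    \<le> est_const TYPE('a) * N * (((t - t') * (t' - \<tau>) powr (s - 2)) * (t' - \<tau>) powr (\<alpha>/2))"
  proof (intro kernel_estimate[where c="129 * (2 + real DIM('a))"])
    show "norm (?K y) \<le> 129 * (2 + real DIM('a)) * ((t - t') * (t' - \<tau>) powr (s - 2)) * gauss 16 (x - y) (t' - \<tau>)" for y
      using hk_time_diff[of "t' - \<tau>" "t - \<tau>" s "x - y"] s assms by (simp add: algebra_simps)
  qed (use assms in auto)
  moreover have "(\<integral>y. ?K y \<partial>lborel) = hk_mass TYPE('a) s (t - \<tau>) - hk_mass TYPE('a) s (t' - \<tau>)"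
    using assms by (simp add: hk_integrable hk_integral_mass)
  moreover have "(\<integral>y. g (y, \<tau>) *\<^sub>R ?K y \<partial>lborel) = J x t \<tau> - J x t' \<tau>"
    using assms hk_integrable(2)[of "t - \<tau>"] hk_integrable(2)[of "t' - \<tau>"]
    by (simp add: J_def right_diff_distrib)
  ultimately show ?thesis 
    by (simp add: powr_add right_diff_distrib mult.assoc diff_diff_eq2 diff_diff_eq add.commute)
qed

lemma DJ_time_diff:
  assumes "\<tau> < t'" "t' \<le> t" "t - t' \<le> t' - \<tau>" "norm x < 1"
  shows "norm (DJ x t \<tau> - DJ x t' \<tau>) \<le> est_const TYPE('a) * N * ((t - t') * (t' - \<tau>) powr (s - 5/2 + \<alpha>/2))"
proof -
  let ?K = "\<lambda>y. grad_hk s (x - y) (t - \<tau>) - grad_hk s (x - y) (t' - \<tau>)"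
  have "norm (\<integral>y. g (y, \<tau>) *\<^sub>R ?K y \<partial>lborel)
    \<le> est_const TYPE('a) * N * (((t - t') * (t' - \<tau>) powr (s - 5/2)) * (t' - \<tau>) powr (\<alpha>/2))"
  proof (intro kernel_estimate_0[where c="129 * (3 + real DIM('a))"])
    show "norm (?K y) \<le> 129 * (3 + real DIM('a)) * ((t - t') * (t' - \<tau>) powr (s - 5/2)) * gauss 16 (x - y) (t' - \<tau>)" for y
      using grad_hk_time_diff[of "t' - \<tau>" "t - \<tau>" s "x - y"] s assms by (simp add: algebra_simps)
    show "(\<integral>y. ?K y \<partial>lborel) = 0"
      using assms by (simp add: grad_hk_integrable grad_hk_integral)
  qed (use assms in auto)
  then show ?thesis using assms grad_hk_integrable(2)[of "t - \<tau>"] grad_hk_integrable(2)[of "t' - \<tau>"]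
    by (simp add: DJ_def powr_add scaleR_diff_right mult.assoc)
qed

end

section \<open>Bounds for the potential\<close>

text \<open>Trades a power of \<open>r\<close> for a power of the splitting point;
  \<open>a \<le> 1\<close> and \<open>1 \<le> c\<close> allow \<open>c powr a\<close> to be rounded
  up to \<open>c\<close>.\<close>

lemma powr_le_scaled:
  fixes r \<rho> c a :: real
  assumes "0 < r" "r \<le> c * \<rho>" "0 < \<rho>" "1 \<le> c" "0 \<le> a" "a \<le> 1"
  shows "r powr (b + a) \<le> c * (\<rho> powr a * r powr b)"
proof -
  have "r powr a \<le> (c * \<rho>) powr a" using assms by (intro powr_mono2) auto
  also have "\<dots> = c powr a * \<rho> powr a" using assms by (simp add: powr_mult)
  also have "\<dots> \<le> c powr 1 * \<rho> powr a" using assms by (intro mult_right_mono powr_mono) auto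
  finally have "r powr a \<le> c * \<rho> powr a" using assms by simp
  then have "r powr b * r powr a \<le> r powr b * (c * \<rho> powr a)" by (intro mult_left_mono) auto
  then show ?thesis by (simp add: powr_add mult_ac)
qed

lemma power2_powr: "d \<ge> 0 \<Longrightarrow> (d\<^sup>2) powr a = (d::real) powr (2 * a)"
  by (simp add: powr_powr flip: powr_numeral)

lemma gauss_mass_le_est_const: "gauss_mass TYPE('a::euclidean_space) 4 \<le> est_const TYPE('a)"
proof -
  have "gauss_mass TYPE('a) 4 \<le> gauss_mass TYPE('a) 32 * 1" by (simp add: gauss_mass_mono)
  also have "\<dots> \<le> gauss_mass TYPE('a) 32 * (4098 * (258 * (3 + real DIM('a))))"
    by (intro mult_left_mono) auto
  finally show ?thesis by (simp only: est_const_def mult_ac)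
qed

lemma hk_mass_nonneg [simp]: "0 \<le> hk_mass T s r"
  by (simp add: hk_mass_def)

lemma hk_mass_bound: "0 < r \<Longrightarrow> hk_mass TYPE('a::euclidean_space) s r \<le> est_const TYPE('a) * r powr (s - 1)"
  using gauss_mass_le_est_const[where 'a='a] by (simp add: hk_mass_def mult_right_mono)

lemma hk_mass_diff:
  assumes "0 < r" "r \<le> r1" "0 < s" "s < 1"
  shows "\<bar>hk_mass TYPE('a::euclidean_space) s r1 - hk_mass TYPE('a) s r\<bar> \<le> est_const TYPE('a) * ((r1 - r) * r powr (s - 2))"
proof -
  have "norm (r1 powr (s - 1) - r powr (s - 1)) \<le> r powr (s - 2) * norm (r1 - r)"
  proof (rule differentiable_bound[where S="{r..r1}"])
    fix x assume x: "x \<in> {r..r1}"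
    show "((\<lambda>r. r powr (s - 1)) has_derivative (\<lambda>v. ((s - 1) * x powr (s - 2)) * v)) (at x within {r..r1})"
      using has_real_derivative_powr[of x "s - 1"] x assms
      by (auto simp: has_field_derivative_def intro: has_derivative_at_withinI)
    have "\<bar>(s - 1) * x powr (s - 2)\<bar> \<le> 1 * r powr (s - 2)"
      unfolding abs_mult using x assms by (intro mult_mono) (auto intro: powr_mono2')
    then show "onorm (\<lambda>v. ((s - 1) * x powr (s - 2)) * v) \<le> r powr (s - 2)"
      by (intro onorm_bound) (auto simp: abs_mult intro!: mult_right_mono)
  qed (use assms in auto)
  then have "gauss_mass TYPE('a) 4 * \<bar>r1 powr (s - 1) - r powr (s - 1)\<bar> \<le> est_const TYPE('a) * (r powr (s - 2) * (r1 - r))"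
    using assms gauss_mass_le_est_const by (intro mult_mono) auto
  moreover have "hk_mass TYPE('a) s r1 - hk_mass TYPE('a) s r = gauss_mass TYPE('a) 4 * (r1 powr (s - 1) - r powr (s - 1))"
    using assms by (simp add: hk_mass_def right_diff_distrib)
  ultimately show ?thesis by (simp add: abs_mult mult_ac)
qed

text \<open>The cut at -4 is the lower end of the time support of the source. It makes the integral
  finite, as r^(s-1) is not integrable at infinity.\<close>

lemma hk_mass_integral:
  assumes "0 < s" "-4 < t"
  shows "integrable lborel (\<lambda>\<tau>. indicator {-4<..} \<tau> * hk_mass TYPE('a::euclidean_space) s (t - \<tau>))"
    and "(\<integral>\<tau>. indicator {-4<..} \<tau> * hk_mass TYPE('a) s (t - \<tau>) \<partial>lborel) = gauss_mass TYPE('a) 4 * ((t + 4) powr s / s)"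
proof -
  let ?R = "\<lambda>r. gauss_mass TYPE('a) 4 * (r powr (s - 1) * indicator {0..t + 4} r)"
  have i: "integrable lborel ?R" using assms by (intro integrable_mult_right powr_integral_from_0) auto
  \<comment> \<open>The two sides can differ only at \<tau> = -4, where the closed interval
    \<open>{0..t + 4}\<close> contains its endpoint and \<open>{-4<..}\<close> does not.\<close>
  have ae: "AE \<tau> in lborel. indicator {-4<..} \<tau> * hk_mass TYPE('a) s (t - \<tau>) = ?R (t - \<tau>)"
    using AE_lborel_singleton[of "-4::real"] by eventually_elim (auto simp: hk_mass_def indicator_def)
  have m: "(\<lambda>\<tau>. indicator {-4<..} \<tau> * hk_mass TYPE('a) s (t - \<tau>)) \<in> borel_measurable lborel"
    unfolding hk_mass_def by measurable
  have m': "(\<lambda>\<tau>. ?R (t - \<tau>)) \<in> borel_measurable lborel"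
    by measurable
  show "integrable lborel (\<lambda>\<tau>. indicator {-4<..} \<tau> * hk_mass TYPE('a) s (t - \<tau>))"
    unfolding integrable_cong_AE[OF m m' ae] by (rule integrable_reflect[OF i])
  have "(\<integral>\<tau>. indicator {-4<..} \<tau> * hk_mass TYPE('a) s (t - \<tau>) \<partial>lborel) = (\<integral>r. ?R r \<partial>lborel)"
    unfolding integral_cong_AE[OF m m' ae] by (rule integrable_reflect[OF i])
  then show "(\<integral>\<tau>. indicator {-4<..} \<tau> * hk_mass TYPE('a) s (t - \<tau>) \<partial>lborel) = gauss_mass TYPE('a) 4 * ((t + 4) powr s / s)"
    using assms by (simp add: powr_integral_from_0)
qed

text \<open>The bound \<open>1 \<le> a\<close> stays away from 0, where x^s is not Lipschitz. It is
  met with \<open>a = t' + 4\<close>, as times in the unit cylinder exceed -1.\<close>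

lemma powr_diff_le:
  assumes "1 \<le> a" "a \<le> b" "0 < s" "s < 1"
  shows "b powr s / s - a powr s / s \<le> b - (a::real)"
proof -
  have "\<bar>b powr s / s - a powr s / s\<bar> \<le> 1 * norm (b - a)"
    unfolding real_norm_def[symmetric]
  proof (rule differentiable_bound[where S="{a..b}"])
    fix x assume x: "x \<in> {a..b}"
    show "((\<lambda>x. x powr s / s) has_derivative (\<lambda>v. x powr (s - 1) * v)) (at x within {a..b})"
      using DERIV_cdivide[OF has_real_derivative_powr[of x s], of s] x assms
      by (auto simp: has_field_derivative_def intro: has_derivative_at_withinI)
    have "x powr (s - 1) \<le> x powr 0" using x assms by (intro powr_mono) auto
    then have "x powr (s - 1) \<le> 1" using x assms by simp
    then show "onorm (\<lambda>v. x powr (s - 1) * v) \<le> 1"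
      by (intro onorm_bound) (auto simp: abs_mult intro!: mult_left_le_one_le)
  qed (use assms in auto)
  then show ?thesis using assms by auto
qed

section \<open>The potential and its increments in space\<close>

context source_term begin

definition w :: "'a \<Rightarrow> real \<Rightarrow> real" where "w x t = (\<integral>\<tau>. J x t \<tau> \<partial>lborel)"
definition Dw :: "'a \<Rightarrow> real \<Rightarrow> 'a" where "Dw x t = (\<integral>\<tau>. DJ x t \<tau> \<partial>lborel)"

lemma EN_nonneg [simp]: "0 \<le> est_const TYPE('a) * N" 
  using N_nonneg by simp

text \<open>With splitting point 4 the near range \<open>{0..8}\<close> contains every elapsed time
  at which \<open>J\<close> is nonzero, so \<open>radial_near\<close> applies without a case
  distinction.\<close>

lemma J_bound_radial:
  assumes "t \<le> 4"
  shows "norm (J x t \<tau>) \<le> est_const TYPE('a) * N * (radial 0 2 s 4 (t - \<tau>) + radial 0 2 s 4 (t - \<tau>))"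
proof (cases "t \<le> \<tau> \<or> 4 \<le> \<bar>\<tau>\<bar>")
  case True then show ?thesis by (simp add: J_zero)
next
  case False
  then have \<tau>: "\<tau> < t" "-4 < \<tau>" "\<tau> < 4" by auto
  then have "(t - \<tau>) powr (s - 1) \<le> radial 0 2 s 4 (t - \<tau>)"
    using radial_near[of "t - \<tau>" 4 0 s 2] assms by simp
  then have "est_const TYPE('a) * N * (t - \<tau>) powr (s - 1)
      \<le> est_const TYPE('a) * N * (radial 0 2 s 4 (t - \<tau>) + radial 0 2 s 4 (t - \<tau>))"
    by (intro mult_left_mono[OF _ EN_nonneg] add_increasing2[OF radial_nonneg])
  then show ?thesis using J_bound[of \<tau> t x] False by linarith
qed

lemma DJ_bound_radial:
  assumes "t \<le> 4" "norm x < 1"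
  shows "norm (DJ x t \<tau>) \<le> est_const TYPE('a) * N * (radial 0 2 (s + \<alpha>/2 - 1/2) 4 (t - \<tau>) + radial 0 2 (s + \<alpha>/2 - 1/2) 4 (t - \<tau>))"
proof (cases "t \<le> \<tau> \<or> 4 \<le> \<bar>\<tau>\<bar>")
  case True then show ?thesis by (simp add: DJ_zero)
next
  case False
  then have \<tau>: "\<tau> < t" "-4 < \<tau>" "\<tau> < 4" by auto
  then have "(t - \<tau>) powr (s - 3/2 + \<alpha>/2) \<le> radial 0 2 (s + \<alpha>/2 - 1/2) 4 (t - \<tau>)"
    using radial_near[of "t - \<tau>" 4 0 "s + \<alpha>/2 - 1/2" 2] assms by (simp add: algebra_simps)
  then have "est_const TYPE('a) * N * (t - \<tau>) powr (s - 3/2 + \<alpha>/2)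
      \<le> est_const TYPE('a) * N * (radial 0 2 (s + \<alpha>/2 - 1/2) 4 (t - \<tau>) + radial 0 2 (s + \<alpha>/2 - 1/2) 4 (t - \<tau>))"
    by (intro mult_left_mono[OF _ EN_nonneg] add_increasing2[OF radial_nonneg])
  then show ?thesis using DJ_bound[of \<tau> t x] False assms by linarith
qed

lemma J_integrable:
  assumes "t \<le> 4"
  shows "integrable lborel (J x t)"
proof (rule Bochner_Integration.integrable_bound)
  show "integrable lborel (\<lambda>\<tau>. est_const TYPE('a) * N * (radial 0 2 s 4 (t - \<tau>) + radial 0 2 s 4 (t - \<tau>)))"
    using s by (intro integrable_mult_right Bochner_Integration.integrable_add integrable_reflect radial_integrable) auto
  show "AE \<tau> in lborel. norm (J x t \<tau>) \<le> norm (est_const TYPE('a) * N * (radial 0 2 s 4 (t - \<tau>) + radial 0 2 s 4 (t - \<tau>)))"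
    using order_trans[OF J_bound_radial[OF assms] abs_ge_self] by auto
qed measurable

lemma DJ_integrable:
  assumes "t \<le> 4" "norm x < 1" "1 < 2 * s + \<alpha>"
  shows "integrable lborel (DJ x t)"
proof (rule Bochner_Integration.integrable_bound)
  let ?R = "radial 0 2 (s + \<alpha>/2 - 1/2) 4"
  show "integrable lborel (\<lambda>\<tau>. est_const TYPE('a) * N * (?R (t - \<tau>) + ?R (t - \<tau>)))"
    using assms by (intro integrable_mult_right Bochner_Integration.integrable_add integrable_reflect radial_integrable) auto
  show "AE \<tau> in lborel. norm (DJ x t \<tau>) \<le> norm (est_const TYPE('a) * N * (?R (t - \<tau>) + ?R (t - \<tau>)))"
    using order_trans[OF DJ_bound_radial[OF assms(1,2)] abs_ge_self] by auto
qed measurable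

lemma w_bound:
  assumes "t \<le> 4"
  shows "norm (w x t) \<le> 2 * (est_const TYPE('a) * N) * (\<integral>r. radial 0 2 s 4 r \<partial>lborel)"
  unfolding w_def
  by (intro time_integral_bound[where R="radial 0 2 s 4" and t=t and t'=t] radial_integrable J_bound_radial assms)
     (use s in auto)

lemma Dw_bound:
  assumes "t \<le> 4" "norm x < 1" "1 < 2 * s + \<alpha>"
  shows "norm (Dw x t) \<le> 2 * (est_const TYPE('a) * N) * (\<integral>r. radial 0 2 (s + \<alpha>/2 - 1/2) 4 r \<partial>lborel)"
  unfolding Dw_def
  by (intro time_integral_bound[where R="radial 0 2 (s + \<alpha>/2 - 1/2) 4" and t=t and t'=t] radial_integrable DJ_bound_radial assms)
     (use assms in auto)

text \<open>For elapsed times below the squared distance the kernel increment gives no gain. Each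
  \<open>J\<close> is instead compared with the mass times the value of \<open>g\<close> at its own
  point; the two errors and the increment of \<open>g\<close> are each at most one multiple of
  d^\<alpha> r^(s-1), hence the 3.\<close>

lemma J_space_near:
  assumes "\<tau> < t" "norm x < 1" "norm x' < 1" "t - \<tau> \<le> (norm (x' - x))\<^sup>2"
  shows "norm (J x' t \<tau> - J x t \<tau>) \<le> est_const TYPE('a) * N * (3 * (norm (x' - x) powr \<alpha> * (t - \<tau>) powr (s - 1)))"
proof -
  let ?r = "t - \<tau>" and ?d = "norm (x' - x)"
  have d: "0 < ?d" using assms by (cases "x = x'") auto
  have "norm (J x' t \<tau> - J x t \<tau>) \<le> norm (J x' t \<tau> - g (x', \<tau>) * hk_mass TYPE('a) s ?r)
      + norm (J x t \<tau> - g (x, \<tau>) * hk_mass TYPE('a) s ?r) + \<bar>g (x', \<tau>) - g (x, \<tau>)\<bar> * \<bar>hk_mass TYPE('a) s ?r\<bar>"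
    unfolding abs_mult[symmetric] left_diff_distrib real_norm_def by linarith
  also have "\<dots> \<le> est_const TYPE('a) * N * ?r powr (s - 1 + \<alpha>/2) + est_const TYPE('a) * N * ?r powr (s - 1 + \<alpha>/2)
     + (N * ?d powr \<alpha>) * (est_const TYPE('a) * ?r powr (s - 1))"
    using assms g_space[of x x' \<tau>] N_nonneg hk_mass_bound[of ?r s, where 'a='a]
    by (intro add_mono J_mass_diff mult_mono) (auto simp: norm_minus_commute)
  also have "\<dots> = est_const TYPE('a) * N * (2 * ?r powr (s - 1 + \<alpha>/2) + ?d powr \<alpha> * ?r powr (s - 1))"
    by (simp add: algebra_simps)
  also have "\<dots> \<le> est_const TYPE('a) * N * (3 * (?d powr \<alpha> * ?r powr (s - 1)))"
    using powr_le_scaled[of ?r 1 "?d\<^sup>2" "\<alpha>/2" "s - 1"] assms d \<alpha> 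
    by (intro mult_left_mono) (auto simp: power2_powr)
  finally show ?thesis .
qed

text \<open>With \<open>\<rho> = d^2\<close>, the near exponent \<alpha>/2 encodes the factor
  d^\<alpha> of \<open>J_space_near\<close>, and the far exponent 1/2 the first-order factor d of
  \<open>J_space_diff\<close>.\<close>

lemma J_space_radial:
  assumes "norm x < 1" "norm x' < 1" "x \<noteq> x'" "t \<le> 4"
  shows "norm (J x' t \<tau> - J x t \<tau>) 
    \<le> 3 * (est_const TYPE('a) * N) * (radial (\<alpha>/2) (1/2) (s + \<alpha>/2) ((norm (x' - x))\<^sup>2) (t - \<tau>)
         + radial (\<alpha>/2) (1/2) (s + \<alpha>/2) ((norm (x' - x))\<^sup>2) (t - \<tau>))"
proof (cases "t \<le> \<tau> \<or> 4 \<le> \<bar>\<tau>\<bar>")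
  case True then show ?thesis using N_nonneg by (simp add: J_zero)
next
  case False
  then have \<tau>: "\<tau> < t" "-4 < \<tau>" "\<tau> < 4" by auto
  let ?r = "t - \<tau>" and ?d = "norm (x' - x)"
  let ?R = "radial (\<alpha>/2) (1/2) (s + \<alpha>/2) (?d\<^sup>2)"
  have d: "0 < ?d" using assms by auto
  have R: "0 \<le> ?R ?r" by simp
  have "norm (J x' t \<tau> - J x t \<tau>) \<le> est_const TYPE('a) * N * (3 * ?R ?r)"
  proof (cases "?r \<le> ?d\<^sup>2")
    case True
    have "?d powr \<alpha> * ?r powr (s - 1) \<le> ?R ?r"
      using radial_near[of ?r "?d\<^sup>2" "\<alpha>/2" "s + \<alpha>/2" "1/2"] True False d by (simp add: power2_powr algebra_simps)
    then have "est_const TYPE('a) * N * (3 * (?d powr \<alpha> * ?r powr (s - 1))) \<le> est_const TYPE('a) * N * (3 * ?R ?r)"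
      by (intro mult_left_mono) auto
    then show ?thesis using J_space_near[of \<tau> t x x'] assms False True by linarith
  next
    case far: False
    have "?d * ?r powr (s - 3/2 + \<alpha>/2) \<le> ?R ?r"
      using radial_far[of "?d\<^sup>2" ?r "1/2" "s + \<alpha>/2" "\<alpha>/2"] far \<tau> d assms by (simp add: power2_powr algebra_simps)
    then have "?d * ?r powr (s - 3/2 + \<alpha>/2) \<le> 3 * ?R ?r" using R by linarith
    then have "est_const TYPE('a) * N * (?d * ?r powr (s - 3/2 + \<alpha>/2)) \<le> est_const TYPE('a) * N * (3 * ?R ?r)"
      by (intro mult_left_mono) auto
    moreover have "norm (J x' t \<tau> - J x t \<tau>) \<le> est_const TYPE('a) * N * (?d * ?r powr (s - 3/2 + \<alpha>/2))"
      using J_space_diff[of \<tau> t x x'] far False assms by (simp add: norm_minus_commute)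
    ultimately show ?thesis by linarith
  qed
  also have "\<dots> \<le> 3 * (est_const TYPE('a) * N) * (?R ?r + ?R ?r)"
    using R mult_nonneg_nonneg[OF EN_nonneg R] by (simp add: algebra_simps)
  finally show ?thesis .
qed

text \<open>Here \<open>p = s + \<alpha>/2\<close> meets the far exponent 1/2, which is the
  comparison of 2s + \<alpha> with 1.\<close>

lemma w_space_diff:
  assumes "norm x < 1" "norm x' < 1" "x \<noteq> x'" "t \<le> 4"
  shows "norm (w x' t - w x t) \<le> 6 * (est_const TYPE('a) * N) * (\<integral>r. radial (\<alpha>/2) (1/2) (s + \<alpha>/2) ((norm (x' - x))\<^sup>2) r \<partial>lborel)"
proof -
  let ?R = "radial (\<alpha>/2) (1/2) (s + \<alpha>/2) ((norm (x' - x))\<^sup>2)"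
  have "w x' t - w x t = (\<integral>\<tau>. J x' t \<tau> - J x t \<tau> \<partial>lborel)"
    unfolding w_def using assms by (simp add: J_integrable)
  also have "norm \<dots> \<le> 2 * (3 * (est_const TYPE('a) * N)) * (\<integral>r. ?R r \<partial>lborel)"
    by (intro time_integral_bound[where R="?R" and t=t and t'=t] J_space_radial radial_integrable assms)
       (use s assms N_nonneg in auto)
  finally show ?thesis by simp
qed

text \<open>Since the gradient kernel has mean zero, near the singularity each \<open>DJ\<close> is
  small enough by itself; this is the near exponent 0. In the far part
  \<open>p = s + \<alpha>/2 - 1/2\<close> meets 1/2, the comparison of 2s + \<alpha> with 2.\<close>

lemma Dw_space_diff:
  assumes "norm x < 1" "norm x' < 1" "x \<noteq> x'" "t \<le> 4" "1 < 2 * s + \<alpha>"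
  shows "norm (Dw x' t - Dw x t) \<le> 4 * (est_const TYPE('a) * N) * (\<integral>r. radial 0 (1/2) (s + \<alpha>/2 - 1/2) ((norm (x' - x))\<^sup>2) r \<partial>lborel)"
proof -
  let ?d = "norm (x' - x)"
  let ?R = "radial 0 (1/2) (s + \<alpha>/2 - 1/2) (?d\<^sup>2)"
  have d: "0 < ?d" using assms by auto
  have bd: "norm (DJ x' t \<tau> - DJ x t \<tau>) \<le> 2 * (est_const TYPE('a) * N) * (?R (t - \<tau>) + ?R (t - \<tau>))" for \<tau>
  proof (cases "t \<le> \<tau> \<or> 4 \<le> \<bar>\<tau>\<bar>")
    case True then show ?thesis using N_nonneg by (simp add: DJ_zero)
  next
    case False
    then have \<tau>: "\<tau> < t" "-4 < \<tau>" "\<tau> < 4" by auto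
    let ?r = "t - \<tau>"
    have R: "0 \<le> ?R ?r" by simp
    have "norm (DJ x' t \<tau> - DJ x t \<tau>) \<le> est_const TYPE('a) * N * (2 * ?R ?r)"
    proof (cases "?r \<le> ?d\<^sup>2")
      case True
      have "?r powr (s - 3/2 + \<alpha>/2) \<le> ?R ?r"
        using radial_near[of ?r "?d\<^sup>2" 0 "s + \<alpha>/2 - 1/2" "1/2"] True False d by (simp add: algebra_simps)
      then have "est_const TYPE('a) * N * (2 * ?r powr (s - 3/2 + \<alpha>/2)) \<le> est_const TYPE('a) * N * (2 * ?R ?r)"
        by (intro mult_left_mono) auto
      moreover have "norm (DJ x' t \<tau> - DJ x t \<tau>) \<le> norm (DJ x' t \<tau>) + norm (DJ x t \<tau>)"
        by (rule norm_triangle_ineq4)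
      ultimately show ?thesis using DJ_bound[of \<tau> t x] DJ_bound[of \<tau> t x'] assms False by linarith
    next
      case far: False
      have "?d * ?r powr (s - 2 + \<alpha>/2) \<le> ?R ?r"
        using radial_far[of "?d\<^sup>2" ?r "1/2" "s + \<alpha>/2 - 1/2" 0] far \<tau> d assms by (simp add: power2_powr algebra_simps)
      then have "?d * ?r powr (s - 2 + \<alpha>/2) \<le> 2 * ?R ?r" using R by linarith
      then have "est_const TYPE('a) * N * (?d * ?r powr (s - 2 + \<alpha>/2)) \<le> est_const TYPE('a) * N * (2 * ?R ?r)"
        by (intro mult_left_mono) auto
      moreover have "norm (DJ x' t \<tau> - DJ x t \<tau>) \<le> est_const TYPE('a) * N * (?d * ?r powr (s - 2 + \<alpha>/2))"
        using DJ_space_diff[of \<tau> t x x'] far False assms by (simp add: norm_minus_commute)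
      ultimately show ?thesis by linarith
    qed
    also have "\<dots> \<le> 2 * (est_const TYPE('a) * N) * (?R ?r + ?R ?r)"
      using R mult_nonneg_nonneg[OF EN_nonneg R] by (simp add: algebra_simps)
    finally show ?thesis .
  qed
  have "Dw x' t - Dw x t = (\<integral>\<tau>. DJ x' t \<tau> - DJ x t \<tau> \<partial>lborel)"
    unfolding Dw_def using assms by (simp add: DJ_integrable)
  also have "norm \<dots> \<le> 2 * (2 * (est_const TYPE('a) * N)) * (\<integral>r. ?R r \<partial>lborel)"
    by (intro time_integral_bound[where R="?R" and t=t and t'=t] bd radial_integrable)
       (use s assms N_nonneg in auto)
  finally show ?thesis by simp
qed

text \<open>The near exponent 1/2 is that of the linear term, d r^(s-3/2+\<alpha>/2), and the far
  exponent 1 that of the quadratic remainder. Integrability at 0 means 1/2 < s + \<alpha>/2, the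
  condition 1 < 2s + \<alpha> under which \<open>Dw\<close> converges.\<close>

lemma w_taylor:
  assumes "norm x < 1" "norm x' < 1" "x \<noteq> x'" "t \<le> 4" "1 < 2 * s + \<alpha>"
  shows "norm (w x' t - w x t - Dw x t \<bullet> (x' - x)) \<le> 8 * (est_const TYPE('a) * N) * (\<integral>r. radial (1/2) 1 (s + \<alpha>/2) ((norm (x' - x))\<^sup>2) r \<partial>lborel)"
proof -
  let ?d = "norm (x' - x)"
  let ?R = "radial (1/2) 1 (s + \<alpha>/2) (?d\<^sup>2)"
  have d: "0 < ?d" using assms by auto
  have bd: "norm (J x' t \<tau> - J x t \<tau> - DJ x t \<tau> \<bullet> (x' - x)) \<le> 4 * (est_const TYPE('a) * N) * (?R (t - \<tau>) + ?R (t - \<tau>))" for \<tau>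
  proof (cases "t \<le> \<tau> \<or> 4 \<le> \<bar>\<tau>\<bar>")
    case True then show ?thesis using N_nonneg by (simp add: J_zero DJ_zero)
  next
    case False
    then have \<tau>: "\<tau> < t" "-4 < \<tau>" "\<tau> < 4" by auto
    let ?r = "t - \<tau>"
    have R: "0 \<le> ?R ?r" by simp
    have "norm (J x' t \<tau> - J x t \<tau> - DJ x t \<tau> \<bullet> (x' - x)) \<le> est_const TYPE('a) * N * (4 * ?R ?r)"
    proof (cases "?r \<le> ?d\<^sup>2")
      case True
      have n: "?d * ?r powr (s - 3/2 + \<alpha>/2) \<le> ?R ?r"
        using radial_near[of ?r "?d\<^sup>2" "1/2" "s + \<alpha>/2" "1"] True False d by (simp add: power2_powr algebra_simps)
      \<comment> \<open>From r \<le> d^2 follows r^((1-\<alpha>)/2) \<le> d^(1-\<alpha>), which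
        brings the bound d^\<alpha> r^(s-1) for the increment of \<open>J\<close> to the order of
        the linear term.\<close>
      have "(?r powr (s - 3/2 + \<alpha>/2 + (1/2 - \<alpha>/2))) \<le> 1 * ((?d\<^sup>2) powr (1/2 - \<alpha>/2) * ?r powr (s - 3/2 + \<alpha>/2))"
        using True False d \<alpha> by (intro powr_le_scaled) auto
      then have "?d powr \<alpha> * ?r powr (s - 1) \<le> ?d powr \<alpha> * (?d powr (1 - \<alpha>) * ?r powr (s - 3/2 + \<alpha>/2))"
        by (intro mult_left_mono) (auto simp: power2_powr algebra_simps)
      also have "\<dots> = ?d * ?r powr (s - 3/2 + \<alpha>/2)" using d by (simp add: powr_diff)
      finally have "est_const TYPE('a) * N * (3 * (?d powr \<alpha> * ?r powr (s - 1))) \<le> est_const TYPE('a) * N * (3 * ?R ?r)"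
        using n by (intro mult_left_mono) auto
      then have 1: "norm (J x' t \<tau> - J x t \<tau>) \<le> est_const TYPE('a) * N * (3 * ?R ?r)"
        using J_space_near[of \<tau> t x x'] assms False True by linarith
      have "\<bar>DJ x t \<tau> \<bullet> (x' - x)\<bar> \<le> norm (DJ x t \<tau>) * ?d" by (rule Cauchy_Schwarz_ineq2)
      also have "\<dots> \<le> (est_const TYPE('a) * N * ?r powr (s - 3/2 + \<alpha>/2)) * ?d"
        using DJ_bound[of \<tau> t x] assms False by (intro mult_right_mono) auto
      also have "\<dots> = est_const TYPE('a) * N * (?d * ?r powr (s - 3/2 + \<alpha>/2))" by simp
      also have "\<dots> \<le> est_const TYPE('a) * N * ?R ?r" using n by (intro mult_left_mono) auto
      finally show ?thesis using 1 by (auto simp: abs_if algebra_simps split: if_splits)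
    next
      case far: False
      have "?d\<^sup>2 * ?r powr (s - 2 + \<alpha>/2) \<le> ?R ?r"
        using radial_far[of "?d\<^sup>2" ?r "1" "s + \<alpha>/2" "1/2"] far \<tau> d assms by (simp add: algebra_simps)
      then have "?d\<^sup>2 * ?r powr (s - 2 + \<alpha>/2) \<le> 4 * ?R ?r" using R by linarith
      then have "est_const TYPE('a) * N * (?d\<^sup>2 * ?r powr (s - 2 + \<alpha>/2)) \<le> est_const TYPE('a) * N * (4 * ?R ?r)"
        by (intro mult_left_mono) auto
      moreover have "norm (J x' t \<tau> - J x t \<tau> - DJ x t \<tau> \<bullet> (x' - x)) \<le> est_const TYPE('a) * N * (?d\<^sup>2 * ?r powr (s - 2 + \<alpha>/2))"
        using J_taylor[of \<tau> t x x'] far False assms by (simp add: norm_minus_commute)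
      ultimately show ?thesis by linarith
    qed
    also have "\<dots> \<le> 4 * (est_const TYPE('a) * N) * (?R ?r + ?R ?r)"
      using R mult_nonneg_nonneg[OF EN_nonneg R] by (simp add: algebra_simps)
    finally show ?thesis .
  qed
  have "Dw x t \<bullet> (x' - x) = (\<integral>\<tau>. DJ x t \<tau> \<bullet> (x' - x) \<partial>lborel)"
    unfolding Dw_def using assms by (simp add: DJ_integrable)
  then have "w x' t - w x t - Dw x t \<bullet> (x' - x) = (\<integral>\<tau>. J x' t \<tau> - J x t \<tau> - DJ x t \<tau> \<bullet> (x' - x) \<partial>lborel)"
    unfolding w_def using assms by (simp add: J_integrable DJ_integrable)
  also have "norm \<dots> \<le> 2 * (4 * (est_const TYPE('a) * N)) * (\<integral>r. ?R r \<partial>lborel)"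
    by (intro time_integral_bound[where R="?R" and t=t and t'=t] bd radial_integrable)
       (use s assms N_nonneg in auto)
  finally show ?thesis by simp
qed

section \<open>Increments of the potential in time\<close>

lemma Dw_time_diff:
  assumes "norm x < 1" "t' < t" "t \<le> 4" "1 < 2 * s + \<alpha>"
  shows "norm (Dw x t - Dw x t') \<le> 2 * (est_const TYPE('a) * N) * (\<integral>r. radial 0 1 (s + \<alpha>/2 - 1/2) (t - t') r \<partial>lborel)"
proof -
  let ?R = "radial 0 1 (s + \<alpha>/2 - 1/2) (t - t')"
  \<comment> \<open>Stated for both times at once: if \<open>t' - \<tau> \<le> t - t'\<close>, then
    \<open>t - \<tau> \<le> 2 * (t - t')\<close>, so both elapsed times lie in the near
    range.\<close>
  have near: "norm (DJ x u \<tau>) \<le> est_const TYPE('a) * N * ?R (u - \<tau>)"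
    if "u - \<tau> \<le> 2 * (t - t')" "u \<le> 4" for \<tau> u
  proof (cases "u \<le> \<tau> \<or> 4 \<le> \<bar>\<tau>\<bar>")
    case True then show ?thesis using N_nonneg by (simp add: DJ_zero)
  next
    case False
    then have "(u - \<tau>) powr (s - 3/2 + \<alpha>/2) \<le> ?R (u - \<tau>)"
      using radial_near[of "u - \<tau>" "t - t'" 0 "s + \<alpha>/2 - 1/2" 1] that assms by (simp add: algebra_simps)
    then have "est_const TYPE('a) * N * (u - \<tau>) powr (s - 3/2 + \<alpha>/2) \<le> est_const TYPE('a) * N * ?R (u - \<tau>)"
      by (intro mult_left_mono) auto
    then show ?thesis using DJ_bound[of \<tau> u x] assms False by linarith
  qed
  have bd: "norm (DJ x t \<tau> - DJ x t' \<tau>) \<le> est_const TYPE('a) * N * (?R (t - \<tau>) + ?R (t' - \<tau>))" for \<tau>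
  proof (cases "4 \<le> \<bar>\<tau>\<bar> \<or> t' - \<tau> \<le> t - t'")
    case True 
    show ?thesis
    proof (cases "4 \<le> \<bar>\<tau>\<bar>")
      case True then show ?thesis using N_nonneg by (simp add: DJ_zero)
    next
      case False
      then show ?thesis using near[of t \<tau>] near[of t' \<tau>] norm_triangle_ineq4[of "DJ x t \<tau>" "DJ x t' \<tau>"] True assms
        by (auto simp: distrib_left)
    qed
  next
    case False
    then have \<tau>: "-4 < \<tau>" "t - t' \<le> t' - \<tau>" by auto
    have "(t - t') * (t' - \<tau>) powr (s - 5/2 + \<alpha>/2) \<le> ?R (t' - \<tau>)"
      using radial_far[of "t - t'" "t' - \<tau>" 1 "s + \<alpha>/2 - 1/2" 0] \<tau> assms by (simp add: algebra_simps)
    then have "(t - t') * (t' - \<tau>) powr (s - 5/2 + \<alpha>/2) \<le> ?R (t - \<tau>) + ?R (t' - \<tau>)" by (intro add_increasing) auto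
    then have "est_const TYPE('a) * N * ((t - t') * (t' - \<tau>) powr (s - 5/2 + \<alpha>/2)) 
        \<le> est_const TYPE('a) * N * (?R (t - \<tau>) + ?R (t' - \<tau>))"
      by (intro mult_left_mono) auto
    then show ?thesis using DJ_time_diff[of \<tau> t' t x] False assms by linarith
  qed
  have "Dw x t - Dw x t' = (\<integral>\<tau>. DJ x t \<tau> - DJ x t' \<tau> \<partial>lborel)"
    unfolding Dw_def using assms by (simp add: DJ_integrable)
  also have "norm \<dots> \<le> 2 * (est_const TYPE('a) * N) * (\<integral>r. ?R r \<partial>lborel)"
    by (intro time_integral_bound[where R="?R" and t=t and t'=t'] bd radial_integrable)
       (use s assms N_nonneg in auto)
  finally show ?thesis .
qed

text \<open>Freezing at \<open>g (x, t)\<close> in place of \<open>g (x, \<tau>)\<close>, with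
  \<open>t\<close> the later of the two compared times, makes the coefficient of the mass constant
  in \<tau>. The price is a time increment of \<open>g\<close> over at most
  \<open>2 * \<delta>\<close>, of the same order as the spatial error; each contributes 2 to the
  constant 4.\<close>

lemma J_time_near:
  assumes "norm x < 1" "u \<le> t" "\<bar>t\<bar> < 4" "-4 < \<tau>" "\<delta> > 0" "u - \<tau> \<le> 2 * \<delta>" "t - \<tau> \<le> 2 * \<delta>"
  shows "norm (J x u \<tau> - g (x, t) * hk_mass TYPE('a) s (u - \<tau>)) 
     \<le> 4 * (est_const TYPE('a) * N) * radial (\<alpha>/2) 1 (s + \<alpha>/2) \<delta> (u - \<tau>)"
proof (cases "u \<le> \<tau>")
  case True then show ?thesis using N_nonneg by (simp add: J_zero hk_mass_def)
next
  case False
  let ?r = "u - \<tau>"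
  let ?m = "hk_mass TYPE('a) s ?r"
  have "norm (J x u \<tau> - g (x, t) * ?m) 
      \<le> norm (J x u \<tau> - g (x, \<tau>) * ?m) + \<bar>g (x, t) - g (x, \<tau>)\<bar> * \<bar>?m\<bar>"
    unfolding abs_mult[symmetric] left_diff_distrib real_norm_def by linarith
  also have "\<dots> \<le> est_const TYPE('a) * N * ?r powr (s - 1 + \<alpha>/2)
     + (N * \<bar>t - \<tau>\<bar> powr (\<alpha>/2)) * (est_const TYPE('a) * ?r powr (s - 1))"
    using assms False N_nonneg hk_mass_bound[of ?r s, where 'a='a]
    by (intro add_mono J_mass_diff mult_mono g_time) auto
  also have "\<dots> = est_const TYPE('a) * N * (?r powr (s - 1 + \<alpha>/2) + \<bar>t - \<tau>\<bar> powr (\<alpha>/2) * ?r powr (s - 1))"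
    by (simp add: algebra_simps)
  also have "\<dots> \<le> est_const TYPE('a) * N * (4 * (\<delta> powr (\<alpha>/2) * ?r powr (s - 1)))"
  proof (intro mult_left_mono)
    have "?r powr (s - 1 + \<alpha>/2) \<le> 2 * (\<delta> powr (\<alpha>/2) * ?r powr (s - 1))"
      using assms False \<alpha> by (intro powr_le_scaled) auto
    moreover have "\<bar>t - \<tau>\<bar> powr (\<alpha>/2) \<le> 2 * \<delta> powr (\<alpha>/2)"
      using powr_le_scaled[of "t - \<tau>" 2 \<delta> "\<alpha>/2" 0] assms False \<alpha> by auto
    then have "\<bar>t - \<tau>\<bar> powr (\<alpha>/2) * ?r powr (s - 1) \<le> (2 * \<delta> powr (\<alpha>/2)) * ?r powr (s - 1)"
      by (intro mult_right_mono) auto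
    ultimately show "?r powr (s - 1 + \<alpha>/2) + \<bar>t - \<tau>\<bar> powr (\<alpha>/2) * ?r powr (s - 1) \<le> 4 * (\<delta> powr (\<alpha>/2) * ?r powr (s - 1))"
      by linarith
  qed simp
  also have "\<dots> \<le> est_const TYPE('a) * N * (4 * radial (\<alpha>/2) 1 (s + \<alpha>/2) \<delta> ?r)"
    using radial_near[of ?r \<delta> "\<alpha>/2" "s + \<alpha>/2" 1] assms False
    by (intro mult_left_mono) (auto simp: algebra_simps)
  finally show ?thesis by simp
qed

text \<open>Constants survive a time difference because the mass of \<open>hk\<close> depends on the
  elapsed time. They are removed with the single coefficient \<open>g (x, t)\<close>, so that
  \<open>?F\<close> is small enough for \<open>radial\<close>; the removed part integrates to the
  Lipschitz term that ends the bound.\<close>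

lemma w_time_diff:
  assumes "norm x < 1" "t' < t" "\<bar>t\<bar> < 1" "\<bar>t'\<bar> < 1"
  shows "norm (w x t - w x t') \<le> 8 * (est_const TYPE('a) * N) * (\<integral>r. radial (\<alpha>/2) 1 (s + \<alpha>/2) (t - t') r \<partial>lborel)
     + est_const TYPE('a) * N * (t - t')"
proof -
  define \<delta> where "\<delta> = t - t'"
  have \<delta>: "\<delta> > 0" using assms by (simp add: \<delta>_def)
  let ?R = "radial (\<alpha>/2) 1 (s + \<alpha>/2) \<delta>"
  let ?m = "hk_mass TYPE('a) s"
  \<comment> \<open>the part on which the increments of \<open>g\<close> give no gain; it is integrated exactly\<close>
  let ?H = "\<lambda>\<tau>. indicator {-4<..} \<tau> * ?m (t - \<tau>) - indicator {-4<..} \<tau> * ?m (t' - \<tau>)"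
  let ?F = "\<lambda>\<tau>. J x t \<tau> - J x t' \<tau> - g (x, t) * ?H \<tau>"
  let ?E = "est_const TYPE('a) * N"
  have bd: "norm (?F \<tau>) \<le> 4 * ?E * (?R (t - \<tau>) + ?R (t' - \<tau>))" for \<tau>
  proof (cases "4 \<le> \<bar>\<tau>\<bar>")
    case True
    \<comment> \<open>For \<tau> \<ge> 4 both masses vanish as the elapsed times are negative; for
      \<tau> \<le> -4 the indicator vanishes.\<close>
    then have "?F \<tau> = 0" using assms by (auto simp: J_zero hk_mass_def indicator_def)
    then show ?thesis using N_nonneg by simp
  next
    case in4: False
    then have "-4 < \<tau>" by linarith
    then have F: "?F \<tau> = (J x t \<tau> - g (x, t) * ?m (t - \<tau>)) - (J x t' \<tau> - g (x, t) * ?m (t' - \<tau>))"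
      by (simp add: indicator_def algebra_simps)
    show ?thesis
    proof (cases "t' - \<tau> \<le> \<delta>")
      case True
      have "norm (J x t \<tau> - g (x, t) * ?m (t - \<tau>)) \<le> 4 * ?E * ?R (t - \<tau>)"
        using assms in4 True \<delta> by (intro J_time_near) (auto simp: \<delta>_def)
      moreover have "norm (J x t' \<tau> - g (x, t) * ?m (t' - \<tau>)) \<le> 4 * ?E * ?R (t' - \<tau>)"
        using assms in4 True \<delta> by (intro J_time_near) (auto simp: \<delta>_def)
      ultimately show ?thesis unfolding F distrib_left real_norm_def by linarith
    next
      case False
      let ?r = "t' - \<tau>"
      have r: "?r > 0" "\<delta> \<le> ?r" "0 < t - \<tau>" "t - \<tau> \<le> 2 * ?r" using False \<delta> by (auto simp: \<delta>_def)
      \<comment> \<open>\<open>J_time_diff\<close> freezes the source at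
        \<open>g (x, \<tau>)\<close>. Passing to \<open>g (x, t)\<close> costs the time increment of
        \<open>g\<close> times the increment of the mass, again of order
        \<open>\<delta> * ?r powr (s - 2 + \<alpha>/2)\<close> because
        \<open>t - \<tau> \<le> 2 * ?r\<close>.\<close>
      have "?F \<tau> = (J x t \<tau> - g (x, \<tau>) * ?m (t - \<tau>) - (J x t' \<tau> - g (x, \<tau>) * ?m (t' - \<tau>)))
          - (g (x, t) - g (x, \<tau>)) * (?m (t - \<tau>) - ?m ?r)"
        unfolding F by (simp add: algebra_simps)
      then have "norm (?F \<tau>) \<le> norm (J x t \<tau> - g (x, \<tau>) * ?m (t - \<tau>) - (J x t' \<tau> - g (x, \<tau>) * ?m (t' - \<tau>)))
          + norm ((g (x, t) - g (x, \<tau>)) * (?m (t - \<tau>) - ?m ?r))"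
        using norm_triangle_ineq4 by simp
      also have "\<dots> \<le> ?E * (\<delta> * ?r powr (s - 2 + \<alpha>/2)) + (N * \<bar>t - \<tau>\<bar> powr (\<alpha>/2)) * (est_const TYPE('a) * (\<delta> * ?r powr (s - 2)))"
      proof (intro add_mono)
        show "norm (J x t \<tau> - g (x, \<tau>) * ?m (t - \<tau>) - (J x t' \<tau> - g (x, \<tau>) * ?m (t' - \<tau>))) \<le> ?E * (\<delta> * ?r powr (s - 2 + \<alpha>/2))"
          unfolding \<delta>_def by (intro J_time_diff) (use r(1,2) assms in \<open>auto simp: \<delta>_def\<close>)
        show "norm ((g (x, t) - g (x, \<tau>)) * (?m (t - \<tau>) - ?m ?r)) \<le> (N * \<bar>t - \<tau>\<bar> powr (\<alpha>/2)) * (est_const TYPE('a) * (\<delta> * ?r powr (s - 2)))"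
          unfolding norm_mult
        proof (intro mult_mono)
          show "norm (g (x, t) - g (x, \<tau>)) \<le> N * \<bar>t - \<tau>\<bar> powr (\<alpha>/2)"
            unfolding real_norm_def by (intro g_time) (use assms in4 in auto)
          have "t - \<tau> - ?r = \<delta>" by (simp add: \<delta>_def)
          with hk_mass_diff[of ?r "t - \<tau>" s, where 'a='a]
          show "norm (?m (t - \<tau>) - ?m ?r) \<le> est_const TYPE('a) * (\<delta> * ?r powr (s - 2))"
            using s r(1) assms(2) by simp
        qed auto
      qed
      also have "\<dots> = ?E * (\<delta> * ?r powr (s - 2 + \<alpha>/2) + \<delta> * (\<bar>t - \<tau>\<bar> powr (\<alpha>/2) * ?r powr (s - 2)))"
        by (simp add: algebra_simps)
      also have "\<dots> \<le> ?E * (4 * (\<delta> * ?r powr (s - 2 + \<alpha>/2)))"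
      proof (intro mult_left_mono)
        have "\<bar>t - \<tau>\<bar> powr (\<alpha>/2) \<le> 2 * ?r powr (\<alpha>/2)"
          using powr_le_scaled[of "t - \<tau>" 2 ?r "\<alpha>/2" 0] r \<delta> \<alpha> by auto
        then have "\<bar>t - \<tau>\<bar> powr (\<alpha>/2) * ?r powr (s - 2) \<le> (2 * ?r powr (\<alpha>/2)) * ?r powr (s - 2)"
          by (intro mult_right_mono) auto
        also have "\<dots> = 2 * ?r powr (s - 2 + \<alpha>/2)" by (simp add: powr_add)
        finally have "\<delta> * (\<bar>t - \<tau>\<bar> powr (\<alpha>/2) * ?r powr (s - 2)) \<le> \<delta> * (2 * ?r powr (s - 2 + \<alpha>/2))"
          using \<delta> by (intro mult_left_mono) auto
        moreover have "0 \<le> \<delta> * ?r powr (s - 2 + \<alpha>/2)" using \<delta> by simp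
        ultimately show "\<delta> * ?r powr (s - 2 + \<alpha>/2) + \<delta> * (\<bar>t - \<tau>\<bar> powr (\<alpha>/2) * ?r powr (s - 2)) \<le> 4 * (\<delta> * ?r powr (s - 2 + \<alpha>/2))"
          by linarith
      qed simp
      also have "\<dots> \<le> ?E * (4 * (?R (t - \<tau>) + ?R ?r))"
      proof (intro mult_left_mono)
        show "\<delta> * ?r powr (s - 2 + \<alpha>/2) \<le> ?R (t - \<tau>) + ?R ?r"
          using radial_far[of \<delta> ?r 1 "s + \<alpha>/2" "\<alpha>/2"] r \<delta> in4 assms 
          by (intro add_increasing) (auto simp: algebra_simps)
      qed auto
      also have "\<dots> = 4 * ?E * (?R (t - \<tau>) + ?R ?r)" by (simp only: mult_ac)
      finally show ?thesis .
    qed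
  qed
  have iH: "integrable lborel ?H" using s assms by (intro Bochner_Integration.integrable_diff hk_mass_integral) auto
  have eq: "(\<integral>\<tau>. J x t \<tau> - J x t' \<tau> - c * H \<tau> \<partial>lborel)
      = (\<integral>\<tau>. J x t \<tau> \<partial>lborel) - (\<integral>\<tau>. J x t' \<tau> \<partial>lborel) - c * (\<integral>\<tau>. H \<tau> \<partial>lborel)"
    if "integrable lborel H" for H and c :: real
    using that assms by (simp add: J_integrable)
  have "(\<integral>\<tau>. ?F \<tau> \<partial>lborel) = w x t - w x t' - g (x, t) * (\<integral>\<tau>. ?H \<tau> \<partial>lborel)"
    unfolding w_def by (rule eq[OF iH])
  moreover have "norm (\<integral>\<tau>. ?F \<tau> \<partial>lborel) \<le> 2 * (4 * ?E) * (\<integral>r. ?R r \<partial>lborel)"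
    by (intro time_integral_bound[where R="?R" and t=t and t'=t'] bd radial_integrable)
       (use s \<delta> N_nonneg in auto)
  moreover have "\<bar>g (x, t) * (\<integral>\<tau>. ?H \<tau> \<partial>lborel)\<bar> \<le> ?E * (t - t')"
  proof -
    have "(\<integral>\<tau>. ?H \<tau> \<partial>lborel) = gauss_mass TYPE('a) 4 * ((t + 4) powr s / s - (t' + 4) powr s / s)"
      using s assms by (subst Bochner_Integration.integral_diff) 
        (auto simp: hk_mass_integral right_diff_distrib)
    also have "\<bar>\<dots>\<bar> \<le> est_const TYPE('a) * (t - t')"
    proof -
      have "(t' + 4) powr s \<le> (t + 4) powr s" using s assms by (intro powr_mono2) auto
      then have "0 \<le> (t + 4) powr s / s - (t' + 4) powr s / s" using s by (simp add: divide_right_mono)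
      moreover have "(t + 4) powr s / s - (t' + 4) powr s / s \<le> t - t'"
        using powr_diff_le[of "t' + 4" "t + 4" s] s assms by simp
      ultimately show ?thesis unfolding abs_mult using gauss_mass_le_est_const[where 'a='a]
        by (intro mult_mono) auto
    qed
    finally have "\<bar>g (x, t)\<bar> * \<bar>\<integral>\<tau>. ?H \<tau> \<partial>lborel\<bar> \<le> N * (est_const TYPE('a) * (t - t'))"
      using g_bound N_nonneg by (intro mult_mono) auto
    then show ?thesis by (simp add: abs_mult mult_ac)
  qed
  ultimately show ?thesis unfolding \<delta>_def[symmetric] real_norm_def by linarith
qed

end

section \<open>Moduli of continuity\<close>

text \<open>The 7 is an upper bound for \<open>ln 8\<close>, from the borderline case \<open>p = m\<close>.\<close>

definition radial_const :: "real \<Rightarrow> real \<Rightarrow> real \<Rightarrow> real" where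
  "radial_const a m p = 2 powr (p - a) / (p - a) + (if p < m then 1 / (m - p) else 7)"

lemma radial_const_nonneg: "a < p \<Longrightarrow> 0 \<le> radial_const a m p"
  by (simp add: radial_const_def)

lemma radial_const_less:
  "a < p \<Longrightarrow> p < m \<Longrightarrow> \<rho> > 0 \<Longrightarrow> (\<integral>r. radial a m p \<rho> r \<partial>lborel) \<le> radial_const a m p * \<rho> powr p"
  using radial_integral_less[of a p m \<rho>] by (simp add: radial_const_def)

abbreviation log_modulus :: "real \<Rightarrow> real" where
  "log_modulus d \<equiv> d * \<bar>ln (min d (1/2))\<bar>"

text \<open>Both cases rest on 1 \<le> 2 ln 2. Below 1/2 the 1 is absorbed by 2 |ln d|; between 1/2
  and 2, where |ln d| \<le> ln 2, the right-hand side is 4 ln 2. Distances in the unit cylinder in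
  one variable never exceed 2.\<close>

lemma one_add_ln_le:
  fixes d :: real
  assumes "0 < d" "d \<le> 2"
  shows "1 + 2 * \<bar>ln d\<bar> \<le> 4 * \<bar>ln (min d (1/2))\<bar>"
proof -
  have l: "1 \<le> 2 * ln (2::real)"
    using ln_le_minus_one[of "1/2"] by (simp add: ln_div)
  show ?thesis
  proof (cases "d \<le> 1/2")
    case True
    have "ln d \<le> ln (1/2)" using True assms by (subst ln_le_cancel_iff) auto
    then have "ln d \<le> - ln 2" by (simp add: ln_div)
    then show ?thesis using True l by (simp add: min_def)
  next
    case False
    have "ln (1/2) \<le> ln d" "ln d \<le> ln 2" using False assms by (auto simp: ln_le_cancel_iff)
    then have "\<bar>ln d\<bar> \<le> ln 2" by (simp add: ln_div)
    then show ?thesis using False l by (simp add: min_def ln_div)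
  qed
qed

lemma radial_const_log:
  assumes "a < p" "0 < \<rho>" "\<rho> \<le> 8"
  shows "(\<integral>r. radial a p p \<rho> r \<partial>lborel) \<le> radial_const a p p * (\<rho> powr p * (1 + \<bar>ln \<rho>\<bar>))"
  using radial_integral_log[OF assms] by (simp add: radial_const_def)

lemma radial_const_log_modulus:
  assumes "a < 1" "0 < d" "d \<le> 2"
  shows "(\<integral>r. radial a 1 1 d r \<partial>lborel) \<le> 4 * radial_const a 1 1 * log_modulus d"
proof -
  have "d * (1 + \<bar>ln d\<bar>) \<le> d * (4 * \<bar>ln (min d (1/2))\<bar>)"
    using one_add_ln_le[of d] assms by (intro mult_left_mono) auto
  then have "radial_const a 1 1 * (d * (1 + \<bar>ln d\<bar>)) \<le> radial_const a 1 1 * (d * (4 * \<bar>ln (min d (1/2))\<bar>))"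
    by (rule mult_left_mono) (use assms in \<open>auto intro: radial_const_nonneg\<close>)
  moreover have "(\<integral>r. radial a 1 1 d r \<partial>lborel) \<le> radial_const a 1 1 * (d * (1 + \<bar>ln d\<bar>))"
    using radial_const_log[of a 1 d] assms by simp
  moreover have "4 * radial_const a 1 1 * log_modulus d = radial_const a 1 1 * (d * (4 * \<bar>ln (min d (1/2))\<bar>))"
    by (simp only: mult_ac)
  ultimately show ?thesis by linarith
qed

text \<open>With \<open>\<rho> = d^2\<close>, the power \<open>\<rho> powr (1/2)\<close> is
  \<open>d\<close> and \<open>ln \<rho>\<close> is \<open>2 * ln d\<close>; this is the factor 2 in
  \<open>one_add_ln_le\<close>.\<close>

lemma radial_const_sqrt_log_modulus:
  assumes "a < 1/2" "0 < d" "d \<le> 2"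
  shows "(\<integral>r. radial a (1/2) (1/2) (d\<^sup>2) r \<partial>lborel) \<le> 4 * radial_const a (1/2) (1/2) * log_modulus d"
proof -
  have "d\<^sup>2 \<le> 2\<^sup>2" using assms by (intro power_mono) auto
  then have 1: "(\<integral>r. radial a (1/2) (1/2) (d\<^sup>2) r \<partial>lborel) \<le> radial_const a (1/2) (1/2) * (d * (1 + 2 * \<bar>ln d\<bar>))"
    using radial_const_log[of a "1/2" "d\<^sup>2"] assms by (simp add: power2_powr ln_realpow abs_mult)
  have "d * (1 + 2 * \<bar>ln d\<bar>) \<le> d * (4 * \<bar>ln (min d (1/2))\<bar>)"
    using one_add_ln_le[of d] assms by (intro mult_left_mono) auto
  then have "radial_const a (1/2) (1/2) * (d * (1 + 2 * \<bar>ln d\<bar>)) \<le> radial_const a (1/2) (1/2) * (d * (4 * \<bar>ln (min d (1/2))\<bar>))"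
    by (rule mult_left_mono) (use assms in \<open>auto intro: radial_const_nonneg\<close>)
  moreover have "4 * radial_const a (1/2) (1/2) * log_modulus d = radial_const a (1/2) (1/2) * (d * (4 * \<bar>ln (min d (1/2))\<bar>))"
    by (simp only: mult_ac)
  ultimately show ?thesis using 1 by linarith
qed

section \<open>Seminorms as best constants\<close>

lemma sup_norm_bound:
  assumes "\<Omega> \<noteq> {}" "\<And>p. p \<in> \<Omega> \<Longrightarrow> norm (u p) \<le> K"
  shows "bounded (u ` \<Omega>)" "sup_norm \<Omega> u \<le> K"
  using assms by (auto simp: sup_norm_def bounded_iff intro: cSUP_least)

lemma hoelder_seminorm_bound:
  assumes "0 \<le> K" "\<And>p q. (p, q) \<in> S \<Longrightarrow> norm (u p - u q) \<le> K * d p q powr a"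
  shows "hoelder_consts S d a u \<noteq> {}" "hoelder_seminorm S d a u \<le> K"
proof -
  have K: "K \<in> hoelder_consts S d a u" using assms by (auto simp: hoelder_consts_def)
  then show "hoelder_consts S d a u \<noteq> {}" by auto
  have "bdd_below (hoelder_consts S d a u)" by (rule bdd_belowI[of _ 0]) (auto simp: hoelder_consts_def)
  then show "hoelder_seminorm S d a u \<le> K" unfolding hoelder_seminorm_def by (rule cInf_lower[OF K])
qed

text \<open>The infimum is itself an admissible constant. In this form the norm of the source is
  turned back into pointwise increments.\<close>

lemma hoelder_seminorm_attained:
  assumes "hoelder_consts S d a u \<noteq> {}"
  shows "0 \<le> hoelder_seminorm S d a u"
    and "(p, q) \<in> S \<Longrightarrow> norm (u p - u q) \<le> hoelder_seminorm S d a u * d p q powr a"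
proof -
  show "0 \<le> hoelder_seminorm S d a u"
    unfolding hoelder_seminorm_def using assms by (intro cInf_greatest) (auto simp: hoelder_consts_def)
  show "norm (u p - u q) \<le> hoelder_seminorm S d a u * d p q powr a" if pq: "(p, q) \<in> S"
  proof (cases "d p q powr a = 0")
    \<comment> \<open>Any admissible constant already forces \<open>u p = u q\<close>.\<close>
    case True
    then show ?thesis using assms pq by (fastforce simp: hoelder_consts_def)
  next
    case False
    then have D: "d p q powr a > 0" by simp
    have "norm (u p - u q) / d p q powr a \<le> hoelder_seminorm S d a u"
      unfolding hoelder_seminorm_def
      by (intro cInf_greatest[OF assms]) (use pq D in \<open>auto simp: hoelder_consts_def pos_divide_le_eq\<close>)
    then show ?thesis using D by (simp add: pos_divide_le_eq)
  qed
qed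

text \<open>The pair \<open>p0\<close>, \<open>q0\<close> makes the set of quotients nonempty,
  without which a real supremum carries no information. The minimum with 1/2 keeps every denominator
  positive.\<close>

lemma loglip_seminorm_bound:
  assumes "(p0, q0) \<in> S" "p0 \<noteq> q0"
    and "\<And>p q. (p, q) \<in> S \<Longrightarrow> p \<noteq> q \<Longrightarrow> norm (u p - u q) \<le> K * log_modulus (dist p q)"
  shows "bdd_above (loglip_quotients S u)" "loglip_seminorm S u \<le> K"
proof -
  have le: "x \<le> K" if x_in: "x \<in> loglip_quotients S u" for x
  proof -
    obtain p q where x: "x = norm (u p - u q) / log_modulus (dist p q)" and pq: "(p, q) \<in> S" "p \<noteq> q"
      using x_in unfolding loglip_quotients_def by blast
    have "ln (min (dist p q) (1/2)) < 0" using pq by (intro ln_less_zero) auto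
    then have "0 < log_modulus (dist p q)" using pq by (intro mult_pos_pos) auto
    then show ?thesis unfolding x using assms(3)[OF pq] by (simp add: pos_divide_le_eq)
  qed
  have "loglip_quotients S u \<noteq> {}" using assms(1,2) unfolding loglip_quotients_def by blast
  then show "loglip_seminorm S u \<le> K" unfolding loglip_seminorm_def using le by (rule cSup_least)
  show "bdd_above (loglip_quotients S u)" using le by (rule bdd_aboveI)
qed

section \<open>Gradients from Taylor remainders\<close>

lemma GDERIV_unique:
  assumes "GDERIV f x :> D" "GDERIV f x :> D'"
  shows "D = D'"
proof -
  have "(\<lambda>h. h \<bullet> D) = (\<lambda>h. h \<bullet> D')"
    using assms unfolding gderiv_def by (rule has_derivative_unique)
  then have "(D - D') \<bullet> (D - D') = 0" by (metis inner_diff_right right_minus_eq)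
  then show ?thesis by simp
qed

lemma grad_x_eq: "GDERIV (\<lambda>y. u (y, t)) x :> D \<Longrightarrow> grad_x u (x, t) = D"
  unfolding grad_x_def prod.case by (rule the_equality) (auto intro: GDERIV_unique)

lemma GDERIV_from_taylor_bound:
  fixes f :: "'a::real_inner \<Rightarrow> real"
  assumes "\<delta> > 0" "q > 1" "K \<ge> 0"
    and le: "\<And>y. norm (y - x) < \<delta> \<Longrightarrow> norm (f y - f x - D \<bullet> (y - x)) \<le> K * norm (y - x) powr q"
  shows "GDERIV f x :> D"
  unfolding gderiv_def has_derivative_at_alt
proof (intro conjI allI impI)
  show "bounded_linear (\<lambda>h. h \<bullet> D)" by (rule bounded_linear_inner_left)
  fix e :: real assume e: "e > 0"
  \<comment> \<open>Solves (K + 1) \<epsilon>^(q-1) = e; adding 1 keeps the divisor positive when K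
    = 0.\<close>
  define \<epsilon> where "\<epsilon> = (e / (K + 1)) powr (1 / (q - 1))"
  have \<epsilon>: "\<epsilon> > 0" "\<epsilon> powr (q - 1) = e / (K + 1)" using e assms by (auto simp: \<epsilon>_def powr_powr)
  have "norm (f y - f x - (y - x) \<bullet> D) \<le> e * norm (y - x)" if y: "norm (y - x) < min \<delta> \<epsilon>" for y
  proof (cases "y = x")
    case False
    have "norm (f y - f x - (y - x) \<bullet> D) \<le> K * norm (y - x) powr (1 + (q - 1))"
      using le[of y] y by (simp add: inner_commute)
    also have "\<dots> = K * norm (y - x) powr (q - 1) * norm (y - x)"
      unfolding powr_add using False by simp
    also have "\<dots> \<le> (K + 1) * \<epsilon> powr (q - 1) * norm (y - x)"
      using y assms by (intro mult_right_mono mult_mono powr_mono2) auto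
    also have "\<dots> = e * norm (y - x)" using \<epsilon> assms by simp
    finally show ?thesis .
  qed simp
  then show "\<exists>d>0. \<forall>y. norm (y - x) < d \<longrightarrow> norm (f y - f x - (y - x) \<bullet> D) \<le> e * norm (y - x)"
    using assms(1) \<epsilon>(1) by (intro exI[of _ "min \<delta> \<epsilon>"]) auto
qed

section \<open>Moduli of continuity of the potential and of its gradient\<close>

context source_term begin

lemma w_space_hoelder:
  assumes "norm x < 1" "norm x' < 1" "t \<le> 4" "2 * s + \<alpha> < 1"
  shows "norm (w x' t - w x t) \<le> 6 * radial_const (\<alpha>/2) (1/2) (s + \<alpha>/2) * (est_const TYPE('a) * N) * norm (x' - x) powr (2 * s + \<alpha>)"
proof (cases "x = x'")
  case False
  let ?I = "\<integral>r. radial (\<alpha>/2) (1/2) (s + \<alpha>/2) ((norm (x' - x))\<^sup>2) r \<partial>lborel"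
  have "norm (w x' t - w x t) \<le> 6 * (est_const TYPE('a) * N) * ?I"
    by (rule w_space_diff) (use assms False in auto)
  also have "\<dots> \<le> 6 * (est_const TYPE('a) * N) * (radial_const (\<alpha>/2) (1/2) (s + \<alpha>/2) * ((norm (x' - x))\<^sup>2) powr (s + \<alpha>/2))"
    using s assms False by (intro mult_left_mono radial_const_less) auto
  finally show ?thesis by (simp add: power2_powr algebra_simps)
qed simp

lemma w_space_loglip:
  assumes "norm x < 1" "norm x' < 1" "x \<noteq> x'" "t \<le> 4" "2 * s + \<alpha> = 1"
  shows "norm (w x' t - w x t) \<le> 24 * radial_const (\<alpha>/2) (1/2) (1/2) * (est_const TYPE('a) * N) * log_modulus (norm (x' - x))"
proof -
  let ?I = "\<integral>r. radial (\<alpha>/2) (1/2) (1/2) ((norm (x' - x))\<^sup>2) r \<partial>lborel"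
  have p: "s + \<alpha>/2 = 1/2" using assms by simp
  have "norm (w x' t - w x t) \<le> 6 * (est_const TYPE('a) * N) * ?I"
    using w_space_diff[of x x' t] assms p by simp
  also have "\<dots> \<le> 6 * (est_const TYPE('a) * N) * (4 * radial_const (\<alpha>/2) (1/2) (1/2) * log_modulus (norm (x' - x)))"
    using s assms norm_triangle_ineq4[of x' x] \<alpha> by (intro mult_left_mono radial_const_sqrt_log_modulus) auto
  finally show ?thesis by (simp add: algebra_simps)
qed

lemma Dw_space_hoelder:
  assumes "norm x < 1" "norm x' < 1" "t \<le> 4" "1 < 2 * s + \<alpha>" "2 * s + \<alpha> < 2"
  shows "norm (Dw x' t - Dw x t) \<le> 4 * radial_const 0 (1/2) (s + \<alpha>/2 - 1/2) * (est_const TYPE('a) * N) * norm (x' - x) powr (2 * s + \<alpha> - 1)"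
proof (cases "x = x'")
  case False
  let ?I = "\<integral>r. radial 0 (1/2) (s + \<alpha>/2 - 1/2) ((norm (x' - x))\<^sup>2) r \<partial>lborel"
  have "norm (Dw x' t - Dw x t) \<le> 4 * (est_const TYPE('a) * N) * ?I"
    by (rule Dw_space_diff) (use assms False in auto)
  also have "\<dots> \<le> 4 * (est_const TYPE('a) * N) * (radial_const 0 (1/2) (s + \<alpha>/2 - 1/2) * ((norm (x' - x))\<^sup>2) powr (s + \<alpha>/2 - 1/2))"
    using s assms False by (intro mult_left_mono radial_const_less) auto
  finally show ?thesis by (simp add: power2_powr algebra_simps)
qed simp

lemma Dw_space_loglip:
  assumes "norm x < 1" "norm x' < 1" "x \<noteq> x'" "t \<le> 4" "2 * s + \<alpha> = 2"
  shows "norm (Dw x' t - Dw x t) \<le> 16 * radial_const 0 (1/2) (1/2) * (est_const TYPE('a) * N) * log_modulus (norm (x' - x))"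
proof -
  let ?I = "\<integral>r. radial 0 (1/2) (1/2) ((norm (x' - x))\<^sup>2) r \<partial>lborel"
  have p: "s + \<alpha>/2 = 1" using assms by simp
  have "norm (Dw x' t - Dw x t) \<le> 4 * (est_const TYPE('a) * N) * ?I"
    using Dw_space_diff[of x x' t] assms p by simp
  also have "\<dots> \<le> 4 * (est_const TYPE('a) * N) * (4 * radial_const 0 (1/2) (1/2) * log_modulus (norm (x' - x)))"
    using s assms norm_triangle_ineq4[of x' x] by (intro mult_left_mono radial_const_sqrt_log_modulus) auto
  finally show ?thesis by (simp add: algebra_simps)
qed

lemma Dw_time_hoelder:
  assumes "norm x < 1" "t \<le> 4" "t' \<le> 4" "1 < 2 * s + \<alpha>"
  shows "norm (Dw x t - Dw x t') \<le> 2 * radial_const 0 1 (s + \<alpha>/2 - 1/2) * (est_const TYPE('a) * N) * \<bar>t - t'\<bar> powr (s + \<alpha>/2 - 1/2)"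
  using assms
proof (induction t t' rule: linorder_wlog)
  case (le t t')
  show ?case
  proof (cases "t = t'")
    case False
    let ?I = "\<integral>r. radial 0 1 (s + \<alpha>/2 - 1/2) (t' - t) r \<partial>lborel"
    have "norm (Dw x t' - Dw x t) \<le> 2 * (est_const TYPE('a) * N) * ?I"
      by (rule Dw_time_diff) (use le False in auto)
    also have "\<dots> \<le> 2 * (est_const TYPE('a) * N) * (radial_const 0 1 (s + \<alpha>/2 - 1/2) * (t' - t) powr (s + \<alpha>/2 - 1/2))"
      using s \<alpha> le False by (intro mult_left_mono radial_const_less) auto
    finally show ?thesis using le by (simp add: norm_minus_commute algebra_simps)
  qed simp
next
  case (sym t t')
  then show ?case by (simp add: norm_minus_commute abs_minus_commute)
qed

lemma w_time_hoelder:
  assumes "norm x < 1" "\<bar>t\<bar> < 1" "\<bar>t'\<bar> < 1" "2 * s + \<alpha> < 2"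
  shows "norm (w x t - w x t') \<le> (8 * radial_const (\<alpha>/2) 1 (s + \<alpha>/2) + 2) * (est_const TYPE('a) * N) * \<bar>t - t'\<bar> powr (s + \<alpha>/2)"
  using assms
proof (induction t t' rule: linorder_wlog)
  case (le t t')
  show ?case
  proof (cases "t = t'")
    case False
    let ?I = "\<integral>r. radial (\<alpha>/2) 1 (s + \<alpha>/2) (t' - t) r \<partial>lborel"
    have d: "0 < t' - t" "t' - t \<le> 2" using le False by auto
    have "norm (w x t' - w x t) \<le> 8 * (est_const TYPE('a) * N) * ?I + (est_const TYPE('a) * N) * (t' - t)"
      by (rule w_time_diff) (use le False in auto)
    also have "\<dots> \<le> 8 * (est_const TYPE('a) * N) * (radial_const (\<alpha>/2) 1 (s + \<alpha>/2) * (t' - t) powr (s + \<alpha>/2)) + (est_const TYPE('a) * N) * (2 * (t' - t) powr (s + \<alpha>/2))"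
    proof (intro add_mono mult_left_mono radial_const_less)
      \<comment> \<open>The Lipschitz term of \<open>w_time_diff\<close> is absorbed: the time step
        is at most 2 and the Hoelder exponent at most 1. This accounts for the \<open>+ 2\<close> in
        the constant.\<close>
      have "(t' - t) powr (s + \<alpha>/2 + (1 - (s + \<alpha>/2))) \<le> 2 * (1 powr (1 - (s + \<alpha>/2)) * (t' - t) powr (s + \<alpha>/2))"
        using d s \<alpha> le by (intro powr_le_scaled) auto
      then show "t' - t \<le> 2 * (t' - t) powr (s + \<alpha>/2)" using d by simp
    qed (use s \<alpha> le d in auto)
    finally show ?thesis using le by (simp add: norm_minus_commute algebra_simps)
  qed simp
next
  case (sym t t')
  then show ?case by (simp add: norm_minus_commute abs_minus_commute)
qed

lemma w_time_loglip:
  assumes "norm x < 1" "\<bar>t\<bar> < 1" "\<bar>t'\<bar> < 1" "t \<noteq> t'" "2 * s + \<alpha> = 2"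
  shows "norm (w x t - w x t') \<le> (32 * radial_const (\<alpha>/2) 1 1 + 4) * (est_const TYPE('a) * N) * log_modulus \<bar>t - t'\<bar>"
  using assms
proof (induction t t' rule: linorder_wlog)
  case (le t t')
  let ?I = "\<integral>r. radial (\<alpha>/2) 1 1 (t' - t) r \<partial>lborel"
  have p: "s + \<alpha>/2 = 1" using assms by simp
  have d: "0 < t' - t" "t' - t \<le> 2" using le by auto
  have "norm (w x t' - w x t) \<le> 8 * (est_const TYPE('a) * N) * ?I + (est_const TYPE('a) * N) * (t' - t)"
    using w_time_diff[of x t t'] le p by simp
  also have "\<dots> \<le> 8 * (est_const TYPE('a) * N) * (4 * radial_const (\<alpha>/2) 1 1 * log_modulus (t' - t)) + (est_const TYPE('a) * N) * (4 * log_modulus (t' - t))"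
  proof (intro add_mono mult_left_mono radial_const_log_modulus)
    \<comment> \<open>The logarithmic modulus dominates the Lipschitz term as well, at the cost of
      the \<open>+ 4\<close> in the constant.\<close>
    have "1 \<le> 4 * \<bar>ln (min (t' - t) (1/2))\<bar>" using one_add_ln_le[OF d] by linarith
    from mult_left_mono[OF this, of "t' - t"] d
    show "t' - t \<le> 4 * log_modulus (t' - t)" by simp
  qed (use \<alpha> d in auto)
  finally have "norm (w x t' - w x t) \<le> (32 * radial_const (\<alpha>/2) 1 1 + 4) * (est_const TYPE('a) * N) * log_modulus (t' - t)"
    by (simp add: algebra_simps)
  then show ?case using le by (simp add: norm_minus_commute)
next
  case (sym t t')
  then show ?case by (simp add: norm_minus_commute abs_minus_commute)
qed

lemma w_GDERIV:
  assumes x: "norm x < 1" and t: "t \<le> 4" and e: "1 < 2 * s + \<alpha>" "2 * s + \<alpha> \<le> 2"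
  shows "GDERIV (\<lambda>y. w y t) x :> Dw x t"
proof -
  let ?C = "radial_const (1/2) 1 (s + \<alpha>/2)"
  have C: "0 \<le> ?C" using e by (intro radial_const_nonneg) auto
  \<comment> \<open>for \<open>2 * s + \<alpha> = 2\<close> any exponent strictly between 1 and 2 absorbs the logarithm\<close>
  define q where "q = (if 2 * s + \<alpha> < 2 then 2 * s + \<alpha> else 3/2)"
  have I: "(\<integral>r. radial (1/2) 1 (s + \<alpha>/2) (d\<^sup>2) r \<partial>lborel) \<le> ?C * (5 * d powr q)" if d: "0 < d" "d \<le> 1" for d
  proof (cases "2 * s + \<alpha> < 2")
    case True
    have "(\<integral>r. radial (1/2) 1 (s + \<alpha>/2) (d\<^sup>2) r \<partial>lborel) \<le> ?C * (d\<^sup>2) powr (s + \<alpha>/2)"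
      using d e True by (intro radial_const_less) auto
    also have "(d\<^sup>2) powr (s + \<alpha>/2) \<le> 5 * d powr q"
      using d True by (simp add: power2_powr q_def algebra_simps)
    finally show ?thesis using C by (simp add: mult_left_mono)
  next
    case False
    then have p: "s + \<alpha>/2 = 1" using e by simp
    have "d\<^sup>2 \<le> 1\<^sup>2" using d by (intro power_mono) auto
    then have "(\<integral>r. radial (1/2) 1 1 (d\<^sup>2) r \<partial>lborel) \<le> radial_const (1/2) 1 1 * ((d\<^sup>2) powr 1 * (1 + \<bar>ln (d\<^sup>2)\<bar>))"
      using d by (intro radial_const_log) auto
    also have "(d\<^sup>2) powr 1 * (1 + \<bar>ln (d\<^sup>2)\<bar>) \<le> 5 * d powr q"
    proof -
      \<comment> \<open>The inequality ln z \<le> z - 1 at z = d^(-1/2): the logarithm costs half a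
        power and leaves the exponent 3/2. The factor 5 is 1 + 4.\<close>
      have "ln (d powr (-1/2)) \<le> d powr (-1/2) - 1" using d by (intro ln_le_minus_one) simp
      then have "- ln d \<le> 2 * d powr (-1/2)" using d by (simp add: ln_powr)
      moreover have "ln d \<le> 0" using d by simp
      ultimately have "\<bar>ln (d\<^sup>2)\<bar> \<le> 4 * d powr (-1/2)" using d by (simp add: ln_realpow)
      moreover have "1 \<le> d powr (-1/2)" using d powr_mono'[of "-1/2" 0 d] by simp
      ultimately have "1 + \<bar>ln (d\<^sup>2)\<bar> \<le> 5 * d powr (-1/2)" by linarith
      then have "d powr 2 * (1 + \<bar>ln (d\<^sup>2)\<bar>) \<le> d powr 2 * (5 * d powr (-1/2))" by (intro mult_left_mono) auto
      also have "\<dots> = 5 * d powr (2 + (-1/2))" unfolding powr_add by simp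
      finally show ?thesis using d False by (simp add: q_def)
    qed
    finally show ?thesis using C p by (simp add: mult_left_mono)
  qed
  show ?thesis
  proof (rule GDERIV_from_taylor_bound[where \<delta>="1 - norm x" and q=q and K="8 * (est_const TYPE('a) * N) * (?C * 5)"])
    fix y assume y: "norm (y - x) < 1 - norm x"
    \<comment> \<open>The radius \<open>1 - norm x\<close> keeps \<open>y\<close> in the unit ball,
      where \<open>w_taylor\<close> applies, and bounds the distance by 1, as \<open>I\<close>
      requires.\<close>
    have y1: "norm y < 1" using y norm_triangle_sub[of y x] by linarith
    show "norm (w y t - w x t - Dw x t \<bullet> (y - x)) \<le> 8 * (est_const TYPE('a) * N) * (?C * 5) * norm (y - x) powr q"
    proof (cases "x = y")
      case False
      have "norm (w y t - w x t - Dw x t \<bullet> (y - x)) \<le> 8 * (est_const TYPE('a) * N) * (\<integral>r. radial (1/2) 1 (s + \<alpha>/2) ((norm (y - x))\<^sup>2) r \<partial>lborel)"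
        using w_taylor[OF x y1 False t e(1)] .
      also have "\<dots> \<le> 8 * (est_const TYPE('a) * N) * (?C * (5 * norm (y - x) powr q))"
        using False y norm_ge_zero[of x] by (intro mult_left_mono I) (auto simp del: norm_ge_zero)
      finally show ?thesis by (simp add: mult_ac)
    qed simp
  qed (use x e C in \<open>auto simp: q_def\<close>)
qed

end

section \<open>Norms on the unit cylinder\<close>

lemma mem_unit_cylinder: "(x, t) \<in> par_cylinder 1 0 0 \<longleftrightarrow> norm x < 1 \<and> \<bar>t\<bar> < 1"
  by (simp add: par_cylinder_def)

text \<open>Witnesses of distinct points on a common time slice and on a common vertical line, as
  demanded by \<open>loglip_seminorm_bound\<close>.\<close>

lemma unit_cylinder_pairs:
  fixes b :: "'a::euclidean_space"
  assumes "b \<in> Basis"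
  shows "((0, 0), ((1/2) *\<^sub>R b, 0)) \<in> space_pairs (par_cylinder 1 0 0)" "(0, 0) \<noteq> ((1/2) *\<^sub>R b, 0::real)"
    and "((0 :: 'a, 0), (0, 1/2)) \<in> time_pairs (par_cylinder 1 0 0)" "(0::'a, 0) \<noteq> (0, 1/2::real)"
  using assms by (auto simp: space_pairs_def time_pairs_def mem_unit_cylinder)

context source_term begin

text \<open>The potential of the scaled kernel \<open>c * hk\<close>; the normalizing constant of G
  is inserted for \<open>c\<close> at the end.\<close>

definition u :: "real \<Rightarrow> 'a \<times> real \<Rightarrow> real" where "u c = (\<lambda>(x, t). c * w x t)"

lemma u_bounds:
  assumes c: "0 \<le> c" and \<Omega>: "\<Omega> = par_cylinder 1 0 0"
  shows "bounded (u c ` \<Omega>)"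
    and "sup_norm \<Omega> (u c) \<le> c * (2 * (est_const TYPE('a) * N) * (\<integral>r. radial 0 2 s 4 r \<partial>lborel))"
proof -
  have ne: "\<Omega> \<noteq> {}" using mem_unit_cylinder[of 0 0] unfolding \<Omega> by auto
  have le: "norm (u c p) \<le> c * (2 * (est_const TYPE('a) * N) * (\<integral>r. radial 0 2 s 4 r \<partial>lborel))" if "p \<in> \<Omega>" for p
    using w_bound[of "snd p" "fst p"] that c 
    by (cases p) (auto simp: u_def \<Omega> mem_unit_cylinder abs_mult intro!: mult_left_mono)
  show "bounded (u c ` \<Omega>)"
    by (rule sup_norm_bound(1)[OF ne]) (rule le)
  show "sup_norm \<Omega> (u c) \<le> c * (2 * (est_const TYPE('a) * N) * (\<integral>r. radial 0 2 s 4 r \<partial>lborel))"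
    by (rule sup_norm_bound(2)[OF ne]) (rule le)
qed

lemma u_time_hoelder:
  assumes c: "0 \<le> c" and \<Omega>: "\<Omega> = par_cylinder 1 0 0" and "2 * s + \<alpha> < 2"
  shows "hoelder_consts (time_pairs \<Omega>) dist (s + \<alpha>/2) (u c) \<noteq> {}"
    and "hoelder_seminorm (time_pairs \<Omega>) dist (s + \<alpha>/2) (u c)
      \<le> c * ((8 * radial_const (\<alpha>/2) 1 (s + \<alpha>/2) + 2) * (est_const TYPE('a) * N))"
proof -
  let ?K = "(8 * radial_const (\<alpha>/2) 1 (s + \<alpha>/2) + 2) * (est_const TYPE('a) * N)"
  have K: "0 \<le> c * ?K" using c s radial_const_nonneg[of "\<alpha>/2" "s + \<alpha>/2" 1] by (intro mult_nonneg_nonneg) auto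
  have le: "norm (u c p - u c q) \<le> c * ?K * dist p q powr (s + \<alpha>/2)" if pq_in: "(p, q) \<in> time_pairs \<Omega>" for p q
  proof -
    obtain x t t' where pq: "p = (x, t)" "q = (x, t')" and x: "norm x < 1" "\<bar>t\<bar> < 1" "\<bar>t'\<bar> < 1"
      using pq_in unfolding \<Omega> time_pairs_def
      by (cases p; cases q) (auto simp: mem_unit_cylinder)
    have "norm (u c p - u c q) = c * norm (w x t - w x t')"
      using c by (simp add: u_def pq abs_mult flip: right_diff_distrib)
    also have "\<dots> \<le> c * (?K * \<bar>t - t'\<bar> powr (s + \<alpha>/2))"
      using w_time_hoelder[of x t t'] x assms by (intro mult_left_mono) auto
    finally show ?thesis by (simp add: pq dist_Pair_Pair dist_real_def mult.assoc)
  qed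
  show "hoelder_consts (time_pairs \<Omega>) dist (s + \<alpha>/2) (u c) \<noteq> {}"
    by (rule hoelder_seminorm_bound(1)[OF K]) (rule le)
  show "hoelder_seminorm (time_pairs \<Omega>) dist (s + \<alpha>/2) (u c) \<le> c * ?K"
    by (rule hoelder_seminorm_bound(2)[OF K]) (rule le)
qed

text \<open>The path from (x,t) to (y,t') goes through (y,t): a space increment followed by a time
  increment, with both |x - y| and sqrt |t - t'| bounded by \<open>par_dist\<close>.\<close>

lemma u_par_hoelder:
  assumes c: "0 \<le> c" and \<Omega>: "\<Omega> = par_cylinder 1 0 0" and "2 * s + \<alpha> < 1"
  shows "hoelder_consts (\<Omega> \<times> \<Omega>) par_dist (2 * (s + \<alpha>/2)) (u c) \<noteq> {}"
    and "hoelder_seminorm (\<Omega> \<times> \<Omega>) par_dist (2 * (s + \<alpha>/2)) (u c) 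
      \<le> c * ((6 * radial_const (\<alpha>/2) (1/2) (s + \<alpha>/2) + (8 * radial_const (\<alpha>/2) 1 (s + \<alpha>/2) + 2)) * (est_const TYPE('a) * N))"
proof -
  define K1 where "K1 = 6 * radial_const (\<alpha>/2) (1/2) (s + \<alpha>/2) * (est_const TYPE('a) * N)"
  define K2 where "K2 = (8 * radial_const (\<alpha>/2) 1 (s + \<alpha>/2) + 2) * (est_const TYPE('a) * N)"
  have K: "0 \<le> K1" "0 \<le> K2" 
    using s radial_const_nonneg[of "\<alpha>/2" "s + \<alpha>/2" 1] radial_const_nonneg[of "\<alpha>/2" "s + \<alpha>/2" "1/2"]
    by (auto simp: K1_def K2_def intro!: mult_nonneg_nonneg)
  have le: "norm (u c p - u c q) \<le> c * (K1 + K2) * par_dist p q powr (2 * (s + \<alpha>/2))" if pq_in: "(p, q) \<in> \<Omega> \<times> \<Omega>" for p q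
  proof -
    obtain x t y t' where pq: "p = (x, t)" "q = (y, t')" 
        and x: "norm x < 1" "norm y < 1" "\<bar>t\<bar> < 1" "\<bar>t'\<bar> < 1"
      using pq_in unfolding \<Omega> by (cases p; cases q) (auto simp: mem_unit_cylinder)
    let ?D = "par_dist p q"
    have D: "norm (x - y) \<le> ?D" "sqrt \<bar>t - t'\<bar> \<le> ?D" by (auto simp: par_dist_def pq)
    have "norm (w x t - w y t) \<le> K1 * norm (x - y) powr (2 * s + \<alpha>)"
      using w_space_hoelder[of y x t] x assms by (simp add: K1_def)
    also have "\<dots> \<le> K1 * ?D powr (2 * s + \<alpha>)"
      using K D s \<alpha> by (intro mult_left_mono powr_mono2) auto
    finally have 1: "norm (w x t - w y t) \<le> K1 * ?D powr (2 * s + \<alpha>)" .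
    have "norm (w y t - w y t') \<le> K2 * \<bar>t - t'\<bar> powr (s + \<alpha>/2)"
      using w_time_hoelder[of y t t'] x assms by (simp add: K2_def)
    also have "\<bar>t - t'\<bar> powr (s + \<alpha>/2) = sqrt \<bar>t - t'\<bar> powr (2 * s + \<alpha>)"
      by (simp add: powr_half_sqrt[symmetric] powr_powr algebra_simps)
    also have "K2 * \<dots> \<le> K2 * ?D powr (2 * s + \<alpha>)"
      using K D s \<alpha> by (intro mult_left_mono powr_mono2) auto
    finally have 2: "norm (w y t - w y t') \<le> K2 * ?D powr (2 * s + \<alpha>)" .
    have "norm (u c p - u c q) = c * norm (w x t - w y t')"
      using c by (simp add: u_def pq abs_mult flip: right_diff_distrib)
    also have "\<dots> \<le> c * (K1 * ?D powr (2 * s + \<alpha>) + K2 * ?D powr (2 * s + \<alpha>))"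
      using 1 2 c by (intro mult_left_mono) auto
    finally show ?thesis by (simp add: algebra_simps)
  qed
  have K0: "0 \<le> c * (K1 + K2)" using K c by simp
  show "hoelder_consts (\<Omega> \<times> \<Omega>) par_dist (2 * (s + \<alpha>/2)) (u c) \<noteq> {}"
    by (rule hoelder_seminorm_bound(1)[OF K0]) (rule le)
  have "hoelder_seminorm (\<Omega> \<times> \<Omega>) par_dist (2 * (s + \<alpha>/2)) (u c) \<le> c * (K1 + K2)"
    by (rule hoelder_seminorm_bound(2)[OF K0]) (rule le)
  then show "hoelder_seminorm (\<Omega> \<times> \<Omega>) par_dist (2 * (s + \<alpha>/2)) (u c) 
      \<le> c * ((6 * radial_const (\<alpha>/2) (1/2) (s + \<alpha>/2) + (8 * radial_const (\<alpha>/2) 1 (s + \<alpha>/2) + 2)) * (est_const TYPE('a) * N))"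
    by (simp add: K1_def K2_def distrib_right)
qed

lemma u_space_loglip:
  assumes c: "0 \<le> c" and \<Omega>: "\<Omega> = par_cylinder 1 0 0" and "2 * s + \<alpha> = 1"
  shows "bdd_above (loglip_quotients (space_pairs \<Omega>) (u c))"
    and "loglip_seminorm (space_pairs \<Omega>) (u c) \<le> c * (24 * radial_const (\<alpha>/2) (1/2) (1/2) * (est_const TYPE('a) * N))"
proof -
  let ?K = "24 * radial_const (\<alpha>/2) (1/2) (1/2) * (est_const TYPE('a) * N)"
  obtain b :: 'a where b: "b \<in> Basis" using nonempty_Basis by blast
  have le: "norm (u c p - u c q) \<le> c * ?K * log_modulus (dist p q)" if pq_in: "(p, q) \<in> space_pairs \<Omega>" "p \<noteq> q" for p q
  proof -
    obtain x y t where pq: "p = (x, t)" "q = (y, t)" "x \<noteq> y" and x: "norm x < 1" "norm y < 1" "\<bar>t\<bar> < 1"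
      using pq_in unfolding \<Omega> space_pairs_def
      by (cases p; cases q) (auto simp: mem_unit_cylinder)
    have "norm (u c p - u c q) = c * norm (w x t - w y t)"
      using c by (simp add: u_def pq abs_mult flip: right_diff_distrib)
    also have "\<dots> \<le> c * (?K * log_modulus (norm (x - y)))"
      using w_space_loglip[of y x t] x assms pq by (intro mult_left_mono) auto
    finally show ?thesis by (simp add: pq dist_Pair_Pair dist_norm mult.assoc)
  qed
  show "bdd_above (loglip_quotients (space_pairs \<Omega>) (u c))"
    by (rule loglip_seminorm_bound(1)[OF unit_cylinder_pairs(1,2)[OF b, folded \<Omega>]]) (rule le)
  show "loglip_seminorm (space_pairs \<Omega>) (u c) \<le> c * ?K"
    by (rule loglip_seminorm_bound(2)[OF unit_cylinder_pairs(1,2)[OF b, folded \<Omega>]]) (rule le)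
qed

lemma u_time_loglip:
  assumes c: "0 \<le> c" and \<Omega>: "\<Omega> = par_cylinder 1 0 0" and "2 * s + \<alpha> = 2"
  shows "bdd_above (loglip_quotients (time_pairs \<Omega>) (u c))"
    and "loglip_seminorm (time_pairs \<Omega>) (u c) \<le> c * ((32 * radial_const (\<alpha>/2) 1 1 + 4) * (est_const TYPE('a) * N))"
proof -
  let ?K = "(32 * radial_const (\<alpha>/2) 1 1 + 4) * (est_const TYPE('a) * N)"
  obtain b :: 'a where b: "b \<in> Basis" using nonempty_Basis by blast
  have le: "norm (u c p - u c q) \<le> c * ?K * log_modulus (dist p q)" if pq_in: "(p, q) \<in> time_pairs \<Omega>" "p \<noteq> q" for p q
  proof -
    obtain x t t' where pq: "p = (x, t)" "q = (x, t')" "t \<noteq> t'" and x: "norm x < 1" "\<bar>t\<bar> < 1" "\<bar>t'\<bar> < 1"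
      using pq_in unfolding \<Omega> time_pairs_def
      by (cases p; cases q) (auto simp: mem_unit_cylinder)
    have "norm (u c p - u c q) = c * norm (w x t - w x t')"
      using c by (simp add: u_def pq abs_mult flip: right_diff_distrib)
    also have "\<dots> \<le> c * (?K * log_modulus \<bar>t - t'\<bar>)"
      using w_time_loglip[of x t t'] x assms pq by (intro mult_left_mono) auto
    finally show ?thesis by (simp add: pq dist_Pair_Pair dist_real_def mult.assoc)
  qed
  show "bdd_above (loglip_quotients (time_pairs \<Omega>) (u c))"
    by (rule loglip_seminorm_bound(1)[OF unit_cylinder_pairs(3,4)[OF b, folded \<Omega>]]) (rule le)
  show "loglip_seminorm (time_pairs \<Omega>) (u c) \<le> c * ?K"
    by (rule loglip_seminorm_bound(2)[OF unit_cylinder_pairs(3,4)[OF b, folded \<Omega>]]) (rule le)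
qed

lemma u_GDERIV:
  assumes "norm x < 1" "\<bar>t\<bar> < 1" "1 < 2 * s + \<alpha>" "2 * s + \<alpha> \<le> 2"
  shows "GDERIV (\<lambda>y. u c (y, t)) x :> c *\<^sub>R Dw x t"
  using has_derivative_mult_right[OF w_GDERIV[unfolded gderiv_def], of x t c] assms
  by (simp add: gderiv_def u_def)

lemma u_has_grad:
  assumes "1 < 2 * s + \<alpha>" "2 * s + \<alpha> \<le> 2"
  shows "has_grad_on (par_cylinder 1 0 0) (u c)"
  using u_GDERIV assms by (fastforce simp: has_grad_on_def mem_unit_cylinder)

lemma grad_u:
  assumes "norm x < 1" "\<bar>t\<bar> < 1" "1 < 2 * s + \<alpha>" "2 * s + \<alpha> \<le> 2"
  shows "grad_x (u c) (x, t) = c *\<^sub>R Dw x t"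
  by (rule grad_x_eq[OF u_GDERIV[OF assms]])

lemma grad_u_bounds:
  assumes c: "0 \<le> c" and \<Omega>: "\<Omega> = par_cylinder 1 0 0" and e: "1 < 2 * s + \<alpha>" "2 * s + \<alpha> \<le> 2"
  shows "bounded (grad_x (u c) ` \<Omega>)"
    and "sup_norm \<Omega> (grad_x (u c)) \<le> c * (2 * (est_const TYPE('a) * N) * (\<integral>r. radial 0 2 (s + \<alpha>/2 - 1/2) 4 r \<partial>lborel))"
proof -
  let ?K = "2 * (est_const TYPE('a) * N) * (\<integral>r. radial 0 2 (s + \<alpha>/2 - 1/2) 4 r \<partial>lborel)"
  have ne: "\<Omega> \<noteq> {}" using mem_unit_cylinder[of 0 0] unfolding \<Omega> by auto
  have le: "norm (grad_x (u c) p) \<le> c * ?K" if "p \<in> \<Omega>" for p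
    using Dw_bound[of "snd p" "fst p"] that c e
    by (cases p) (auto simp: grad_u \<Omega> mem_unit_cylinder abs_mult intro!: mult_left_mono)
  show "bounded (grad_x (u c) ` \<Omega>)"
    by (rule sup_norm_bound(1)[OF ne]) (rule le)
  show "sup_norm \<Omega> (grad_x (u c)) \<le> c * ?K"
    by (rule sup_norm_bound(2)[OF ne]) (rule le)
qed

lemma grad_u_space_hoelder:
  assumes c: "0 \<le> c" and \<Omega>: "\<Omega> = par_cylinder 1 0 0" and e: "1 < 2 * s + \<alpha>" "2 * s + \<alpha> < 2"
  shows "hoelder_consts (space_pairs \<Omega>) dist (2 * (s + \<alpha>/2) - 1) (grad_x (u c)) \<noteq> {}"
    and "hoelder_seminorm (space_pairs \<Omega>) dist (2 * (s + \<alpha>/2) - 1) (grad_x (u c))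
      \<le> c * (4 * radial_const 0 (1/2) (s + \<alpha>/2 - 1/2) * (est_const TYPE('a) * N))"
proof -
  let ?K = "4 * radial_const 0 (1/2) (s + \<alpha>/2 - 1/2) * (est_const TYPE('a) * N)"
  have K: "0 \<le> c * ?K" using c e radial_const_nonneg[of 0 "s + \<alpha>/2 - 1/2" "1/2"] by (intro mult_nonneg_nonneg) auto
  have le: "norm (grad_x (u c) p - grad_x (u c) q) \<le> c * ?K * dist p q powr (2 * (s + \<alpha>/2) - 1)" if pq_in: "(p, q) \<in> space_pairs \<Omega>" for p q
  proof -
    obtain x y t where pq: "p = (x, t)" "q = (y, t)" and x: "norm x < 1" "norm y < 1" "\<bar>t\<bar> < 1"
      using pq_in unfolding \<Omega> space_pairs_def
      by (cases p; cases q) (auto simp: mem_unit_cylinder)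
    have "norm (grad_x (u c) p - grad_x (u c) q) = c * norm (Dw x t - Dw y t)"
      using c x e by (simp add: grad_u pq flip: scaleR_diff_right)
    also have "\<dots> \<le> c * (?K * norm (x - y) powr (2 * s + \<alpha> - 1))"
      using Dw_space_hoelder[of y x t] x assms by (intro mult_left_mono) auto
    finally show ?thesis by (simp add: pq dist_Pair_Pair dist_norm mult.assoc)
  qed
  show "hoelder_consts (space_pairs \<Omega>) dist (2 * (s + \<alpha>/2) - 1) (grad_x (u c)) \<noteq> {}"
    by (rule hoelder_seminorm_bound(1)[OF K]) (rule le)
  show "hoelder_seminorm (space_pairs \<Omega>) dist (2 * (s + \<alpha>/2) - 1) (grad_x (u c)) \<le> c * ?K"
    by (rule hoelder_seminorm_bound(2)[OF K]) (rule le)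
qed

lemma grad_u_space_loglip:
  assumes c: "0 \<le> c" and \<Omega>: "\<Omega> = par_cylinder 1 0 0" and e: "2 * s + \<alpha> = 2"
  shows "bdd_above (loglip_quotients (space_pairs \<Omega>) (grad_x (u c)))"
    and "loglip_seminorm (space_pairs \<Omega>) (grad_x (u c)) \<le> c * (16 * radial_const 0 (1/2) (1/2) * (est_const TYPE('a) * N))"
proof -
  let ?K = "16 * radial_const 0 (1/2) (1/2) * (est_const TYPE('a) * N)"
  obtain b :: 'a where b: "b \<in> Basis" using nonempty_Basis by blast
  have le: "norm (grad_x (u c) p - grad_x (u c) q) \<le> c * ?K * log_modulus (dist p q)" if pq_in: "(p, q) \<in> space_pairs \<Omega>" "p \<noteq> q" for p q
  proof -
    obtain x y t where pq: "p = (x, t)" "q = (y, t)" "x \<noteq> y" and x: "norm x < 1" "norm y < 1" "\<bar>t\<bar> < 1"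
      using pq_in unfolding \<Omega> space_pairs_def
      by (cases p; cases q) (auto simp: mem_unit_cylinder)
    have "norm (grad_x (u c) p - grad_x (u c) q) = c * norm (Dw x t - Dw y t)"
      using c x e by (simp add: grad_u pq flip: scaleR_diff_right)
    also have "\<dots> \<le> c * (?K * log_modulus (norm (x - y)))"
      using Dw_space_loglip[of y x t] x assms pq by (intro mult_left_mono) auto
    finally show ?thesis by (simp add: pq dist_Pair_Pair dist_norm mult.assoc)
  qed
  show "bdd_above (loglip_quotients (space_pairs \<Omega>) (grad_x (u c)))"
    by (rule loglip_seminorm_bound(1)[OF unit_cylinder_pairs(1,2)[OF b, folded \<Omega>]]) (rule le)
  show "loglip_seminorm (space_pairs \<Omega>) (grad_x (u c)) \<le> c * ?K"
    by (rule loglip_seminorm_bound(2)[OF unit_cylinder_pairs(1,2)[OF b, folded \<Omega>]]) (rule le)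
qed

lemma grad_u_time_hoelder:
  assumes c: "0 \<le> c" and \<Omega>: "\<Omega> = par_cylinder 1 0 0" and e: "1 < 2 * s + \<alpha>" "2 * s + \<alpha> < 2"
  shows "hoelder_consts (time_pairs \<Omega>) dist (s + \<alpha>/2 - 1/2) (grad_x (u c)) \<noteq> {}"
    and "hoelder_seminorm (time_pairs \<Omega>) dist (s + \<alpha>/2 - 1/2) (grad_x (u c))
      \<le> c * (2 * radial_const 0 1 (s + \<alpha>/2 - 1/2) * (est_const TYPE('a) * N))"
proof -
  let ?K = "2 * radial_const 0 1 (s + \<alpha>/2 - 1/2) * (est_const TYPE('a) * N)"
  have K: "0 \<le> c * ?K" using c e radial_const_nonneg[of 0 "s + \<alpha>/2 - 1/2" 1] by (intro mult_nonneg_nonneg) auto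
  have le: "norm (grad_x (u c) p - grad_x (u c) q) \<le> c * ?K * dist p q powr (s + \<alpha>/2 - 1/2)" if pq_in: "(p, q) \<in> time_pairs \<Omega>" for p q
  proof -
    obtain x t t' where pq: "p = (x, t)" "q = (x, t')" and x: "norm x < 1" "\<bar>t\<bar> < 1" "\<bar>t'\<bar> < 1"
      using pq_in unfolding \<Omega> time_pairs_def
      by (cases p; cases q) (auto simp: mem_unit_cylinder)
    have "norm (grad_x (u c) p - grad_x (u c) q) = c * norm (Dw x t - Dw x t')"
      using c x e by (simp add: grad_u pq flip: scaleR_diff_right)
    also have "\<dots> \<le> c * (?K * \<bar>t - t'\<bar> powr (s + \<alpha>/2 - 1/2))"
      using Dw_time_hoelder[of x t t'] x assms by (intro mult_left_mono) auto
    finally show ?thesis by (simp add: pq dist_Pair_Pair dist_real_def mult.assoc)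
  qed
  show "hoelder_consts (time_pairs \<Omega>) dist (s + \<alpha>/2 - 1/2) (grad_x (u c)) \<noteq> {}"
    by (rule hoelder_seminorm_bound(1)[OF K]) (rule le)
  show "hoelder_seminorm (time_pairs \<Omega>) dist (s + \<alpha>/2 - 1/2) (grad_x (u c)) \<le> c * ?K"
    by (rule hoelder_seminorm_bound(2)[OF K]) (rule le)
qed

end

section \<open>The zero extension as an admissible source\<close>

lemma source_term_zero_ext:
  fixes f :: "'a::euclidean_space \<times> real \<Rightarrow> real"
  assumes s: "0 < s" "s < 1" and \<alpha>: "0 < \<alpha>" "\<alpha> < 1" and Q: "Q = par_cylinder 2 0 0"
    and f: "f \<in> par_hoelder (\<alpha>/2) Q"
  shows "source_term s \<alpha> (par_hoelder_norm (\<alpha>/2) Q f) (zero_ext Q f)"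
proof -
  define M where "M = sup_norm Q f"
  define L where "L = hoelder_seminorm (Q \<times> Q) par_dist \<alpha> f"
  \<comment> \<open>Both summands serve: \<open>L\<close> for two points of the cylinder,
    \<open>M\<close> when one of them lies outside.\<close>
  have N: "par_hoelder_norm (\<alpha>/2) Q f = M + L" using \<alpha> by (simp add: par_hoelder_norm_def M_def L_def)
  have f': "bounded (f ` Q)" "hoelder_consts (Q \<times> Q) par_dist \<alpha> f \<noteq> {}" using f \<alpha> by (auto simp: par_hoelder_def)
  \<comment> \<open>The radius 2 gives the time half-width 2^2 = 4, the 4 of
    \<open>source_term\<close>.\<close>
  have memQ: "(x, t) \<in> Q \<longleftrightarrow> norm x < 2 \<and> \<bar>t\<bar> < 4" for x t by (simp add: Q par_cylinder_def)
  have bdd: "bdd_above ((\<lambda>p. norm (f p)) ` Q)" using f'(1) by (auto simp: bounded_iff bdd_above_def)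
  have M: "\<bar>f p\<bar> \<le> M" if "p \<in> Q" for p
    unfolding M_def sup_norm_def real_norm_def[symmetric] by (rule cSUP_upper[OF that bdd])
  have "0 \<le> \<bar>f (0, 0)\<bar>" by simp
  also have "\<dots> \<le> M" by (rule M) (simp add: memQ)
  finally have M0: "0 \<le> M" .
  have L0: "0 \<le> L" unfolding L_def by (rule hoelder_seminorm_attained[OF f'(2)])
  have L: "\<bar>f p - f q\<bar> \<le> L * par_dist p q powr \<alpha>" if "p \<in> Q" "q \<in> Q" for p q
    using hoelder_seminorm_attained(2)[OF f'(2), of p q] that by (simp add: L_def)
  let ?g = "zero_ext Q f"
  have Qopen: "open Q"
  proof -
    have "Q = ball 0 2 \<times> {-4<..<4}" by (auto simp: memQ)
    then show ?thesis by (simp add: open_Times)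
  qed
  \<comment> \<open>Hoelder continuity gives continuity on the open set \<open>Q\<close>, and this
    makes the zero extension Borel measurable although it may jump at the boundary.\<close>
  have cont: "continuous_on Q f"
    unfolding continuous_on_def
  proof
    fix p assume p: "p \<in> Q"
    have "((\<lambda>q. L * par_dist q p powr \<alpha>) \<longlongrightarrow> L * par_dist p p powr \<alpha>) (at p within Q)"
      unfolding par_dist_def using \<alpha>
      by (intro tendsto_intros tendsto_powr') (auto simp: par_dist_def)
    then have "((\<lambda>q. L * par_dist q p powr \<alpha>) \<longlongrightarrow> 0) (at p within Q)" by (simp add: par_dist_def)
    moreover have "\<forall>\<^sub>F q in at p within Q. norm (f q - f p) \<le> L * par_dist q p powr \<alpha>"
      unfolding eventually_at_filter by (rule always_eventually) (use L p in auto)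
    ultimately show "(f \<longlongrightarrow> f p) (at p within Q)" 
      by (subst Lim_null) (rule Lim_null_comparison[rotated])
  qed
  have meas: "?g \<in> borel_measurable borel"
  proof -
    have "(\<lambda>p. indicator Q p *\<^sub>R f p) \<in> borel_measurable borel"
      using Qopen cont by (intro borel_measurable_continuous_on_indicator) auto
    moreover have "?g = (\<lambda>p. indicator Q p *\<^sub>R f p)" by (auto simp: zero_ext_def indicator_def)
    ultimately show ?thesis by simp
  qed
  have g_le: "\<bar>?g p\<bar> \<le> M" for p using M M0 by (simp add: zero_ext_def)
  show ?thesis unfolding N
  proof
    show "\<bar>?g p\<bar> \<le> M + L" for p using g_le[of p] L0 by linarith
    show "?g (y, \<tau>) = 0" if "4 \<le> \<bar>\<tau>\<bar>" for y \<tau> using that by (simp add: zero_ext_def memQ)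
    show "\<bar>?g (y, \<tau>) - ?g (x, \<tau>)\<bar> \<le> (M + L) * norm (x - y) powr \<alpha>" if x: "norm x < 1" for x y \<tau>
    proof (cases "\<bar>\<tau>\<bar> < 4 \<and> norm y < 2")
      case True
      then have "\<bar>?g (y, \<tau>) - ?g (x, \<tau>)\<bar> \<le> L * norm (x - y) powr \<alpha>"
        using L[of "(y, \<tau>)" "(x, \<tau>)"] x by (simp add: zero_ext_def memQ par_dist_def norm_minus_commute)
      also have "\<dots> \<le> (M + L) * norm (x - y) powr \<alpha>" using M0 by (intro mult_right_mono) auto
      finally show ?thesis .
    next
      case False
      then have y0: "?g (y, \<tau>) = 0" by (auto simp: zero_ext_def memQ)
      show ?thesis
      proof (cases "\<bar>\<tau>\<bar> < 4")
        case True
        then have "1 \<le> norm (x - y)" using x False norm_triangle_sub[of y x] by (auto simp: norm_minus_commute)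
        then have "M * 1 \<le> (M + L) * norm (x - y) powr \<alpha>"
          using M0 L0 \<alpha> by (intro mult_mono ge_one_powr_ge_zero) auto
        then show ?thesis using g_le[of "(x, \<tau>)"] y0 by simp
      next
        case False
        \<comment> \<open>Both points share the time \<tau>, so outside the time interval both
          values vanish.\<close>
        then have "?g (x, \<tau>) = 0" by (auto simp: zero_ext_def memQ)
        then show ?thesis using y0 M0 L0 by simp
      qed
    qed
    show "\<bar>?g (x, \<tau>) - ?g (x, \<tau>')\<bar> \<le> (M + L) * \<bar>\<tau> - \<tau>'\<bar> powr (\<alpha>/2)"
      if "norm x < 1" "\<bar>\<tau>\<bar> < 4" "\<bar>\<tau>'\<bar> < 4" for x \<tau> \<tau>'
    proof -
      \<comment> \<open>For equal space points \<open>par_dist\<close> is the square root of the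
        time difference, which halves the exponent.\<close>
      have "\<bar>?g (x, \<tau>) - ?g (x, \<tau>')\<bar> \<le> L * \<bar>\<tau> - \<tau>'\<bar> powr (\<alpha>/2)"
        using L[of "(x, \<tau>)" "(x, \<tau>')"] that 
        by (simp add: zero_ext_def memQ par_dist_def powr_half_sqrt[symmetric] powr_powr)
      also have "\<dots> \<le> (M + L) * \<bar>\<tau> - \<tau>'\<bar> powr (\<alpha>/2)" using M0 by (intro mult_right_mono) auto
      finally show ?thesis .
    qed
  qed (use s \<alpha> meas in auto)
qed

section \<open>The normalized kernel and its potential\<close>

definition kernel_const :: "'n::finite itself \<Rightarrow> real \<Rightarrow> real" where
  "kernel_const _ s = 1 / ((4 * pi) powr (real CARD('n) / 2) * \<bar>Gamma (- s)\<bar>)"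

lemma kernel_G_eq: "kernel_G s x t = kernel_const TYPE('n::finite) s * hk s (x :: real ^ 'n) t"
proof (cases "t > 0")
  case True
  have "t powr (s - 1) * t powr (- (real CARD('n) / 2)) = 1 / t powr (real CARD('n) / 2 + 1 - s)"
    unfolding powr_add[symmetric] powr_minus_divide[symmetric] by (rule arg_cong[where f="(powr) t"]) simp
  then show ?thesis using True
    by (simp add: kernel_G_def kernel_const_def hk_def gauss_def mult.assoc[symmetric])
qed (simp add: kernel_G_def hk_def)

lemma heat_potential_eq:
  fixes g :: "(real ^ 'n::finite) \<times> real \<Rightarrow> real"
  assumes "source_term s \<alpha> N g"
  shows "heat_potential s g = source_term.u s g (kernel_const TYPE('n) s)"
proof -
  interpret source_term s \<alpha> N g by fact
  let ?c = "kernel_const TYPE('n) s"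
  have "(\<integral>\<tau>. indicator {..<t} \<tau> *\<^sub>R (\<integral>y. g (y, \<tau>) * kernel_G s (x - y) (t - \<tau>) \<partial>lborel) \<partial>lborel) = ?c * w x t" for x t
  proof -
    have "(\<integral>y. g (y, \<tau>) * kernel_G s (x - y) (t - \<tau>) \<partial>lborel) = ?c * J x t \<tau>" for \<tau>
      by (simp add: kernel_G_eq J_def mult.left_commute)
    \<comment> \<open>\<open>J\<close> vanishes at source times \<tau> \<ge> t, so integrating over
      the past of \<open>t\<close> agrees with integrating over the whole line.\<close>
    moreover have "indicator {..<t} \<tau> * (?c * J x t \<tau>) = ?c * J x t \<tau>" for \<tau>
      using J_zero[of t \<tau> x] by (cases "\<tau> < t") auto
    ultimately show ?thesis by (simp only: real_scaleR_def w_def integral_mult_right_zero)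
  qed
  then show ?thesis by (simp add: heat_potential_def u_def set_lebesgue_integral_def)
qed

text \<open>Replaces a sum of constants by a strictly positive one without tracking signs.\<close>

lemma le_abs_add_one_mult:
  fixes X K N :: real
  assumes "X \<le> K * N" "0 \<le> N"
  shows "X \<le> (\<bar>K\<bar> + 1) * N"
proof -
  have "K * N \<le> (\<bar>K\<bar> + 1) * N" using assms(2) by (intro mult_right_mono) auto
  with assms(1) show ?thesis by linarith
qed

theorem theorem6:
  fixes s \<alpha> :: real
    and Q Qt :: "((real ^ 'n::finite) \<times> real) set"
  assumes "0 < s" "s < 1" "0 < \<alpha>" "\<alpha> < 1"
    and "Q = par_cylinder 2 0 0" "Qt = par_cylinder 1 0 0"
  shows "\<exists>C>0. \<forall>f\<in>par_hoelder (\<alpha> / 2) Q. \<forall>w. w = heat_potential s (zero_ext Q f) \<longrightarrow>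
     ((2 * s + \<alpha> < 1 \<or> (1 < 2 * s + \<alpha> \<and> 2 * s + \<alpha> < 2)) \<longrightarrow>
        w \<in> par_hoelder (s + \<alpha> / 2) Qt \<and>
        par_hoelder_norm (s + \<alpha> / 2) Qt w \<le> C * par_hoelder_norm (\<alpha> / 2) Q f) \<and>
     (2 * s + \<alpha> = 1 \<longrightarrow>
        w \<in> par_loglip (s + \<alpha> / 2) Qt \<and>
        par_loglip_norm (s + \<alpha> / 2) Qt w \<le> C * par_hoelder_norm (\<alpha> / 2) Q f) \<and>
     (2 * s + \<alpha> = 2 \<longrightarrow>
        w \<in> par_C1_loglip Qt \<and>
        par_C1_loglip_norm Qt w \<le> C * par_hoelder_norm (\<alpha> / 2) Q f)"
proof -
  let ?N = "par_hoelder_norm (\<alpha> / 2) Q"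
  let ?E = "est_const TYPE(real ^ 'n)"
  define c where "c = kernel_const TYPE('n) s"
  have c: "0 \<le> c" by (simp add: c_def kernel_const_def)
  have src: "source_term s \<alpha> (?N f) (zero_ext Q f)" if "f \<in> par_hoelder (\<alpha> / 2) Q" for f
    by (rule source_term_zero_ext[OF assms(1-5) that])
  have heat: "heat_potential s (zero_ext Q f) = source_term.u s (zero_ext Q f) c" if "f \<in> par_hoelder (\<alpha> / 2) Q" for f
    unfolding c_def by (rule heat_potential_eq[OF src[OF that]])
  define K0 where "K0 = c * (2 * ?E * (\<integral>r. radial 0 2 s 4 r \<partial>lborel))"
  define K1 where "K1 = c * ((8 * radial_const (\<alpha>/2) 1 (s + \<alpha>/2) + 2) * ?E)"
  define K2 where "K2 = c * (2 * ?E * (\<integral>r. radial 0 2 (s + \<alpha>/2 - 1/2) 4 r \<partial>lborel))"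
  \<comment> \<open>The regime depends on \<open>s\<close> and \<alpha> only, so the constant can be
    chosen within each case before the source is given.\<close>
  consider (lt1) "2 * s + \<alpha> < 1" | (eq1) "2 * s + \<alpha> = 1" | (lt2) "1 < 2 * s + \<alpha>" "2 * s + \<alpha> < 2"
    | (eq2) "2 * s + \<alpha> = 2" | (gt2) "2 < 2 * s + \<alpha>"
    by linarith
  then show ?thesis
  proof cases
    case lt1
    define K where "K = K0 + c * ((6 * radial_const (\<alpha>/2) (1/2) (s + \<alpha>/2) + (8 * radial_const (\<alpha>/2) 1 (s + \<alpha>/2) + 2)) * ?E)"
    have "source_term.u s (zero_ext Q f) c \<in> par_hoelder (s + \<alpha>/2) Qt
        \<and> par_hoelder_norm (s + \<alpha>/2) Qt (source_term.u s (zero_ext Q f) c) \<le> (\<bar>K\<bar> + 1) * ?N f"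
      if "f \<in> par_hoelder (\<alpha> / 2) Q" for f
    proof -
      interpret source_term s \<alpha> "?N f" "zero_ext Q f" by (rule src[OF that])
      note b = u_bounds[OF c assms(6)] and h = u_par_hoelder[OF c assms(6) lt1]
      have "sup_norm Qt (u c) + hoelder_seminorm (Qt \<times> Qt) par_dist (2 * (s + \<alpha>/2)) (u c) \<le> K * ?N f"
        using add_mono[OF b(2) h(2)] by (simp add: K_def K0_def algebra_simps)
      from le_abs_add_one_mult[OF this N_nonneg] b(1) h(1) lt1 show ?thesis
        by (simp add: par_hoelder_def par_hoelder_norm_def)
    qed
    then show ?thesis using lt1 heat by (intro exI[of _ "\<bar>K\<bar> + 1"]) auto
  next
    case eq1
    define K where "K = K0 + c * (24 * radial_const (\<alpha>/2) (1/2) (1/2) * ?E) + K1"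
    have "source_term.u s (zero_ext Q f) c \<in> par_loglip (s + \<alpha>/2) Qt
        \<and> par_loglip_norm (s + \<alpha>/2) Qt (source_term.u s (zero_ext Q f) c) \<le> (\<bar>K\<bar> + 1) * ?N f"
      if "f \<in> par_hoelder (\<alpha> / 2) Q" for f
    proof -
      interpret source_term s \<alpha> "?N f" "zero_ext Q f" by (rule src[OF that])
      \<comment> \<open>Only the space modulus is borderline at 2s + \<alpha> = 1; in time the
        threshold is s + \<alpha>/2 = 1, so the Hoelder bound persists.\<close>
      have "2 * s + \<alpha> < 2" using eq1 by simp
      note b = u_bounds[OF c assms(6)] and l = u_space_loglip[OF c assms(6) eq1]
        and h = u_time_hoelder[OF c assms(6) this]
      have "par_loglip_norm (s + \<alpha>/2) Qt (u c) \<le> K * ?N f"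
        using add_mono[OF add_mono[OF b(2) l(2)] h(2)]
        by (simp add: par_loglip_norm_def K_def K0_def K1_def algebra_simps)
      from le_abs_add_one_mult[OF this N_nonneg] b(1) l(1) h(1) show ?thesis
        by (simp add: par_loglip_def)
    qed
    then show ?thesis using eq1 heat by (intro exI[of _ "\<bar>K\<bar> + 1"]) auto
  next
    case lt2
    define K where "K = K0 + K2 + K1 + c * (4 * radial_const 0 (1/2) (s + \<alpha>/2 - 1/2) * ?E)
       + c * (2 * radial_const 0 1 (s + \<alpha>/2 - 1/2) * ?E)"
    have "source_term.u s (zero_ext Q f) c \<in> par_hoelder (s + \<alpha>/2) Qt
        \<and> par_hoelder_norm (s + \<alpha>/2) Qt (source_term.u s (zero_ext Q f) c) \<le> (\<bar>K\<bar> + 1) * ?N f"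
      if "f \<in> par_hoelder (\<alpha> / 2) Q" for f
    proof -
      interpret source_term s \<alpha> "?N f" "zero_ext Q f" by (rule src[OF that])
      have le: "2 * s + \<alpha> \<le> 2" using lt2 by simp
      note b = u_bounds[OF c assms(6)] and g = grad_u_bounds[OF c assms(6) lt2(1) le]
        and h = u_time_hoelder[OF c assms(6) lt2(2)]
        and gs = grad_u_space_hoelder[OF c assms(6) lt2] and gt = grad_u_time_hoelder[OF c assms(6) lt2]
      have "sup_norm Qt (u c) + sup_norm Qt (grad_x (u c)) + hoelder_seminorm (time_pairs Qt) dist (s + \<alpha>/2) (u c)
          + hoelder_seminorm (space_pairs Qt) dist (2 * (s + \<alpha>/2) - 1) (grad_x (u c))
          + hoelder_seminorm (time_pairs Qt) dist (s + \<alpha>/2 - 1/2) (grad_x (u c)) \<le> K * ?N f"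
        using add_mono[OF add_mono[OF add_mono[OF add_mono[OF b(2) g(2)] h(2)] gs(2)] gt(2)]
        by (simp add: K_def K0_def K1_def K2_def algebra_simps)
      from le_abs_add_one_mult[OF this N_nonneg] b(1) g(1) h(1) gs(1) gt(1) u_has_grad[OF lt2(1) le, folded assms(6)] lt2
      show ?thesis
        by (simp add: par_hoelder_def par_hoelder_norm_def)
    qed
    then show ?thesis using lt2 heat by (intro exI[of _ "\<bar>K\<bar> + 1"]) auto
  next
    case eq2
    define K where "K = K0 + K2 + c * (16 * radial_const 0 (1/2) (1/2) * ?E) + c * ((32 * radial_const (\<alpha>/2) 1 1 + 4) * ?E)"
    have "source_term.u s (zero_ext Q f) c \<in> par_C1_loglip Qt
        \<and> par_C1_loglip_norm Qt (source_term.u s (zero_ext Q f) c) \<le> (\<bar>K\<bar> + 1) * ?N f"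
      if "f \<in> par_hoelder (\<alpha> / 2) Q" for f
    proof -
      interpret source_term s \<alpha> "?N f" "zero_ext Q f" by (rule src[OF that])
      have le: "1 < 2 * s + \<alpha>" "2 * s + \<alpha> \<le> 2" using eq2 by simp_all
      note b = u_bounds[OF c assms(6)] and g = grad_u_bounds[OF c assms(6) le]
        and gs = grad_u_space_loglip[OF c assms(6) eq2] and h = u_time_loglip[OF c assms(6) eq2]
      have "par_C1_loglip_norm Qt (u c) \<le> K * ?N f"
        using add_mono[OF add_mono[OF add_mono[OF b(2) g(2)] gs(2)] h(2)]
        by (simp add: par_C1_loglip_norm_def K_def K0_def K2_def algebra_simps)
      from le_abs_add_one_mult[OF this N_nonneg] b(1) g(1) gs(1) h(1) u_has_grad[OF le, folded assms(6)]
      show ?thesis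
        by (simp add: par_C1_loglip_def)
    qed
    then show ?thesis using eq2 heat by (intro exI[of _ "\<bar>K\<bar> + 1"]) auto
  next
    case gt2
    \<comment> \<open>All three implications are vacuous, so any positive constant will do.\<close>
    then show ?thesis by (intro exI[of _ 1]) auto
  qed
qed

end
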